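(* Let $d\ge3$ and $1\le k<d$ be integers. Let $X\subseteq\mathbb{R}^d$ be a compact set with $0<\dim_{\mathrm H}X<d$ which supports a $(C,\alpha)$-uniformly affinely non-concentrated Borel measure (for some $C\ge1$, $\alpha>0$). Write $$B(u)=k(d-k)+\inf_{\theta\in(0,1]}\frac{u-\dim_{\mathrm F}^{\theta}X}{\theta}.$$ Then for all sufficiently small $u>0$, $$\dim_{\mathrm H}\{V\in G(d,k):\dim_{\mathrm H}P_V(X)<u\}\le\max\{0,B(u)\},$$ where $B(u)$ is strictly smaller than both the Peres--Schlag bound and the Mattila bound, i.e. $$B(u)<k(d-k)+u-\dim_{\mathrm H}X\qquad\text{and}\qquad B(u)<k(d-k-1)+u.$$
   Context: $G(d,k)$ is the Grassmannian of $k$-dimensional linear subspaces $V$ of $\mathbb{R}^d$, with its usual metric (e.g. $\|P_V-P_W\|$), with respect to which Hausdorff dimensions of its subsets are taken. $P_V:\mathbb{R}^d\to V$ is orthogonal projection. $\dim_{\mathrm H}$ is Hausdorff dimension, with $\dim_{\mathrm H}\varnothing=0$. For $X\subseteq\mathbb{R}^d$, $\mathcal M(X)$ is the set of Borel measures $\mu$ compactly supported on $X$ with $0<\mu(X)<\infty$; "$X$ supports a measure" means the measure belongs to $\mathcal M(X)$. A Borel measure $\mu$ on $\mathbb{R}^d$ is $(C,\alpha)$-uniformly affinely non-concentrated, where $C\ge1$ and $\alpha>0$, if for every $\varepsilon>0$, $x\in\operatorname{spt}\mu$, $0<r\le1$ and every affine hyperplane $W\subseteq\mathbb{R}^d$,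 $$\mu\big(W^{(\varepsilon r)}\cap B(x,r)\big)\le C\varepsilon^{\alpha}\mu\big(B(x,r)\big),$$ where $W^{(\rho)}$ is the $\rho$-neighbourhood of $W$ and $B(x,r)$ is the ball of centre $x$ and radius $r$. The Fourier transform is $\widehat\mu(z)=\int e^{-2\pi i z\cdot x}\,d\mu(x)$. For $\mu\in\mathcal M(\mathbb{R}^d)$ and $\theta\in(0,1]$ put $$\mathcal J_{s,\theta}(\mu)=\Big(\int_{\mathbb{R}^d}|\widehat\mu(z)|^{2/\theta}|z|^{s/\theta-d}\,dz\Big)^{\theta}.$$ The Fourier spectrum of $\mu$ at $\theta$ is $\dim_{\mathrm F}^{\theta}\mu=\sup\{s\in\mathbb{R}:\mathcal J_{s,\theta}(\mu)<\infty\}$, and of a Borel set $X\subseteq\mathbb{R}^d$ it is $\dim_{\mathrm F}^{\theta}X=\sup\{\min\{\dim_{\mathrm F}^{\theta}\mu,d\}:\mu\in\mathcal M(X)\}$ (suprema over empty sets are $0$). The Peres--Schlag bound states $\dim_{\mathrm H}\{V\in G(d,k):\dim_{\mathrm H}P_V(X)<u\}\le k(d-k)+u-\dim_{\mathrm H}X$ for $u\in[0,k]$; the Mattila bound states that, if $\dim_{\mathrm H}X\le k$, then the same dimension is at most $k(d-k-1)+u$ for $u\in[0,\dim_{\mathrm H}X]$. *)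

theory Defs
  imports "HOL-Analysis.Analysis"
begin

section \<open>Hausdorff dimension with respect to a distance function\<close>

definition ennreal_powr :: "ennreal \<Rightarrow> real \<Rightarrow> ennreal" where
  "ennreal_powr x s = (if x = top then top else ennreal (enn2real x powr s))"

definition ediam :: "('m \<Rightarrow> 'm \<Rightarrow> real) \<Rightarrow> 'm set \<Rightarrow> ennreal" where
  "ediam \<rho> U = (SUP x\<in>U. SUP y\<in>U. ennreal (\<rho> x y))"

definition hausdorff_premeasure ::
    "('m \<Rightarrow> 'm \<Rightarrow> real) \<Rightarrow> real \<Rightarrow> real \<Rightarrow> 'm set \<Rightarrow> ennreal" where
  "hausdorff_premeasure \<rho> s \<delta> A =
     (INF U \<in> {U :: nat \<Rightarrow> 'm set. A \<subseteq> (\<Union>i. U i) \<and> (\<forall>i. ediam \<rho> (U i) \<le> ennreal \<delta>)}.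
        \<Sum>i. ennreal_powr (ediam \<rho> (U i)) s)"

definition hausdorff_measure :: "('m \<Rightarrow> 'm \<Rightarrow> real) \<Rightarrow> real \<Rightarrow> 'm set \<Rightarrow> ennreal" where
  "hausdorff_measure \<rho> s A = (SUP \<delta> \<in> {0<..}. hausdorff_premeasure \<rho> s \<delta> A)"

text \<open>
  The distance is an argument because the definition is applied both to \<open>dist\<close> and to the metric
  of the Grassmannian, which lives on a subset of a type only. Since \<open>\<rho>\<close> enters through diameters,
  which decrease when the sets \<open>U i\<close> are replaced by \<open>U i \<inter> A\<close>, the value depends only on the
  restriction of \<open>\<rho>\<close> to \<open>A\<close>. Only exponents \<open>s > 0\<close> are used, so no convention for
  \<open>0\<close>-dimensional measure is involved; the empty set gets dimension \<open>0\<close>.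
\<close>

definition hausdorff_dim :: "('m \<Rightarrow> 'm \<Rightarrow> real) \<Rightarrow> 'm set \<Rightarrow> ereal" where
  "hausdorff_dim \<rho> A = Inf (ereal ` {s. 0 < s \<and> hausdorff_measure \<rho> s A = 0})"


section \<open>Orthogonal projections and the Grassmannian\<close>

definition orth_proj :: "'a::euclidean_space set \<Rightarrow> 'a \<Rightarrow> 'a" where
  "orth_proj V x = (THE y. y \<in> V \<and> (\<forall>v\<in>V. orthogonal (x - y) v))"

definition grassmannian :: "nat \<Rightarrow> 'a::euclidean_space set set" where
  "grassmannian k = {V. subspace V \<and> dim V = k}"

definition gr_dist :: "'a::euclidean_space set \<Rightarrow> 'a set \<Rightarrow> real" where
  "gr_dist V W = onorm (\<lambda>x. orth_proj V x - orth_proj W x)"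

lemma orth_proj_unique:
  assumes "subspace V" "y \<in> V" "\<And>v. v \<in> V \<Longrightarrow> orthogonal (x - y) v"
  shows "orth_proj V x = y"
  unfolding orth_proj_def
proof (rule the_equality)
  fix z assume z: "z \<in> V \<and> (\<forall>v\<in>V. orthogonal (x - z) v)"
  have "y - z \<in> V" using assms z by (simp add: subspace_diff)
  then have "orthogonal (x - y) (y - z)" "orthogonal (x - z) (y - z)" using assms z by auto
  then have "(y - z) \<bullet> (y - z) = 0" by (simp add: orthogonal_def inner_diff)
  then show "z = y" by simp
qed (use assms in auto)

lemma orth_proj:
  assumes "subspace V"
  shows "orth_proj V x \<in> V" "v \<in> V \<Longrightarrow> orthogonal (x - orth_proj V x) v"
proof -
  obtain y z where y: "y \<in> span V" "\<And>w. w \<in> span V \<Longrightarrow> orthogonal z w" "x = y + z"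
    by (rule orthogonal_subspace_decomp_exists[of V x]) blast
  moreover have "span V = V" using assms by (rule span_eq_iff[THEN iffD2])
  ultimately have "y \<in> V" and 2: "\<And>v. v \<in> V \<Longrightarrow> orthogonal (x - y) v" by auto
  moreover from this have "orth_proj V x = y" using assms by (intro orth_proj_unique)
  ultimately show "orth_proj V x \<in> V" "v \<in> V \<Longrightarrow> orthogonal (x - orth_proj V x) v" by auto
qed

lemma linear_orth_proj:
  assumes "subspace V"
  shows "linear (orth_proj V)"
proof (rule linearI)
  fix x y c
  show "orth_proj V (x + y) = orth_proj V x + orth_proj V y"
  proof (rule orth_proj_unique[OF assms])
    fix v assume "v \<in> V"
    then show "orthogonal (x + y - (orth_proj V x + orth_proj V y)) v"
      using orth_proj(2)[OF assms, of v x] orth_proj(2)[OF assms, of v y]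
      by (simp add: orthogonal_def inner_diff_left inner_add_left)
  qed (simp add: assms orth_proj subspace_add)
  show "orth_proj V (c *\<^sub>R x) = c *\<^sub>R orth_proj V x"
  proof (rule orth_proj_unique[OF assms])
    fix v assume "v \<in> V"
    then show "orthogonal (c *\<^sub>R x - c *\<^sub>R orth_proj V x) v"
      using orth_proj(2)[OF assms, of v x]
      by (simp add: orthogonal_def inner_diff_left)
  qed (simp add: assms orth_proj subspace_scale)
qed

lemma bounded_linear_orth_proj_diff:
  assumes "subspace V" "subspace W"
  shows "bounded_linear (\<lambda>x. orth_proj V x - orth_proj W x)"
  using assms by (intro bounded_linear_sub linear_conv_bounded_linear[THEN iffD1] linear_orth_proj)

lemma gr_dist_metric:
  assumes "subspace U" "subspace V" "subspace W"
  shows gr_dist_nonneg: "0 \<le> gr_dist V W"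
    and gr_dist_commute: "gr_dist V W = gr_dist W V"
    and gr_dist_eq_0_iff: "gr_dist V W = 0 \<longleftrightarrow> V = W"
    and gr_dist_triangle: "gr_dist U W \<le> gr_dist U V + gr_dist V W"
proof -
  note bl = bounded_linear_orth_proj_diff
  show "0 \<le> gr_dist V W"
    unfolding gr_dist_def using assms by (intro onorm_pos_le bl)
  show "gr_dist V W = gr_dist W V"
    unfolding gr_dist_def by (simp add: onorm_def norm_minus_commute)
  have img: "range (orth_proj V) = V" if "subspace V" for V :: "'a set"
  proof -
    have "orth_proj V v = v" if "v \<in> V" for v
      using that \<open>subspace V\<close> by (intro orth_proj_unique) (auto simp: orthogonal_def)
    then show ?thesis using orth_proj(1)[OF that] by (metis image_subsetI rangeI subsetI subset_antisym)
  qed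
  show "gr_dist V W = 0 \<longleftrightarrow> V = W"
  proof
    assume "gr_dist V W = 0"
    then have "orth_proj V = orth_proj W"
      unfolding gr_dist_def using onorm_eq_0[OF bl[OF assms(2,3)]] by auto
    then show "V = W" using img assms by metis
  qed (simp add: gr_dist_def onorm_zero)
  show "gr_dist U W \<le> gr_dist U V + gr_dist V W"
    unfolding gr_dist_def using onorm_triangle[OF bl[OF assms(1,2)] bl[OF assms(2,3)]] by simp
qed


section \<open>Measures supported on a set\<close>

definition spt :: "'a::euclidean_space measure \<Rightarrow> 'a set" where
  "spt \<mu> = {x. \<forall>r>0. 0 < emeasure \<mu> (ball x r)}"

text \<open>
  A Borel measure on Euclidean space vanishes outside its support, so \<open>\<mu>\<close> below is concentrated
  on \<open>X\<close> and has finite total mass. The set \<open>X\<close> is meant to be Borel.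
\<close>

definition measures_on :: "'a::euclidean_space set \<Rightarrow> 'a measure set" where
  "measures_on X = {\<mu>. sets \<mu> = sets borel \<and> compact (spt \<mu>) \<and> spt \<mu> \<subseteq> X \<and>
                        0 < emeasure \<mu> X \<and> emeasure \<mu> X < \<infinity>}"

definition affine_hyperplane :: "'a::euclidean_space set \<Rightarrow> bool" where
  "affine_hyperplane W \<longleftrightarrow> affine W \<and> aff_dim W = int DIM('a) - 1"

definition nbhd :: "'a::metric_space set \<Rightarrow> real \<Rightarrow> 'a set" where
  "nbhd W \<rho> = (\<Union>w\<in>W. ball w \<rho>)"

definition uniformly_affinely_nonconcentrated ::
    "real \<Rightarrow> real \<Rightarrow> 'a::euclidean_space measure \<Rightarrow> bool" where
  "uniformly_affinely_nonconcentrated C \<alpha> \<mu> \<longleftrightarrow>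
     (\<forall>\<epsilon>>0. \<forall>x\<in>spt \<mu>. \<forall>r. 0 < r \<and> r \<le> 1 \<longrightarrow>
        (\<forall>W. affine_hyperplane W \<longrightarrow>
          emeasure \<mu> (nbhd W (\<epsilon> * r) \<inter> ball x r)
            \<le> ennreal (C * \<epsilon> powr \<alpha>) * emeasure \<mu> (ball x r)))"


section \<open>The Fourier spectrum\<close>

definition fourier_transform :: "'a::euclidean_space measure \<Rightarrow> 'a \<Rightarrow> complex" where
  "fourier_transform \<mu> z =
     (LINT x|\<mu>. exp (- 2 * complex_of_real pi * \<i> * complex_of_real (z \<bullet> x)))"

definition fourier_energy :: "real \<Rightarrow> real \<Rightarrow> 'a::euclidean_space measure \<Rightarrow> ennreal" where
  "fourier_energy s \<theta> \<mu> =
     ennreal_powr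
       (\<integral>\<^sup>+ z. ennreal (cmod (fourier_transform \<mu> z) powr (2 / \<theta>)
                  * norm z powr (s / \<theta> - real DIM('a))) \<partial>lborel) \<theta>"

text \<open>In \<open>ereal\<close> the supremum of the empty set is \<open>-\<infinity>\<close>; here it has to be \<open>0\<close>.\<close>

definition Sup0 :: "ereal set \<Rightarrow> ereal" where
  "Sup0 S = (if S = {} then 0 else Sup S)"

definition fourier_spectrum_measure :: "real \<Rightarrow> 'a::euclidean_space measure \<Rightarrow> ereal" where
  "fourier_spectrum_measure \<theta> \<mu> = Sup0 (ereal ` {s. fourier_energy s \<theta> \<mu> < \<infinity>})"

definition fourier_spectrum :: "real \<Rightarrow> 'a::euclidean_space set \<Rightarrow> ereal" where
  "fourier_spectrum \<theta> X =
     Sup0 ((\<lambda>\<mu>. min (fourier_spectrum_measure \<theta> \<mu>) (ereal (real DIM('a)))) ` measures_on X)"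

text \<open>
  The bound \<open>B(u)\<close>. Each Fourier spectrum of a set lies in \<open>[0, d]\<close>, but the infimum over \<open>\<theta>\<close> may
  be \<open>-\<infinity>\<close> (this happens if \<open>u\<close> is below the Fourier dimension of \<open>X\<close>), hence the type.
\<close>

definition exceptional_bound :: "nat \<Rightarrow> 'a::euclidean_space set \<Rightarrow> real \<Rightarrow> ereal" where
  "exceptional_bound k X u =
     ereal (real k * (real DIM('a) - real k)) +
     (INF \<theta>\<in>{0<..1}. (ereal u - fourier_spectrum \<theta> X) / ereal \<theta>)"

end

(* Flat measures. On a non-concentrated set every ball contains, at each scale rho ^ n, points
   spreading in all directions, with constants independent of rho. Let a random walk choose
   uniformly among such points; the law nu of its limit lives on X. Its Fourier transform obeys a
   recursion averaging over the choices, and is damped by a fixed factor at each scale unless all the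
   phases align, which inside a ball of radius rho ^ - n happens only on boundedly many balls of
   radius ~ rho ^ (1 - n), again with a bound independent of rho. For rho small and then q large,
   the integral of |nu^| ^ (2 q) over the ball of radius R is therefore O(R ^ epsilon), so the Fourier
   spectrum of X at some theta = 1 / q is at least (d - epsilon) theta, while the dimension of X is
   below d - epsilon and k <= d - 1 < d - epsilon. Hence B(u) <= k (d - k) + u / theta - (d - epsilon),
   which beats both classical bounds when u is small.

   Exceptional set. Suppose mu on X has finite (s, theta) energy and dim P_V X < u < a. Then at
   infinitely many scales delta the set of pairs with |P_V (x - y)| <= 2 delta has mu x mu measure at
   least c delta ^ a, which forces the weight |mu^| ^ (2 / theta) |z| ^ (a (1 / theta - 1)) to have
   mass at least c delta ^ (a - k) on the unit neighbourhood of V in the ball of radius 1 / delta,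
   hence on some dyadic shell |z| ~ 2 ^ i. At most C 2 ^ (i (k - 1) (d - k)) planes from a
   2 ^ - i separated family pass within distance 1 of a given z in the shell, so double counting
   bounds the number of such separated planes by C 2 ^ (i (k (d - k) + (a - s) / theta)). *)
theory Submission
  imports Defs "HOL-Probability.Probability"
begin

section \<open>Branching random walks\<close>

text \<open>The transform of the walk may be tiny, and then an absolute Lipschitz bound says nothing
  about its phase. The recursion is therefore run with a majorant \<open>maj\<close> of its square
  that also controls its variation: over a frequency distance r at level n the transform changes by
  O(\<rho> ^ n r) times the root of the majorant. Where averaging brings no damping, that root is
  comparable to the transform of a child that stands still, so phases at two such frequencies can be
  compared with this child as reference. The growth factor per scale is fixed before \<rho>, so it
  can be made smaller than \<rho> ^ - \<epsilon>. The number of balls needed for the damped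
  frequencies does depend on \<rho>, but it is beaten by the q-th power of the damping factor, and q
  comes last. In the second half the weight must not depend on V, or double counting fails; hence
  |P_V z| is replaced by |z| once a threshold in |P_V z| has been used. That threshold is a multiple
  of |P_V z| ^ -a, which is locally integrable for every k \<ge> 1 because a < 1; this is where u <
  1 enters.\<close>

lemma cis_diff_norm_le: "cmod (cis s - cis t) \<le> \<bar>s - t\<bar>"
proof -
  have "cis s - cis t = cis t * (cis (s - t) - 1)"
    by (simp add: algebra_simps cis_mult)
  then have "cmod (cis s - cis t) = cmod (cis (s - t) - 1)"
    by (simp add: norm_mult)
  also have "\<dots> \<le> \<bar>s - t\<bar>"
    using iexp_approx1[of "s - t" 0] by (simp add: cis_conv_exp)
  finally show ?thesis .
qed

text \<open>A step from level n has length at most \<rho> ^ n. The maps \<open>ch\<close> may depend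
  on the level and on the current point, so no self-similarity of \<open>K\<close> is involved. They
  are defined for every index because the letters of a stream range over all naturals, although only
  the indices up to \<open>M\<close> carry mass.\<close>

locale branching_walk =
  fixes M :: nat and ch :: "nat \<Rightarrow> 'a::euclidean_space \<Rightarrow> nat \<Rightarrow> 'a" and \<rho> :: real and K :: "'a set"
  assumes rho: "0 < \<rho>" "\<rho> \<le> 1/4"
    and ch_mem: "\<And>n x i. x \<in> K \<Longrightarrow> ch n x i \<in> K"
    and ch_near: "\<And>n x i. x \<in> K \<Longrightarrow> norm (ch n x i - x) \<le> \<rho> ^ n"
    and compact_K: "compact K"
begin

definition S :: "nat stream measure" where
  "S = stream_space (measure_pmf (pmf_of_set {..M}))"

text \<open>The recursion removes the first step, not the last: what remains is a walk of the same
  kind one level up. This is the form in which \<open>endpoint_rec\<close> and the recursion of the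
  Fourier transform use it.\<close>

primrec walk :: "nat \<Rightarrow> nat \<Rightarrow> 'a \<Rightarrow> nat stream \<Rightarrow> 'a" where
  "walk 0 n x \<omega> = x"
| "walk (Suc k) n x \<omega> = walk k (Suc n) (ch n x (shd \<omega>)) (stl \<omega>)"

definition endpoint :: "nat \<Rightarrow> 'a \<Rightarrow> nat stream \<Rightarrow> 'a" where
  "endpoint n x \<omega> = lim (\<lambda>k. walk k n x \<omega>)"

lemma prob_space_S: "prob_space S"
  unfolding S_def by (rule prob_space.prob_space_stream_space) (rule measure_pmf.prob_space_axioms)

lemma walk_step: "x \<in> K \<Longrightarrow> norm (walk (Suc k) n x \<omega> - walk k n x \<omega>) \<le> \<rho> ^ (n + k)"
proof (induction k arbitrary: n x \<omega>)
  case (Suc k)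
  show ?case using Suc.IH[of "ch n x (shd \<omega>)" "Suc n" "stl \<omega>"] ch_mem[OF Suc.prems] by simp
qed (simp add: ch_near)

lemma walk_mem: "x \<in> K \<Longrightarrow> walk k n x \<omega> \<in> K"
  by (induction k arbitrary: n x \<omega>) (auto simp: ch_mem)

lemma walk_tendsto: 
  assumes "x \<in> K"
  shows "(\<lambda>k. walk k n x \<omega>) \<longlonglongrightarrow> endpoint n x \<omega>"
proof -
  have "summable (\<lambda>k. walk (Suc k) n x \<omega> - walk k n x \<omega>)"
  proof (rule summable_comparison_test')
    show "summable (\<lambda>k. \<rho> ^ n * \<rho> ^ k)"
      using rho by (intro summable_mult summable_geometric) auto
    show "norm (walk (Suc k) n x \<omega> - walk k n x \<omega>) \<le> \<rho> ^ n * \<rho> ^ k" for k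
      using walk_step[OF assms, of k n \<omega>] by (simp add: power_add)
  qed
  then have "(\<lambda>k. x + (\<Sum>i<k. walk (Suc i) n x \<omega> - walk i n x \<omega>))
      \<longlonglongrightarrow> x + (\<Sum>i. walk (Suc i) n x \<omega> - walk i n x \<omega>)"
    by (intro tendsto_intros summable_LIMSEQ)
  then have "convergent (\<lambda>k. walk k n x \<omega>)"
    using sum_lessThan_telescope[of "\<lambda>k. walk k n x \<omega>"] by (auto simp: convergent_def simp del: walk.simps(2))
  then show ?thesis unfolding endpoint_def by (simp add: convergent_LIMSEQ_iff)
qed

lemma endpoint_mem: "x \<in> K \<Longrightarrow> endpoint n x \<omega> \<in> K"
  using walk_tendsto walk_mem compact_imp_closed[OF compact_K]
  by (meson closed_sequentially)

lemma endpoint_rec: 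
  assumes "x \<in> K"
  shows "endpoint n x \<omega> = endpoint (Suc n) (ch n x (shd \<omega>)) (stl \<omega>)"
proof -
  have "(\<lambda>k. walk (Suc k) n x \<omega>) \<longlonglongrightarrow> endpoint n x \<omega>"
    using walk_tendsto[OF assms] by (rule LIMSEQ_Suc)
  moreover have "(\<lambda>k. walk (Suc k) n x \<omega>) \<longlonglongrightarrow> endpoint (Suc n) (ch n x (shd \<omega>)) (stl \<omega>)"
    using walk_tendsto[OF ch_mem[OF assms]] by simp
  ultimately show ?thesis by (rule LIMSEQ_unique)
qed

lemma endpoint_near:
  assumes "x \<in> K"
  shows "norm (endpoint n x \<omega> - x) \<le> 2 * \<rho> ^ n"
proof -
  \<comment> \<open>The subtracted term closes the induction: a step of length \<rho> ^ n \<rho> ^ k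
    is paid for because 2 \<rho> \<le> 1.\<close>
  have *: "norm (walk k n x \<omega> - x) \<le> 2 * \<rho> ^ n - 2 * \<rho> ^ n * \<rho> ^ k" for k
  proof (induction k)
    case (Suc k)
    have "norm (walk (Suc k) n x \<omega> - x) \<le> norm (walk (Suc k) n x \<omega> - walk k n x \<omega>) + norm (walk k n x \<omega> - x)"
      using norm_triangle_ineq[of "walk (Suc k) n x \<omega> - walk k n x \<omega>" "walk k n x \<omega> - x"]
      by (simp del: walk.simps)
    moreover have "norm (walk (Suc k) n x \<omega> - walk k n x \<omega>) \<le> \<rho>^n * \<rho>^k"
      using walk_step[OF assms, of k n \<omega>] by (simp add: power_add del: walk.simps)
    moreover have "2 * \<rho> ^ n * \<rho> ^ Suc k \<le> \<rho> ^ n * \<rho> ^ k"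
      using mult_right_mono[of "2 * \<rho>" 1 "\<rho>^n * \<rho>^k"] rho by (simp add: mult_ac)
    ultimately show ?case using Suc by linarith
  qed simp
  then have "norm (walk k n x \<omega> - x) \<le> 2 * \<rho> ^ n" for k
    using order_trans[OF *[of k], of "2 * \<rho> ^ n"] rho by simp
  moreover have "(\<lambda>k. norm (walk k n x \<omega> - x)) \<longlonglongrightarrow> norm (endpoint n x \<omega> - x)"
    using walk_tendsto[OF assms] by (intro tendsto_intros)
  ultimately show ?thesis
    by (intro LIMSEQ_le_const2) auto
qed

lemma shd_measurable [measurable]: "shd \<in> measurable S (count_space UNIV)"
  unfolding S_def by measurable

lemma stl_measurable [measurable]: "stl \<in> measurable S S"
  unfolding S_def by measurable

lemma walk_measurable: "walk k n x \<in> borel_measurable S"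
proof (induction k arbitrary: n x)
  case (Suc k)
  have "(\<lambda>\<omega>. walk k (Suc n) (ch n x i) (stl \<omega>)) \<in> borel_measurable S" for i
    by (rule measurable_compose[OF stl_measurable Suc])
  from measurable_compose_countable[OF this shd_measurable] show ?case
    by (simp add: fun_eq_iff)
next
  case 0
  have "walk 0 n x = (\<lambda>_. x)" by auto
  then show ?case by simp
qed

lemma endpoint_measurable: "x \<in> K \<Longrightarrow> endpoint n x \<in> borel_measurable S"
  by (rule borel_measurable_LIMSEQ_metric[OF walk_measurable walk_tendsto])

text \<open>A stream of independent uniform letters has the law of one uniform letter put in front
  of an independent stream.\<close>

lemma integral_S_rec:
  fixes f :: "nat stream \<Rightarrow> complex"
  assumes [measurable]: "f \<in> borel_measurable S" and bd: "\<And>\<omega>. cmod (f \<omega>) \<le> B"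
  shows "(\<integral>\<omega>. f \<omega> \<partial>S) = (\<Sum>i\<le>M. \<integral>\<omega>. f (i ## \<omega>) \<partial>S) / (M + 1)"
proof -
  let ?P = "measure_pmf (pmf_of_set {..M})"
  interpret P: prob_space S by (rule prob_space_S)
  interpret Q: pair_prob_space ?P S ..
  have eq: "S = distr (?P \<Otimes>\<^sub>M S) S (\<lambda>(i, \<omega>). i ## \<omega>)"
  proof (rule measure_eqI)
    fix A assume A: "A \<in> sets S"
    then have A': "A \<in> sets (stream_space ?P)" by (simp add: S_def)
    have m: "(\<lambda>(i, \<omega>). i ## \<omega>) \<in> measurable (?P \<Otimes>\<^sub>M S) S"
      unfolding S_def by measurable
    have "emeasure S A = (\<integral>\<^sup>+\<omega>. indicator A \<omega> \<partial>S)" using A by simp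
    also have "\<dots> = (\<integral>\<^sup>+i. (\<integral>\<^sup>+\<omega>. indicator A (i ## \<omega>) \<partial>S) \<partial>?P)"
      unfolding S_def by (rule prob_space.nn_integral_stream_space[OF measure_pmf.prob_space_axioms]) (use A' in measurable)
    also have "\<dots> = (\<integral>\<^sup>+p. indicator A (case p of (i, \<omega>) \<Rightarrow> i ## \<omega>) \<partial>(?P \<Otimes>\<^sub>M S))"
    proof -
      have "(\<lambda>p. indicator A (case p of (i, \<omega>) \<Rightarrow> i ## \<omega>) :: ennreal) \<in> borel_measurable (?P \<Otimes>\<^sub>M S)"
        by (rule measurable_compose[OF m]) (use A in simp)
      from P.nn_integral_fst[OF this] show ?thesis by simp
    qed
    also have "\<dots> = (\<integral>\<^sup>+\<omega>. indicator A \<omega> \<partial>distr (?P \<Otimes>\<^sub>M S) S (\<lambda>(i, \<omega>). i ## \<omega>))"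
      by (rule nn_integral_distr[OF m, symmetric]) (use A in simp)
    also have "\<dots> = emeasure (distr (?P \<Otimes>\<^sub>M S) S (\<lambda>(i, \<omega>). i ## \<omega>)) A"
      using A by simp
    finally show "emeasure S A = emeasure (distr (?P \<Otimes>\<^sub>M S) S (\<lambda>(i, \<omega>). i ## \<omega>)) A" .
  qed simp
  have m: "(\<lambda>(i, \<omega>). i ## \<omega>) \<in> measurable (?P \<Otimes>\<^sub>M S) S"
    unfolding S_def by measurable
  have m2: "(\<lambda>p. f (case p of (i, \<omega>) \<Rightarrow> i ## \<omega>)) \<in> borel_measurable (?P \<Otimes>\<^sub>M S)"
    by (rule measurable_compose[OF m assms(1)])
  have "(\<integral>\<omega>. f \<omega> \<partial>S) = (\<integral>p. f (case p of (i, \<omega>) \<Rightarrow> i ## \<omega>) \<partial>(?P \<Otimes>\<^sub>M S))"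
    unfolding integral_distr[OF m assms(1), symmetric] by (rule arg_cong[OF eq])
  also have "\<dots> = (\<integral>i. (\<integral>\<omega>. f (i ## \<omega>) \<partial>S) \<partial>?P)"
  proof -
    have "integrable (?P \<Otimes>\<^sub>M S) (\<lambda>p. f (case p of (i, \<omega>) \<Rightarrow> i ## \<omega>))"
      by (rule Q.integrable_const_bound[where B=B]) (use bd m2 in auto)
    from Q.integral_fst'[OF this] show ?thesis by simp
  qed
  also have "\<dots> = (\<Sum>i\<le>M. \<integral>\<omega>. f (i ## \<omega>) \<partial>S) / (M + 1)"
    by (subst integral_measure_pmf[of "{..M}"]) (auto simp: sum_divide_distrib scaleR_conv_of_real)
  finally show ?thesis .
qed

section \<open>The recentred Fourier transform of the walk\<close>

text \<open>The Fourier transform of the law of the endpoint minus the starting point. Recentring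
  costs a unimodular factor only and brings the Lipschitz constant at level n down to order \<rho> ^
  n.\<close>

definition trans :: "nat \<Rightarrow> 'a \<Rightarrow> 'a \<Rightarrow> complex" where
  "trans n x z = (\<integral>\<omega>. cis (- (2 * pi * (z \<bullet> (endpoint n x \<omega> - x)))) \<partial>S)"

lemma trans_integrand_measurable:
  "x \<in> K \<Longrightarrow> (\<lambda>\<omega>. cis (- (2 * pi * (z \<bullet> (endpoint n x \<omega> - x))))) \<in> borel_measurable S"
  unfolding cis_conv_exp using endpoint_measurable[of x n] by measurable

lemma integrable_trans:
  assumes "x \<in> K" shows "integrable S (\<lambda>\<omega>. cis (- (2 * pi * (z \<bullet> (endpoint n x \<omega> - x)))))"
proof -
  interpret P: prob_space S by (rule prob_space_S)
  show ?thesis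
    by (rule P.integrable_const_bound[where B=1]) (auto intro: trans_integrand_measurable assms)
qed

lemma trans_le_1: "cmod (trans n x z) \<le> 1"
proof -
  interpret P: prob_space S by (rule prob_space_S)
  have "cmod (trans n x z) \<le> (\<integral>\<omega>. cmod (cis (- (2 * pi * (z \<bullet> (endpoint n x \<omega> - x))))) \<partial>S)"
    unfolding trans_def by (rule integral_norm_bound)
  then show ?thesis by (simp add: P.prob_space)
qed

lemma trans_lipschitz:
  assumes "x \<in> K" shows "cmod (trans n x z' - trans n x z) \<le> 4 * pi * \<rho> ^ n * norm (z' - z)"
proof -
  interpret P: prob_space S by (rule prob_space_S)
  have "cmod (trans n x z' - trans n x z) =
      cmod (\<integral>\<omega>. cis (- (2 * pi * (z' \<bullet> (endpoint n x \<omega> - x)))) - cis (- (2 * pi * (z \<bullet> (endpoint n x \<omega> - x)))) \<partial>S)"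
    unfolding trans_def by (subst Bochner_Integration.integral_diff) (auto intro: integrable_trans assms)
  also have "\<dots> \<le> (\<integral>\<omega>. 4 * pi * \<rho> ^ n * norm (z' - z) \<partial>S)"
  proof (rule order_trans[OF integral_norm_bound], rule integral_mono)
    show "integrable S (\<lambda>\<omega>. cmod (cis (- (2 * pi * (z' \<bullet> (endpoint n x \<omega> - x)))) - cis (- (2 * pi * (z \<bullet> (endpoint n x \<omega> - x))))))"
      by (intro integrable_norm Bochner_Integration.integrable_diff integrable_trans assms)
    fix \<omega>
    let ?y = "endpoint n x \<omega> - x"
    have "cmod (cis (- (2 * pi * (z' \<bullet> ?y))) - cis (- (2 * pi * (z \<bullet> ?y)))) \<le> \<bar>(- (2 * pi * (z' \<bullet> ?y))) - (- (2 * pi * (z \<bullet> ?y)))\<bar>"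
      by (rule cis_diff_norm_le)
    also have "\<dots> = 2 * pi * \<bar>(z' - z) \<bullet> ?y\<bar>"
    proof -
      have "(- (2 * pi * (z' \<bullet> ?y))) - (- (2 * pi * (z \<bullet> ?y))) = - (2 * pi) * ((z' - z) \<bullet> ?y)"
        by (simp add: inner_diff_left algebra_simps)
      then show ?thesis by (simp only: abs_mult abs_minus_cancel) simp
    qed
    also have "\<dots> \<le> 2 * pi * (norm (z' - z) * (2 * \<rho> ^ n))"
      using order_trans[OF Cauchy_Schwarz_ineq2[of "z' - z" ?y] mult_left_mono[OF endpoint_near[OF assms, of n \<omega>]]]
      by (intro mult_left_mono) auto
    finally show "cmod (cis (- (2 * pi * (z' \<bullet> ?y))) - cis (- (2 * pi * (z \<bullet> ?y)))) \<le> 4 * pi * \<rho> ^ n * norm (z' - z)"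
      by (simp add: mult_ac)
  qed simp
  also have "\<dots> = 4 * pi * \<rho> ^ n * norm (z' - z)"
    by (simp add: P.prob_space)
  finally show ?thesis .
qed

lemma trans_rec:
  assumes "x \<in> K"
  shows "trans n x z = (\<Sum>i\<le>M. cis (- (2 * pi * (z \<bullet> (ch n x i - x)))) * trans (Suc n) (ch n x i) z) / (M + 1)"
proof -
  interpret P: prob_space S by (rule prob_space_S)
  have "trans n x z = (\<Sum>i\<le>M. \<integral>\<omega>. cis (- (2 * pi * (z \<bullet> (endpoint n x (i ## \<omega>) - x)))) \<partial>S) / (M + 1)"
    unfolding trans_def by (rule integral_S_rec[where B=1]) (auto intro: trans_integrand_measurable assms)
  moreover have "(\<integral>\<omega>. cis (- (2 * pi * (z \<bullet> (endpoint n x (i ## \<omega>) - x)))) \<partial>S) 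
      = cis (- (2 * pi * (z \<bullet> (ch n x i - x)))) * trans (Suc n) (ch n x i) z" for i
    unfolding trans_def
    by (subst integral_mult_right_zero[symmetric])
       (simp add: endpoint_rec[OF assms] cis_mult inner_diff_right algebra_simps)
  ultimately show ?thesis by simp
qed

end

section \<open>Phases, alignment and variance\<close>

text \<open>The cubic Taylor error |x| ^ 3 / 6 is at most |x| / 2, because x ^ 2 \<le> 2.56 < 3 on
  the interval.\<close>

lemma abs_sin_ge_half:
  fixes x :: real assumes "\<bar>x\<bar> \<le> pi / 2" shows "\<bar>x\<bar> / 2 \<le> \<bar>sin x\<bar>"
proof -
  have "\<bar>x\<bar> \<le> 1.6" using assms pi_approx by simp
  then have "\<bar>x\<bar> * \<bar>x\<bar> \<le> 1.6 * 1.6" by (intro mult_mono) auto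
  then have "\<bar>x\<bar> * (\<bar>x\<bar> * \<bar>x\<bar>) \<le> \<bar>x\<bar> * 3" by (intro mult_left_mono) auto
  moreover have "\<bar>sin x - x\<bar> \<le> \<bar>x\<bar> * (\<bar>x\<bar> * \<bar>x\<bar>) / 6"
    using Maclaurin_sin_bound[of x 3] by (simp add: sin_coeff_def numeral_eq_Suc field_simps)
  ultimately show ?thesis by linarith
qed

text \<open>The right-hand side equals 2 |sin (pi s)|, with s the signed distance of t to the
  nearest integer. The factor 2 makes up for the half lost in
  \<open>abs_sin_ge_half\<close>.\<close>

lemma abs_round_diff_le_cis:
  fixes t :: real shows "\<bar>t - of_int (round t)\<bar> \<le> cmod (cis (2 * pi * t) - 1)"
proof -
  define s where "s = t - of_int (round t)"
  have s: "\<bar>s\<bar> \<le> 1/2" using of_int_round_abs_le[of t] by (simp add: s_def abs_minus_commute)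
  have "cis (2 * pi * t) = cis (2 * pi * s) * cis (2 * pi * of_int (round t))"
    by (simp add: cis_mult s_def algebra_simps)
  also have "cis (2 * pi * of_int (round t)) = 1"
    by (rule cis_multiple_2pi) simp
  finally have "cmod (cis (2 * pi * t) - 1) = 2 * \<bar>sin (pi * s)\<bar>"
    using dist_exp_i_1[of "2 * pi * s"] by (simp add: cis_conv_exp)
  moreover have "\<bar>pi * s\<bar> / 2 \<le> \<bar>sin (pi * s)\<bar>"
    using s by (intro abs_sin_ge_half) (simp add: abs_mult)
  moreover have "\<bar>s\<bar> \<le> \<bar>pi * s\<bar>"
    using pi_gt3 mult_right_mono[of 1 pi "\<bar>s\<bar>"] by (simp add: abs_mult)
  ultimately show ?thesis by (simp add: s_def)
qed

text \<open>Here t and t' are the phases of one child at two frequencies, a and a' its transforms,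
  a0 and a0' those of the reference child. If the child agrees with the reference up to a relative
  error \<epsilon> at both frequencies, and neither transform moves by more than \<tau> |a0|, then
  the two phases must nearly agree modulo 2 pi. The condition \<epsilon> \<le> 1/2 gives |a| \<ge>
  |a0| / 2, so that |a| can be divided out.\<close>

lemma cis_alignment:
  fixes t t' :: real and a a' a0 a0' :: complex
  assumes "cmod (cis t * a - a0) \<le> \<epsilon> * cmod a0" "cmod (cis t' * a' - a0') \<le> \<epsilon> * cmod a0'"
    and "cmod (a' - a) \<le> \<tau> * cmod a0" "cmod (a0' - a0) \<le> \<tau> * cmod a0"
    and "a0 \<noteq> 0" "0 \<le> \<epsilon>" "\<epsilon> \<le> 1/2"
  shows "cmod (cis (t' - t) - 1) \<le> 4 * \<epsilon> + 5 * \<tau>"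
proof -
  have a0': "cmod a0' \<le> (1 + \<tau>) * cmod a0"
    using assms(4) norm_triangle_sub[of a0' a0] by (simp add: algebra_simps)
  have "cmod a0 \<le> cmod (cis t * a) + cmod (cis t * a - a0)"
    by (metis norm_minus_commute norm_triangle_sub)
  then have a: "cmod a0 / 2 \<le> cmod a"
    using assms(1) mult_right_mono[OF assms(7), of "cmod a0"] by (simp add: norm_mult)
  have "cmod (cis t' - cis t) * cmod a = cmod ((cis t' * a' - a0') - (cis t * a - a0) + (a0' - a0) - cis t' * (a' - a))"
    by (simp add: norm_mult[symmetric] algebra_simps)
  also have "\<dots> \<le> cmod (cis t' * a' - a0') + cmod (cis t * a - a0) + cmod (a0' - a0) + cmod (cis t' * (a' - a))"
    by norm
  also have "\<dots> \<le> \<epsilon> * ((1 + \<tau>) * cmod a0) + \<epsilon> * cmod a0 + \<tau> * cmod a0 + \<tau> * cmod a0"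
    using order_trans[OF assms(2) mult_left_mono[OF a0' assms(6)]] assms(1,3,4)
    by (simp add: norm_mult)
  also have "\<dots> = (2 * \<epsilon> + \<epsilon> * \<tau> + 2 * \<tau>) * cmod a0"
    by (simp add: algebra_simps)
  also have "\<dots> \<le> (2 * \<epsilon> + 5 / 2 * \<tau>) * cmod a0"
  proof -
    have "0 \<le> \<tau>" using assms(4,5) norm_ge_zero[of "a0' - a0"]
      by (metis order_trans zero_le_mult_iff zero_less_norm_iff not_less order_less_le)
    then show ?thesis using mult_right_mono[OF assms(7), of \<tau>] by (intro mult_right_mono) auto
  qed
  finally have "cmod (cis t' - cis t) * (cmod a0 / 2) \<le> (2 * \<epsilon> + 5 / 2 * \<tau>) * cmod a0"
    using mult_left_mono[OF a, of "cmod (cis t' - cis t)"] by simp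
  then have "cmod (cis t' - cis t) \<le> 4 * \<epsilon> + 5 * \<tau>"
    using assms(5) mult_right_le_imp_le[of "cmod (cis t' - cis t)" "cmod a0" "4 * \<epsilon> + 5 * \<tau>"]
    by (simp add: algebra_simps)
  moreover have "cis t' - cis t = cis t * (cis (t' - t) - 1)"
    by (simp add: algebra_simps cis_mult)
  ultimately show ?thesis by (simp add: norm_mult)
qed

text \<open>The variance identity. Near equality in |m| ^ 2 \<le> (mean of the |b i| ^ 2) thus
  forces every b i to be close to m.\<close>

lemma sum_norm_diff_mean:
  fixes b :: "nat \<Rightarrow> complex"
  assumes m: "m = (\<Sum>i\<le>M. b i) / of_nat (M + 1)"
  shows "(\<Sum>i\<le>M. (cmod (b i - m))\<^sup>2) = (\<Sum>i\<le>M. (cmod (b i))\<^sup>2) - (M + 1) * (cmod m)\<^sup>2"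
proof -
  have s: "(\<Sum>i\<le>M. b i) = of_nat (M + 1) * m" 
  proof -
    have "of_nat (M + 1) \<noteq> (0::complex)" by (simp only: of_nat_eq_0_iff)
    from nonzero_mult_div_cancel_left[OF this, of "\<Sum>i\<le>M. b i"] show ?thesis
      unfolding m by (simp only: times_divide_eq_right)
  qed
  have "(cmod (b i - m))\<^sup>2 = (cmod (b i))\<^sup>2 - 2 * (b i \<bullet> m) + (cmod m)\<^sup>2" for i
    by (simp only: power2_norm_eq_inner) (simp add: inner_diff_left inner_diff_right inner_commute)
  then have "(\<Sum>i\<le>M. (cmod (b i - m))\<^sup>2) = (\<Sum>i\<le>M. (cmod (b i))\<^sup>2) - 2 * ((\<Sum>i\<le>M. b i) \<bullet> m) + (M + 1) * (cmod m)\<^sup>2"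
    by (simp add: sum.distrib sum_subtractf inner_sum_left sum_distrib_left)
  also have "(\<Sum>i\<le>M. b i) \<bullet> m = (M + 1) * (cmod m)\<^sup>2"
  proof -
    have "(of_nat (M + 1) * m) = real (M + 1) *\<^sub>R m" by (simp add: scaleR_conv_of_real)
    then show ?thesis unfolding s by (simp add: power2_norm_eq_inner)
  qed
  finally show ?thesis by simp
qed

section \<open>A majorant that is damped at scales without alignment\<close>

text \<open>Child 0 stands still, so its term in \<open>trans_rec\<close> carries no phase and can
  serve as a reference. The assumption \<open>ch_spread\<close> is all that the Fourier estimates
  use of non-concentration: the displacements of the children see every direction at scale \<rho> ^
  n.\<close>

locale spread_walk = branching_walk M ch \<rho> K
  for M :: nat and ch :: "nat \<Rightarrow> 'a::euclidean_space \<Rightarrow> nat \<Rightarrow> 'a" and \<rho> :: real and K :: "'a set" +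
  fixes b :: real
  assumes rho8: "\<rho> \<le> 1/8" and b_pos: "0 < b"
    and ch_zero: "\<And>n x. ch n x 0 = x"
    and ch_spread: "\<And>n x z. x \<in> K \<Longrightarrow> \<exists>i\<le>M. b * \<rho> ^ n * norm z \<le> \<bar>z \<bullet> (ch n x i - x)\<bar>"
begin

text \<open>The deficit \<rho> ^ 2 / (M + 1) is tuned to the variance identity: if |trans| ^ 2
  exceeds \<open>gain\<close> times the average A of the children's majorants, then the M + 1
  squared deviations from the mean add up to at most \<rho> ^ 2 A.\<close>

definition gain :: real where "gain = 1 - \<rho>\<^sup>2 / (M + 1)"

text \<open>A bound for |trans| ^ 2 that looks j levels ahead. Averaging over the children always
  preserves the bound; the extra factor \<open>gain\<close> is taken whenever |trans| ^ 2 itself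
  allows it. Depth 0 starts from the trivial bound 1.\<close>

primrec maj :: "nat \<Rightarrow> nat \<Rightarrow> 'a \<Rightarrow> 'a \<Rightarrow> real" where
  "maj 0 n x z = 1"
| "maj (Suc j) n x z =
    (let A = (\<Sum>i\<le>M. maj j (Suc n) (ch n x i) z) / (M + 1)
     in if gain * A < (cmod (trans n x z))\<^sup>2 then A else gain * A)"

definition avg :: "nat \<Rightarrow> nat \<Rightarrow> 'a \<Rightarrow> 'a \<Rightarrow> real" where
  "avg j n x z = (\<Sum>i\<le>M. maj j (Suc n) (ch n x i) z) / (M + 1)"

text \<open>The frequencies at which level n brings no damping. There all terms of the recursion
  nearly agree.\<close>

definition bad :: "nat \<Rightarrow> nat \<Rightarrow> 'a \<Rightarrow> 'a set" where
  "bad j n x = {z. gain * avg j n x z < (cmod (trans n x z))\<^sup>2}"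

lemma maj_Suc: "maj (Suc j) n x z = (if z \<in> bad j n x then avg j n x z else gain * avg j n x z)"
  by (simp add: avg_def bad_def Let_def)

declare maj.simps(2) [simp del]

lemma gain: "15/16 \<le> gain" "gain < 1" "gain > 0"
proof -
  have "\<rho>\<^sup>2 \<le> (1/8)\<^sup>2" using rho rho8 by (intro power_mono) auto
  then have "\<rho>\<^sup>2 / (M + 1) \<le> 1/16" by (simp add: field_simps power2_eq_square)
  moreover have "\<rho>\<^sup>2 / (M + 1) > 0" using rho by simp
  ultimately show "15/16 \<le> gain" "gain < 1" "gain > 0" unfolding gain_def by linarith+
qed

lemma maj_pos: "0 < maj j n x z"
proof (induction j arbitrary: n x)
  case (Suc j)
  have "0 < avg j n x z" unfolding avg_def
    using Suc by (intro divide_pos_pos sum_pos) auto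
  then show ?case using gain(3) by (simp add: maj_Suc)
qed simp

lemma avg_pos: "0 < avg j n x z"
  unfolding avg_def using maj_pos by (intro divide_pos_pos sum_pos) auto

text \<open>The second claim is a Lipschitz bound relative to the majorant at z, valid for all z'.
  It survives the recursion because moving the phase of a child costs at most 8 \<rho> ^ n and
  moving its transform only 32 \<rho> ^ (n + 1), while Cauchy-Schwarz bounds the average of the
  roots by the root of the average. The constant reproduces itself: 32 \<rho> + 8 \<le> 16, and a
  possible factor \<open>gain\<close> \<ge> 1/4 costs at most 2 on the root.\<close>

lemma maj_bound:
  assumes "x \<in> K"
  shows "(cmod (trans n x z))\<^sup>2 \<le> maj j n x z" (is ?A)
    and "cmod (trans n x z' - trans n x z) \<le> 32 * \<rho> ^ n * norm (z' - z) * sqrt (maj j n x z)" (is ?B)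
proof -
  have "?A \<and> (\<forall>z'. cmod (trans n x z' - trans n x z) \<le> 32 * \<rho> ^ n * norm (z' - z) * sqrt (maj j n x z))"
    using assms
  proof (induction j arbitrary: n x)
    case 0
    have "cmod (trans n x z' - trans n x z) \<le> 32 * \<rho> ^ n * norm (z' - z)" for z'
    proof -
      have "4 * pi * (\<rho> ^ n * norm (z' - z)) \<le> 32 * (\<rho> ^ n * norm (z' - z))"
        using pi_less_4 rho by (intro mult_right_mono) auto
      then show ?thesis using trans_lipschitz[OF 0, of n z' z] by (simp add: mult.assoc)
    qed
    moreover have "(cmod (trans n x z))\<^sup>2 \<le> 1"
      using trans_le_1[of n x z] by (simp add: power_le_one)
    ultimately show ?case by simp
  next
    case (Suc j)
    let ?c = "\<lambda>i. ch n x i" let ?v = "\<lambda>i. ch n x i - x"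
    let ?G = "\<lambda>i. maj j (Suc n) (ch n x i) z" and ?A = "avg j n x z"
    have IH1: "(cmod (trans (Suc n) (?c i) z))\<^sup>2 \<le> ?G i" for i
      using Suc.IH[OF ch_mem[OF Suc.prems]] by blast
    have IH1': "cmod (trans (Suc n) (?c i) z) \<le> sqrt (?G i)" for i
      using IH1 by (simp add: real_le_rsqrt)
    have IH2: "cmod (trans (Suc n) (?c i) z' - trans (Suc n) (?c i) z) \<le> 32 * \<rho> ^ Suc n * norm (z' - z) * sqrt (?G i)" for i z'
      using Suc.IH[OF ch_mem[OF Suc.prems]] by blast
    have avg_sq: "((\<Sum>i\<le>M. f i) / (M + 1))\<^sup>2 \<le> (\<Sum>i\<le>M. (f i)\<^sup>2) / (M + 1)" for f :: "nat \<Rightarrow> real"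
    proof -
      have "((\<Sum>i\<le>M. f i) / (M + 1))\<^sup>2 \<le> ((\<Sum>i\<le>M. (f i)\<^sup>2) * real (M + 1)) / (real (M + 1))\<^sup>2"
        unfolding power_divide using sum_squared_le_sum_of_squares[of f "{..M}"] by (intro divide_right_mono) auto
      also have "\<dots> = (\<Sum>i\<le>M. (f i)\<^sup>2) / (M + 1)" by (simp add: power2_eq_square)
      finally show ?thesis .
    qed
    have A1: "(cmod (trans n x z))\<^sup>2 \<le> ?A"
    proof -
      have "cmod (trans n x z) \<le> (\<Sum>i\<le>M. cmod (trans (Suc n) (?c i) z)) / (M + 1)"
        unfolding trans_rec[OF Suc.prems] norm_divide
        by (intro divide_mono order_trans[OF norm_sum]) (simp_all add: norm_mult flip: of_nat_Suc)
      then have "(cmod (trans n x z))\<^sup>2 \<le> ((\<Sum>i\<le>M. cmod (trans (Suc n) (?c i) z)) / (M + 1))\<^sup>2"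
        by (intro power_mono) auto
      also have "\<dots> \<le> (\<Sum>i\<le>M. (cmod (trans (Suc n) (?c i) z))\<^sup>2) / (M + 1)"
        by (rule avg_sq)
      also have "\<dots> \<le> ?A"
        unfolding avg_def using IH1 by (intro divide_right_mono sum_mono) auto
      finally show ?thesis .
    qed
    have maj_ge: "gain * ?A \<le> maj (Suc j) n x z"
      using gain avg_pos[of j n x z] by (simp add: maj_Suc)
    have half: "sqrt ?A / 2 \<le> sqrt (maj (Suc j) n x z)"
    proof -
      have "1 / 4 * ?A \<le> maj (Suc j) n x z"
        using maj_ge gain avg_pos[of j n x z] mult_right_mono[of "1/4" gain ?A] by linarith
      then have "sqrt (1 / 4 * ?A) \<le> sqrt (maj (Suc j) n x z)" by (rule real_sqrt_le_mono)
      moreover have "sqrt (1/4 * ?A) = sqrt ?A / 2" by (simp add: real_sqrt_divide)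
      ultimately show ?thesis by linarith
    qed
    have "cmod (trans n x z' - trans n x z) \<le> 32 * \<rho> ^ n * norm (z' - z) * sqrt (maj (Suc j) n x z)" for z'
    proof -
      let ?e = "\<lambda>z i. cis (- (2 * pi * (z \<bullet> ?v i)))" and ?a = "\<lambda>z i. trans (Suc n) (?c i) z"
      have step: "cmod (?e z' i * ?a z' i - ?e z i * ?a z i) \<le> 16 * \<rho> ^ n * norm (z' - z) * sqrt (?G i)" for i
      proof -
        have "cmod (?e z' i - ?e z i) \<le> \<bar>(- (2 * pi * (z' \<bullet> ?v i))) - (- (2 * pi * (z \<bullet> ?v i)))\<bar>"
          by (rule cis_diff_norm_le)
        also have "\<dots> = 2 * pi * \<bar>(z' - z) \<bullet> ?v i\<bar>"
        proof -
          have "(- (2 * pi * (z' \<bullet> ?v i))) - (- (2 * pi * (z \<bullet> ?v i))) = - (2 * pi) * ((z' - z) \<bullet> ?v i)"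
            by (simp add: inner_diff_left inner_diff_right algebra_simps)
          then show ?thesis by (simp only: abs_mult abs_minus_cancel) simp
        qed
        also have "\<dots> \<le> 8 * (norm (z' - z) * \<rho> ^ n)"
          using order_trans[OF Cauchy_Schwarz_ineq2[of "z' - z" "?v i"] mult_left_mono[OF ch_near[OF Suc.prems, of n i]]] pi_less_4
          by (intro mult_mono) auto
        finally have e: "cmod (?e z' i - ?e z i) \<le> 8 * (norm (z' - z) * \<rho> ^ n)" .
        have "cmod (?e z' i * ?a z' i - ?e z i * ?a z i) = cmod (?e z' i * (?a z' i - ?a z i) + (?e z' i - ?e z i) * ?a z i)"
          by (simp add: algebra_simps)
        also have "\<dots> \<le> cmod (?a z' i - ?a z i) + cmod (?e z' i - ?e z i) * cmod (?a z i)"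
          by (rule order_trans[OF norm_triangle_ineq]) (simp add: norm_mult)
        also have "\<dots> \<le> 32 * \<rho> ^ Suc n * norm (z' - z) * sqrt (?G i) + 8 * (norm (z' - z) * \<rho> ^ n) * sqrt (?G i)"
          using IH2 e IH1' rho by (intro add_mono mult_mono) auto
        also have "\<dots> = (32 * \<rho> + 8) * (\<rho> ^ n * norm (z' - z) * sqrt (?G i))"
          by (simp add: algebra_simps)
        also have "\<dots> \<le> 16 * (\<rho> ^ n * norm (z' - z) * sqrt (?G i))"
          using rho rho8 maj_pos[of j "Suc n" "?c i" z] by (intro mult_right_mono) auto
        finally show ?thesis by (simp add: mult_ac)
      qed
      have "trans n x z' - trans n x z = (\<Sum>i\<le>M. ?e z' i * ?a z' i - ?e z i * ?a z i) / (M + 1)"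
        unfolding trans_rec[OF Suc.prems] by (simp add: sum_subtractf diff_divide_distrib)
      then have "cmod (trans n x z' - trans n x z) \<le> (\<Sum>i\<le>M. cmod (?e z' i * ?a z' i - ?e z i * ?a z i)) / (M + 1)"
        by (simp add: norm_divide divide_right_mono norm_sum flip: of_nat_Suc)
      also have "\<dots> \<le> (\<Sum>i\<le>M. 16 * \<rho> ^ n * norm (z' - z) * sqrt (?G i)) / (M + 1)"
        using step by (intro divide_right_mono sum_mono) auto
      also have "\<dots> = 16 * \<rho> ^ n * norm (z' - z) * ((\<Sum>i\<le>M. sqrt (?G i)) / (M + 1))"
        by (simp add: sum_distrib_left)
      also have "(\<Sum>i\<le>M. sqrt (?G i)) / (M + 1) \<le> sqrt ?A"
      proof (rule real_le_rsqrt)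
        show "((\<Sum>i\<le>M. sqrt (?G i)) / (M + 1))\<^sup>2 \<le> ?A"
          using avg_sq[of "\<lambda>i. sqrt (?G i)"] maj_pos[of j "Suc n" _ z] by (simp add: avg_def less_imp_le)
      qed
      also have "16 * \<rho> ^ n * norm (z' - z) * sqrt ?A \<le> 16 * \<rho> ^ n * norm (z' - z) * (2 * sqrt (maj (Suc j) n x z))"
        using half rho by (intro mult_left_mono) auto
      finally show ?thesis using rho by (simp add: mult_left_mono)
    qed
    moreover have "(cmod (trans n x z))\<^sup>2 \<le> maj (Suc j) n x z"
      using A1 by (simp add: maj_Suc bad_def)
    ultimately show ?case by blast
  qed
  then show ?A ?B by blast+
qed

end

section \<open>Coverings by balls and convexity of powers\<close>

text \<open>Translation and scaling reduce every case to one compact ball of radius l. What matters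
  later is that the number depends only on the ratio of the radii.\<close>

lemma ball_cover_number:
  "\<exists>N::nat. \<forall>(z::'a::euclidean_space) r. 0 < r \<longrightarrow>
     (\<exists>Z. finite Z \<and> card Z \<le> N \<and> ball z (l * r) \<subseteq> (\<Union>p\<in>Z. ball p r))"
proof -
  have "cball (0::'a) l \<subseteq> \<Union> ((\<lambda>p. ball p 1) ` UNIV)"
  proof
    fix x :: 'a
    have "x \<in> ball x 1" by simp
    then show "x \<in> \<Union> ((\<lambda>p. ball p 1) ` UNIV)" by blast
  qed
  then obtain C where C: "finite C" "cball (0::'a) l \<subseteq> (\<Union>p\<in>C. ball p 1)"
    using compactE_image[OF compact_cball, of UNIV "\<lambda>p. ball p 1" "0::'a" l] by (auto intro!: open_ball)
  have "\<exists>Z. finite Z \<and> card Z \<le> card C \<and> ball z (l * r) \<subseteq> (\<Union>p\<in>Z. ball p r)" if "0 < r" for z :: 'a and r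
  proof (intro exI conjI)
    show "finite ((\<lambda>p. z + r *\<^sub>R p) ` C)" using C by simp
    show "card ((\<lambda>p. z + r *\<^sub>R p) ` C) \<le> card C" using C by (intro card_image_le)
    show "ball z (l * r) \<subseteq> (\<Union>p\<in>(\<lambda>p. z + r *\<^sub>R p) ` C. ball p r)"
    proof
      fix y assume "y \<in> ball z (l * r)"
      then have "norm ((y - z) /\<^sub>R r) \<le> l"
        using that by (simp add: dist_norm norm_minus_commute pos_divide_le_eq divide_inverse_commute[symmetric])
      then obtain p where p: "p \<in> C" "norm (p - (y - z) /\<^sub>R r) < 1"
        using C(2) by (force simp: dist_norm)
      have "z + r *\<^sub>R p - y = r *\<^sub>R (p - (y - z) /\<^sub>R r)"
        using that by (simp add: algebra_simps)
      then have "norm (z + r *\<^sub>R p - y) < r"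
        using p(2) that by simp
      then show "y \<in> (\<Union>p\<in>(\<lambda>p. z + r *\<^sub>R p) ` C. ball p r)"
        using p(1) by (auto simp: dist_norm)
    qed
  qed
  then show ?thesis by blast
qed

lemma set_nn_integral_cover:
  fixes w :: "'a \<Rightarrow> ennreal"
  assumes [measurable]: "w \<in> borel_measurable M" "\<And>p. p \<in> Z \<Longrightarrow> B p \<in> sets M"
    and "finite Z" "card Z \<le> N" "S \<subseteq> (\<Union>p\<in>Z. B p)"
    and W: "\<And>p. p \<in> Z \<Longrightarrow> (\<integral>\<^sup>+z\<in>B p. w z \<partial>M) \<le> W"
  shows "(\<integral>\<^sup>+z\<in>S. w z \<partial>M) \<le> of_nat N * W"
proof -
  have "(\<integral>\<^sup>+z\<in>S. w z \<partial>M) \<le> (\<integral>\<^sup>+z. (\<Sum>p\<in>Z. w z * indicator (B p) z) \<partial>M)"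
  proof (rule nn_integral_mono)
    fix z
    show "w z * indicator S z \<le> (\<Sum>p\<in>Z. w z * indicator (B p) z)"
    proof (cases "z \<in> S")
      case True
      then obtain p where p: "p \<in> Z" "z \<in> B p" using assms by blast
      then have "w z * indicator S z = w z * indicator (B p) z" using True by simp
      also have "\<dots> \<le> (\<Sum>p\<in>Z. w z * indicator (B p) z)"
        using p \<open>finite Z\<close> by (intro member_le_sum) auto
      finally show ?thesis .
    qed simp
  qed
  also have "\<dots> = (\<Sum>p\<in>Z. \<integral>\<^sup>+z\<in>B p. w z \<partial>M)"
    by (rule nn_integral_sum) measurable
  also have "\<dots> \<le> (\<Sum>p\<in>Z. W)" by (intro sum_mono W)
  also have "\<dots> \<le> of_nat N * W"
    using \<open>card Z \<le> N\<close> by (simp add: mult_right_mono)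
  finally show ?thesis .
qed

lemma power_mean_le:
  fixes f :: "'a \<Rightarrow> real"
  assumes "finite I" "I \<noteq> {}" "\<And>i. i \<in> I \<Longrightarrow> 0 \<le> f i"
  shows "((\<Sum>i\<in>I. f i) / card I) ^ q \<le> (\<Sum>i\<in>I. f i ^ q) / card I"
proof -
  have convex: "convex_on {0::real..} (\<lambda>x. x ^ q)"
    using convex_power_even[of q] convex_power_odd[of q] by (cases "even q") (auto intro: convex_on_subset)
  have "(\<Sum>i\<in>I. (1 / card I) *\<^sub>R f i) ^ q \<le> (\<Sum>i\<in>I. 1 / card I * f i ^ q)"
    using assms by (intro convex_on_sum[OF _ _ convex]) auto
  then show ?thesis by (simp add: sum_divide_distrib)
qed

section \<open>Bad frequencies and the induction over scales\<close>

context spread_walk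
begin

text \<open>Write A for the average majorant. Failure of damping bounds the variance, so each term
  lies within \<rho> sqrt A of the mean, while the mean is at least 3/4 sqrt A. Hence the reference
  term, that of child 0, is at least sqrt A / 2, and all errors can be measured against it. The
  second claim turns the Lipschitz bound of \<open>maj_bound\<close> into one relative to the
  reference transform.\<close>

lemma bad_aligned_children:
  assumes x: "x \<in> K" and z: "z \<in> bad j n x" and i: "i \<le> M"
  shows "cmod (cis (- (2 * pi * (z \<bullet> (ch n x i - x)))) * trans (Suc n) (ch n x i) z - trans (Suc n) x z)
           \<le> 4 * \<rho> * cmod (trans (Suc n) x z)" (is ?A)
    and "sqrt (maj j (Suc n) (ch n x i) z) \<le> 2 * (M + 1) * cmod (trans (Suc n) x z)" (is ?B)
    and "trans (Suc n) x z \<noteq> 0" (is ?C)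
proof -
  define \<beta> where "\<beta> = (\<lambda>i. cis (- (2 * pi * (z \<bullet> (ch n x i - x)))) * trans (Suc n) (ch n x i) z)"
  define m where "m = trans n x z"
  define A where "A = avg j n x z"
  define G where "G = (\<lambda>i. maj j (Suc n) (ch n x i) z)"
  have A: "0 < A" using avg_pos by (simp add: A_def)
  have mA: "gain * A < (cmod m)\<^sup>2" using z by (simp add: bad_def m_def A_def)
  have b0: "\<beta> 0 = trans (Suc n) x z" by (simp add: \<beta>_def ch_zero)
  have sumG: "(\<Sum>i\<le>M. G i) = (M + 1) * A" by (simp add: G_def A_def avg_def)
  have m: "m = (\<Sum>i\<le>M. \<beta> i) / of_nat (M + 1)" unfolding m_def \<beta>_def by (rule trans_rec[OF x])
  have "(\<Sum>i\<le>M. (cmod (\<beta> i))\<^sup>2) \<le> (\<Sum>i\<le>M. G i)"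
    using maj_bound(1)[OF ch_mem[OF x]] by (intro sum_mono) (simp add: \<beta>_def G_def norm_mult)
  then have "(\<Sum>i\<le>M. (cmod (\<beta> i - m))\<^sup>2) \<le> (M + 1) * A - (M + 1) * (gain * A)"
    using sum_norm_diff_mean[OF m] mult_left_mono[OF less_imp_le[OF mA], of "real (M + 1)"] sumG
    by (simp add: algebra_simps)
  also have "\<dots> = (\<rho> * sqrt A)\<^sup>2"
    using A by (simp add: gain_def power_mult_distrib field_simps)
  finally have *: "(\<Sum>i\<le>M. (cmod (\<beta> i - m))\<^sup>2) \<le> (\<rho> * sqrt A)\<^sup>2" .
  have bm: "cmod (\<beta> k - m) \<le> \<rho> * sqrt A" if "k \<le> M" for k
  proof (rule power2_le_imp_le)
    have "(cmod (\<beta> k - m))\<^sup>2 \<le> (\<Sum>i\<le>M. (cmod (\<beta> i - m))\<^sup>2)"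
      using that by (intro member_le_sum) auto
    then show "(cmod (\<beta> k - m))\<^sup>2 \<le> (\<rho> * sqrt A)\<^sup>2" using * by linarith
  qed (use A rho in simp)
  have "3 / 4 * sqrt A \<le> cmod m"
  proof (rule power2_le_imp_le)
    have "(3 / 4 * sqrt A)\<^sup>2 = 9 / 16 * A" using A by (simp add: power_mult_distrib power2_eq_square)
    also have "\<dots> \<le> gain * A" using A gain by (intro mult_right_mono) auto
    finally show "(3 / 4 * sqrt A)\<^sup>2 \<le> (cmod m)\<^sup>2" using mA by linarith
  qed simp
  moreover have "cmod m \<le> cmod (\<beta> 0) + cmod (\<beta> 0 - m)"
    by (metis norm_minus_commute norm_triangle_sub)
  moreover have "\<rho> * sqrt A \<le> 1 / 8 * sqrt A" using rho8 A by (intro mult_right_mono) auto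
  ultimately have b0A: "sqrt A \<le> 2 * cmod (\<beta> 0)" using bm[OF le0] real_sqrt_ge_zero[OF less_imp_le[OF A]] by linarith
  then show ?C using A by (auto simp: b0)
  have "cmod (\<beta> i - \<beta> 0) \<le> cmod (\<beta> i - m) + cmod (\<beta> 0 - m)"
    using norm_triangle_ineq4[of "\<beta> i - m" "\<beta> 0 - m"] by simp
  also have "\<dots> \<le> 2 * \<rho> * sqrt A" using bm[OF i] bm[OF le0] by simp
  also have "\<dots> \<le> 2 * \<rho> * (2 * cmod (\<beta> 0))" using b0A rho by (intro mult_left_mono) auto
  finally show ?A unfolding b0[symmetric] by (simp add: \<beta>_def)
  have "G i \<le> (M + 1) * A"
    unfolding sumG[symmetric] using i maj_pos by (intro member_le_sum) (auto simp: G_def less_imp_le)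
  then have "sqrt (G i) \<le> sqrt (M + 1) * sqrt A" by (simp flip: real_sqrt_mult)
  also have "\<dots> \<le> (M + 1) * (2 * cmod (\<beta> 0))"
    using b0A A by (intro mult_mono) (auto intro!: real_le_lsqrt simp: power2_eq_square)
  finally show ?B unfolding b0[symmetric] by (simp add: G_def algebra_simps)
qed

text \<open>The transforms of the children live one level up, so over a distance 2 / \<rho> ^ n they
  change by O(\<rho>) relative to the reference: 32 \<rho> ^ (n + 1) times 2 / \<rho> ^ n times 2 (M
  + 1) is 128 \<rho> (M + 1). \<open>cis_alignment\<close> with \<epsilon> = 4 \<rho> then yields 16
  \<rho> + 640 \<rho> (M + 1).\<close>

lemma bad_phase:
  assumes x: "x \<in> K" and z: "z \<in> bad j n x" and z': "z' \<in> bad j n x" and i: "i \<le> M"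
    and near: "norm (z' - z) \<le> 2 / \<rho> ^ n"
  shows "\<bar>(z - z') \<bullet> (ch n x i - x) - of_int (round ((z - z') \<bullet> (ch n x i - x)))\<bar> \<le> 656 * (M + 1) * \<rho>"
proof -
  let ?v = "ch n x i - x" and ?a0 = "trans (Suc n) x z"
  have lip: "cmod (trans (Suc n) (ch n x k) z' - trans (Suc n) (ch n x k) z) \<le> (128 * \<rho> * (M + 1)) * cmod ?a0" if "k \<le> M" for k
  proof -
    have "cmod (trans (Suc n) (ch n x k) z' - trans (Suc n) (ch n x k) z)
       \<le> 32 * \<rho> ^ Suc n * norm (z' - z) * sqrt (maj j (Suc n) (ch n x k) z)"
      by (rule maj_bound(2)[OF ch_mem[OF x]])
    also have "\<dots> \<le> 32 * \<rho> ^ Suc n * (2 / \<rho> ^ n) * (2 * (M + 1) * cmod ?a0)"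
      using near bad_aligned_children(2)[OF x z that] rho maj_pos[of j "Suc n" "ch n x k" z]
      by (intro mult_mono) auto
    also have "\<dots> = (128 * \<rho> * (M + 1)) * cmod ?a0" using rho by simp
    finally show ?thesis .
  qed
  have "cmod (cis (- (2 * pi * (z' \<bullet> ?v)) - - (2 * pi * (z \<bullet> ?v))) - 1) \<le> 4 * (4 * \<rho>) + 5 * (128 * \<rho> * (M + 1))"
  proof (rule cis_alignment)
    show "cmod (cis (- (2 * pi * (z \<bullet> ?v))) * trans (Suc n) (ch n x i) z - ?a0) \<le> 4 * \<rho> * cmod ?a0"
      by (rule bad_aligned_children(1)[OF x z i])
    show "cmod (cis (- (2 * pi * (z' \<bullet> ?v))) * trans (Suc n) (ch n x i) z' - trans (Suc n) x z') \<le> 4 * \<rho> * cmod (trans (Suc n) x z')"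
      by (rule bad_aligned_children(1)[OF x z' i])
    show "cmod (trans (Suc n) x z' - ?a0) \<le> 128 * \<rho> * (M + 1) * cmod ?a0"
      using lip[of 0] by (simp add: ch_zero)
  qed (use lip[OF i] bad_aligned_children(3)[OF x z i] rho rho8 in auto)
  also have "- (2 * pi * (z' \<bullet> ?v)) - - (2 * pi * (z \<bullet> ?v)) = 2 * pi * ((z - z') \<bullet> ?v)"
    by (simp add: inner_diff_left inner_diff_right algebra_simps)
  also have "4 * (4 * \<rho>) + 5 * (128 * \<rho> * (M + 1)) \<le> 656 * (M + 1) * \<rho>"
    using rho by (simp add: algebra_simps)
  finally show ?thesis using abs_round_diff_le_cis[of "(z - z') \<bullet> ?v"] by linarith
qed

text \<open>Bad frequencies z are sorted by the integers nearest to the products of z - y with the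
  displacements, for a fixed bad y. Distances are at most 2 / \<rho> ^ n and displacements at most
  \<rho> ^ n, so each integer is one of -2, ..., 2, whence the 5 ^ (M + 1) classes. Within a class
  all products of z - z' with displacements are O(\<rho>), and \<open>ch_spread\<close> converts
  this into a bound for z - z'.\<close>

lemma bad_cover:
  assumes x: "x \<in> K"
  shows "\<exists>Z. finite Z \<and> card Z \<le> 5 ^ (M + 1) \<and>
           bad j n x \<inter> ball z0 (1 / \<rho> ^ n) \<subseteq> (\<Union>p\<in>Z. ball p (1313 * (M + 1) / b * (\<rho> / \<rho> ^ n)))"
proof (cases "bad j n x \<inter> ball z0 (1 / \<rho> ^ n) = {}")
  case False
  define B where "B = bad j n x \<inter> ball z0 (1 / \<rho> ^ n)"
  obtain y where y: "y \<in> B" using False unfolding B_def by blast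
  define v where "v = (\<lambda>i. ch n x i - x)"
  define f where "f = (\<lambda>z. restrict (\<lambda>i. round ((z - y) \<bullet> v i)) {..M})"
  have near: "norm (z' - z) \<le> 2 / \<rho> ^ n" if "z \<in> B" "z' \<in> B" for z z'
  proof -
    have "norm (z' - z) \<le> dist z0 z' + dist z0 z"
      by (metis dist_norm dist_triangle3 dist_commute)
    then show ?thesis using that by (simp add: B_def)
  qed
  have f: "f z \<in> {..M} \<rightarrow>\<^sub>E {-2..2}" if z: "z \<in> B" for z
  proof -
    have "\<bar>(z - y) \<bullet> v i\<bar> \<le> 2" for i
    proof -
      have "\<bar>(z - y) \<bullet> v i\<bar> \<le> norm (z - y) * norm (v i)" by (rule Cauchy_Schwarz_ineq2)
      also have "\<dots> \<le> 2 / \<rho> ^ n * \<rho> ^ n"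
        using near[OF y z] ch_near[OF x, of n i] rho by (intro mult_mono) (auto simp: v_def)
      finally show ?thesis using rho by simp
    qed
    then have "round ((z - y) \<bullet> v i) \<in> {-2..2}" for i
      using round_mono[of "-2" "(z - y) \<bullet> v i"] round_mono[of "(z - y) \<bullet> v i" 2]
      by (simp add: abs_le_iff) (metis minus_le_iff round_numeral round_neg_numeral)
    then show ?thesis by (auto simp: f_def)
  qed
  define rep where "rep = (\<lambda>c. SOME z. z \<in> B \<and> f z = c)"
  have rep: "rep (f z) \<in> B \<and> f (rep (f z)) = f z" if "z \<in> B" for z
    unfolding rep_def by (rule someI_ex) (use that in blast)
  have fin: "finite ({..M} \<rightarrow>\<^sub>E {-2..2::int})" by (intro finite_PiE) auto
  have sub: "f ` B \<subseteq> {..M} \<rightarrow>\<^sub>E {-2..2}" using f by blast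
  have "card (rep ` f ` B) \<le> card (f ` B)" using finite_subset[OF sub fin] by (rule card_image_le)
  also have "\<dots> \<le> card ({..M} \<rightarrow>\<^sub>E {-2..2::int})" by (rule card_mono[OF fin sub])
  also have "\<dots> = 5 ^ (M + 1)" by (simp add: card_PiE)
  finally have card: "card (rep ` f ` B) \<le> 5 ^ (M + 1)" .
  have "norm (z - z') < 1313 * (M + 1) / b * (\<rho> / \<rho> ^ n)" if "z \<in> B" "z' \<in> B" "f z = f z'" for z z'
  proof -
    obtain i where i: "i \<le> M" "b * \<rho> ^ n * norm (z - z') \<le> \<bar>(z - z') \<bullet> v i\<bar>"
      using ch_spread[OF x, of n "z - z'"] by (auto simp: v_def)
    have r: "round ((z - y) \<bullet> v i) = round ((z' - y) \<bullet> v i)"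
      using fun_cong[OF that(3), of i] i(1) by (simp add: f_def)
    have "\<bar>(z - y) \<bullet> v i - of_int (round ((z - y) \<bullet> v i))\<bar> \<le> 656 * (M + 1) * \<rho>"
         "\<bar>(z' - y) \<bullet> v i - of_int (round ((z' - y) \<bullet> v i))\<bar> \<le> 656 * (M + 1) * \<rho>"
      using bad_phase[OF x _ _ i(1), of _ j n y] near that y unfolding v_def B_def by auto
    then have "\<bar>(z - y) \<bullet> v i - (z' - y) \<bullet> v i\<bar> \<le> 1312 * (M + 1) * \<rho>" unfolding r by linarith
    moreover have "(z - y) \<bullet> v i - (z' - y) \<bullet> v i = (z - z') \<bullet> v i" by (simp add: inner_diff_left)
    \<comment> \<open>The spare unit makes the estimate strict, as open balls require.\<close>
    moreover have "1312 * (M + 1) * \<rho> < 1313 * (M + 1) * \<rho>" using rho by simp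
    ultimately have "b * \<rho> ^ n * norm (z - z') < 1313 * (M + 1) * \<rho>" using i(2) by linarith
    then show ?thesis using b_pos rho by (simp add: field_simps)
  qed
  then have "B \<subseteq> (\<Union>p\<in>rep ` f ` B. ball p (1313 * (M + 1) / b * (\<rho> / \<rho> ^ n)))"
    using rep by (force simp: dist_norm)
  moreover have "finite (rep ` f ` B)" using finite_subset[OF sub fin] by simp
  ultimately show ?thesis using card unfolding B_def by blast
qed (auto intro: exI[of _ "{}"])


lemma trans_measurable:
  assumes "x \<in> K" shows "trans n x \<in> borel_measurable borel"
proof (rule borel_measurable_continuous_onI)
  show "continuous_on UNIV (trans n x)"
  proof (rule lipschitz_on_continuous_on)
    show "(4 * pi * \<rho> ^ n)-lipschitz_on UNIV (trans n x)"
      using trans_lipschitz[OF assms] rho by (intro lipschitz_onI) (auto simp: dist_norm)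
  qed
qed

lemma maj_measurable: "x \<in> K \<Longrightarrow> maj j n x \<in> borel_measurable borel"
proof (induction j arbitrary: n x)
  case (Suc j)
  note [measurable] = trans_measurable[OF Suc.prems]
  have [measurable]: "(\<lambda>z. avg j n x z) \<in> borel_measurable borel"
    unfolding avg_def using Suc.IH[OF ch_mem[OF Suc.prems]] by measurable
  have "(\<lambda>z. if gain * avg j n x z < (cmod (trans n x z))\<^sup>2 then avg j n x z else gain * avg j n x z)
      \<in> borel_measurable borel"
    by measurable
  then show ?case by (simp add: maj_Suc[abs_def] bad_def)
next
  case 0
  have "maj 0 n x = (\<lambda>_. 1)" by auto
  then show ?case by simp
qed

lemma bad_sets: assumes "x \<in> K" shows "bad j n x \<in> sets borel"
proof -
  note [measurable] = trans_measurable[OF assms]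
  have [measurable]: "(\<lambda>z. avg j n x z) \<in> borel_measurable borel"
    unfolding avg_def using maj_measurable[OF ch_mem[OF assms]] by measurable
  show ?thesis unfolding bad_def by measurable
qed

lemma maj_power_le:
  "maj (Suc j) n x z ^ q \<le> (if z \<in> bad j n x then 1 else gain ^ q) * ((\<Sum>i\<le>M. maj j (Suc n) (ch n x i) z ^ q) / (M + 1))"
proof -
  have "avg j n x z ^ q \<le> (\<Sum>i\<le>M. maj j (Suc n) (ch n x i) z ^ q) / (M + 1)"
    using power_mean_le[of "{..M}" "\<lambda>i. maj j (Suc n) (ch n x i) z" q] maj_pos
    by (simp add: avg_def less_imp_le)
  from mult_left_mono[OF this, of "gain ^ q"] this show ?thesis using gain(3)
    by (simp add: maj_Suc power_mult_distrib del: times_divide_eq_right)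
qed

text \<open>The induction runs from low to high frequencies. The damping factor of level n is
  absorbed into the weight, and the task is to bound the mass of the new weight on every ball of the
  next radius, with any centre. The bad part of such a ball is covered by 5 ^ (M + 1) N1 balls of
  the old radius; the remainder may need all N2 of them, but there the factor gain ^ q pays. The new
  weight is common to all children, so averaging over them costs nothing.\<close>

lemma weighted_majorant_bound:
  assumes N1: "\<And>z r. 0 < r \<Longrightarrow> \<exists>Z. finite Z \<and> card Z \<le> N1 \<and> ball (z::'a) ((1313 * (M + 1) / b) * r) \<subseteq> (\<Union>p\<in>Z. ball p r)"
    and N2: "\<And>z r. 0 < r \<Longrightarrow> \<exists>Z. finite Z \<and> card Z \<le> N2 \<and> ball (z::'a) (1 / \<rho> * r) \<subseteq> (\<Union>p\<in>Z. ball p r)"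
    and q: "gain ^ q * N2 \<le> 1"
    and x: "x \<in> K" and w: "w \<in> borel_measurable borel"
    and W: "\<And>z0. (\<integral>\<^sup>+z\<in>ball z0 (\<rho> / \<rho> ^ n). w z \<partial>lborel) \<le> W"
  shows "(\<integral>\<^sup>+z\<in>ball z0 (\<rho> / \<rho> ^ (n + j)). w z * ennreal (maj j n x z ^ q) \<partial>lborel) \<le> of_nat (5 ^ (M + 1) * N1 + 1) ^ j * W"
  using x w W
proof (induction j arbitrary: n x w W z0)
  case 0
  then show ?case by simp
next
  case (Suc j)
  let ?A = "of_nat (5 ^ (M + 1) * N1 + 1) :: ennreal"
  note [measurable] = Suc.prems(2) bad_sets[OF Suc.prems(1)]
  define h where "h = (\<lambda>z. if z \<in> bad j n x then 1 else ennreal (gain ^ q))"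
  have [measurable]: "h \<in> borel_measurable borel" unfolding h_def by measurable
  define w' where "w' = (\<lambda>z. w z * h z)"
  have w'[measurable]: "w' \<in> borel_measurable borel" unfolding w'_def by measurable
  have r: "0 < \<rho> / \<rho> ^ n" using rho by simp
  have W': "(\<integral>\<^sup>+z\<in>ball z1 (\<rho> / \<rho> ^ Suc n). w' z \<partial>lborel) \<le> ?A * W" for z1
  proof -
    \<comment> \<open>The next radius is exactly the one for which \<open>bad_cover\<close> is
      stated.\<close>
    have rad: "\<rho> / \<rho> ^ Suc n = 1 / \<rho> ^ n" "1 / \<rho> ^ n = 1 / \<rho> * (\<rho> / \<rho> ^ n)" using rho by (auto simp: field_simps)
    let ?B = "ball z1 (1 / \<rho> ^ n)"
    have b1: "(\<integral>\<^sup>+z\<in>bad j n x \<inter> ?B. w z \<partial>lborel) \<le> of_nat (5 ^ (M + 1)) * (of_nat N1 * W)"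
    proof -
      obtain Z where Z: "finite Z" "card Z \<le> 5 ^ (M + 1)"
        "bad j n x \<inter> ?B \<subseteq> (\<Union>p\<in>Z. ball p (1313 * (M + 1) / b * (\<rho> / \<rho> ^ n)))"
        using bad_cover[OF Suc.prems(1), of j n z1] by blast
      show ?thesis
      proof (rule set_nn_integral_cover[OF _ _ Z])
        fix p :: 'a
        obtain Z' where Z': "finite Z'" "card Z' \<le> N1"
          "ball p (1313 * (M + 1) / b * (\<rho> / \<rho> ^ n)) \<subseteq> (\<Union>p\<in>Z'. ball p (\<rho> / \<rho> ^ n))"
          using N1[OF r, of p] by blast
        show "(\<integral>\<^sup>+z\<in>ball p (1313 * (M + 1) / b * (\<rho> / \<rho> ^ n)). w z \<partial>lborel) \<le> of_nat N1 * W"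
          by (rule set_nn_integral_cover[OF _ _ Z']) (use Suc.prems in auto)
      qed auto
    qed
    obtain Z where Z: "finite Z" "card Z \<le> N2" "?B \<subseteq> (\<Union>p\<in>Z. ball p (\<rho> / \<rho> ^ n))"
      using N2[OF r, of z1] unfolding rad(2) by blast
    have b2: "(\<integral>\<^sup>+z\<in>?B. w z \<partial>lborel) \<le> of_nat N2 * W"
      by (rule set_nn_integral_cover[OF _ _ Z]) (use Suc.prems in auto)
    have "(\<integral>\<^sup>+z\<in>?B. w' z \<partial>lborel) \<le> (\<integral>\<^sup>+z. w z * indicator (bad j n x \<inter> ?B) z + ennreal (gain ^ q) * (w z * indicator ?B z) \<partial>lborel)"
      by (rule nn_integral_mono) (auto simp: w'_def h_def indicator_def mult.commute)
    also have "\<dots> = (\<integral>\<^sup>+z\<in>bad j n x \<inter> ?B. w z \<partial>lborel) + ennreal (gain ^ q) * (\<integral>\<^sup>+z\<in>?B. w z \<partial>lborel)"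
    proof -
      have 1: "(\<lambda>z. w z * indicator (bad j n x \<inter> ?B) z) \<in> borel_measurable lborel"
        and 2: "(\<lambda>z. w z * indicator ?B z) \<in> borel_measurable lborel"
        using Suc.prems(2) bad_sets[OF Suc.prems(1)]
        by (auto intro!: borel_measurable_times_ennreal borel_measurable_indicator sets.Int)
      have "(\<lambda>z. ennreal (gain ^ q) * (w z * indicator ?B z)) \<in> borel_measurable lborel"
        by (rule borel_measurable_times_ennreal[OF borel_measurable_const 2])
      from nn_integral_add[OF 1 this] show ?thesis unfolding nn_integral_cmult[OF 2] .
    qed
    also have "\<dots> \<le> of_nat (5 ^ (M + 1)) * (of_nat N1 * W) + ennreal (gain ^ q) * (of_nat N2 * W)"
      by (intro add_mono b1 mult_left_mono b2) auto
    also have "ennreal (gain ^ q) * (of_nat N2 * W) = ennreal (gain ^ q * N2) * W"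
      using gain(3) by (simp add: ennreal_mult mult.assoc ennreal_of_nat_eq_real_of_nat)
    also have "\<dots> \<le> 1 * W" using q by (intro mult_right_mono) auto
    also have "of_nat (5 ^ (M + 1)) * (of_nat N1 * W) + 1 * W = ?A * W"
      by (simp add: algebra_simps)
    finally show ?thesis unfolding rad(1) by (simp add: add_left_mono)
  qed
  let ?B = "ball z0 (\<rho> / \<rho> ^ (n + Suc j))" and ?c = "ennreal (1 / (M + 1))"
  note [measurable] = maj_measurable[OF ch_mem[OF Suc.prems(1)]]
  have "(\<integral>\<^sup>+z\<in>?B. w z * ennreal (maj (Suc j) n x z ^ q) \<partial>lborel)
      \<le> (\<integral>\<^sup>+z. (\<Sum>i\<le>M. ?c * (w' z * ennreal (maj j (Suc n) (ch n x i) z ^ q) * indicator ?B z)) \<partial>lborel)"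
  proof (rule nn_integral_mono)
    fix z
    have "ennreal (maj (Suc j) n x z ^ q) \<le> ennreal ((if z \<in> bad j n x then 1 else gain ^ q) * ((\<Sum>i\<le>M. maj j (Suc n) (ch n x i) z ^ q) / (M + 1)))"
      using maj_power_le by (intro ennreal_leI) blast
    also have "\<dots> = h z * ennreal ((\<Sum>i\<le>M. 1 / (M + 1) * maj j (Suc n) (ch n x i) z ^ q))"
      using gain(3) maj_pos by (subst ennreal_mult) (auto simp: h_def sum_divide_distrib less_imp_le intro!: sum_nonneg divide_nonneg_nonneg)
    also have "ennreal ((\<Sum>i\<le>M. 1 / (M + 1) * maj j (Suc n) (ch n x i) z ^ q)) = (\<Sum>i\<le>M. ?c * ennreal (maj j (Suc n) (ch n x i) z ^ q))"
      using maj_pos by (subst sum_ennreal[symmetric]) (auto simp: ennreal_mult less_imp_le simp flip: ennreal_mult)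
    finally have "w z * ennreal (maj (Suc j) n x z ^ q) * indicator ?B z \<le> w z * (h z * (\<Sum>i\<le>M. ?c * ennreal (maj j (Suc n) (ch n x i) z ^ q))) * indicator ?B z"
      by (intro mult_right_mono mult_left_mono) auto
    also have "\<dots> = (\<Sum>i\<le>M. ?c * (w' z * ennreal (maj j (Suc n) (ch n x i) z ^ q) * indicator ?B z))"
      by (simp add: w'_def sum_distrib_left sum_distrib_right mult_ac)
    finally show "w z * ennreal (maj (Suc j) n x z ^ q) * indicator ?B z \<le> \<dots>" .
  qed
  also have "\<dots> = (\<Sum>i\<le>M. ?c * (\<integral>\<^sup>+z\<in>?B. w' z * ennreal (maj j (Suc n) (ch n x i) z ^ q) \<partial>lborel))"
  proof -
    have m: "(\<lambda>z. w' z * ennreal (maj j (Suc n) (ch n x i) z ^ q) * indicator ?B z) \<in> borel_measurable lborel" for i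
      using maj_measurable[OF ch_mem[OF Suc.prems(1)]] w'
      by (auto intro!: borel_measurable_times_ennreal borel_measurable_indicator)
    show ?thesis
      by (subst nn_integral_sum) (use m in \<open>auto simp: nn_integral_cmult intro!: borel_measurable_times_ennreal\<close>)
  qed
  also have "\<dots> \<le> (\<Sum>i\<le>M. ?c * (?A ^ j * (?A * W)))"
  proof (intro sum_mono mult_left_mono)
    fix i
    show "(\<integral>\<^sup>+z\<in>?B. w' z * ennreal (maj j (Suc n) (ch n x i) z ^ q) \<partial>lborel) \<le> ?A ^ j * (?A * W)"
      using Suc.IH[OF ch_mem[OF Suc.prems(1), of n i] w' W'] by simp
  qed simp
  also have "\<dots> = ?A ^ Suc j * W"
  proof -
    have "of_nat (M + 1) * ?c = 1"
      by (simp add: ennreal_of_nat_eq_real_of_nat ennreal_mult[symmetric] del: of_nat_Suc flip: of_nat_Suc)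
    then have "of_nat (M + 1) * (?c * (?A ^ j * (?A * W))) = ?A ^ j * (?A * W)"
      by (simp only: mult.assoc[symmetric] mult_1)
    then show ?thesis by (simp add: mult_ac del: of_nat_Suc of_nat_add)
  qed
  finally show ?case .
qed

end

section \<open>Supports and layers\<close>

text \<open>The cover need only reach the points where f does not vanish. For negative powers this
  leaves out the zero set of the base, since 0 \<open>powr\<close> anything is 0.\<close>

lemma nn_integral_countable_cover:
  fixes f :: "'a \<Rightarrow> ennreal" and A :: "nat \<Rightarrow> 'a set"
  assumes f: "f \<in> borel_measurable M" and A: "\<And>i. A i \<in> sets M"
    and cover: "\<And>z. f z \<noteq> 0 \<Longrightarrow> z \<in> S \<Longrightarrow> \<exists>i. z \<in> A i"
  shows "(\<integral>\<^sup>+z\<in>S. f z \<partial>M) \<le> (\<Sum>i. \<integral>\<^sup>+z\<in>A i. f z \<partial>M)"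
proof -
  have m: "(\<lambda>z. f z * indicator (A i) z) \<in> borel_measurable M" for i
    using f A by (intro borel_measurable_times_ennreal borel_measurable_indicator)
  have "(\<integral>\<^sup>+z\<in>S. f z \<partial>M) \<le> (\<integral>\<^sup>+z. (\<Sum>i. f z * indicator (A i) z) \<partial>M)"
  proof (rule nn_integral_mono)
    fix z
    show "f z * indicator S z \<le> (\<Sum>i. f z * indicator (A i) z)"
    proof (cases "f z \<noteq> 0 \<and> z \<in> S")
      case True
      then obtain i where i: "z \<in> A i" using cover by blast
      have "f z * indicator S z = (\<Sum>i\<in>{i}. f z * indicator (A i) z)" using i True by simp
      also have "\<dots> \<le> (\<Sum>i. f z * indicator (A i) z)"
        by (rule sum_le_suminf) auto
      finally show ?thesis .
    qed auto
  qed
  also have "\<dots> = (\<Sum>i. \<integral>\<^sup>+z\<in>A i. f z \<partial>M)"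
    by (rule nn_integral_suminf[OF m])
  finally show ?thesis .
qed

lemma power_bracket:
  fixes p t :: real assumes "0 < p" "p < 1" "0 < t" "t \<le> 1"
  obtains i where "p ^ Suc i < t" "t \<le> p ^ i"
proof -
  have "\<exists>i. p ^ i < t" using assms real_arch_pow_inv[of t p] by auto
  define i where "i = (LEAST i. p ^ i < t)"
  have i: "p ^ i < t" unfolding i_def by (rule LeastI_ex) fact
  then obtain k where k: "i = Suc k" using assms by (cases i) auto
  have "\<not> p ^ k < t"
    using not_less_Least[of k "\<lambda>i. p ^ i < t"] k unfolding i_def by simp
  with i k that show thesis by auto
qed

text \<open>Dyadic layers \<open>2 ^ -(i+1) < g \<le> 2 ^ -i\<close>; the bound \<open>a < 1\<close> makes their contributions summable.\<close>

lemma nn_integral_powr_neg_le: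
  fixes g :: "'a \<Rightarrow> real"
  assumes g: "g \<in> borel_measurable M" and S: "S \<in> sets M" and nonneg: "\<And>z. 0 \<le> g z" and C: "0 \<le> C"
    and le: "\<And>t. 0 < t \<Longrightarrow> t \<le> 1 \<Longrightarrow> emeasure M {z \<in> S. g z \<le> t} \<le> ennreal (C * t)"
    and a: "0 < a" "a < 1"
  shows "(\<integral>\<^sup>+z\<in>{z \<in> S. g z \<le> 1}. ennreal (g z powr - a) \<partial>M)
           \<le> ennreal (C * (2 powr a / (1 - 2 powr (a - 1))))"
proof -
  define A where "A = (\<lambda>i::nat. {z \<in> S. (1/2) ^ Suc i < g z \<and> g z \<le> (1/2) ^ i})"
  have [measurable]: "S \<in> sets M" "g \<in> borel_measurable M" by fact+
  have A: "A i \<in> sets M" for i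
  proof -
    have "{z \<in> space M. z \<in> S \<and> (1/2) ^ Suc i < g z \<and> g z \<le> (1/2) ^ i} \<in> sets M" by measurable
    moreover have "{z \<in> space M. z \<in> S \<and> (1/2) ^ Suc i < g z \<and> g z \<le> (1/2) ^ i} = A i"
      using sets.sets_into_space[OF S] by (auto simp: A_def)
    ultimately show ?thesis by (simp only:)
  qed
  have B: "{z \<in> S. g z \<le> (1/2) ^ i} \<in> sets M" for i :: nat
  proof -
    have "{z \<in> space M. z \<in> S \<and> g z \<le> (1/2) ^ i} \<in> sets M" by measurable
    moreover have "{z \<in> space M. z \<in> S \<and> g z \<le> (1/2) ^ i} = {z \<in> S. g z \<le> (1/2) ^ i}"
      using sets.sets_into_space[OF S] by auto
    ultimately show ?thesis by simp
  qed
  define q where "q = 2 powr (a - 1)"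
  have q: "0 < q" "q < 1" using a by (auto simp: q_def powr_less_one)
  have pw: "(1/2) ^ i = (2::real) powr (- real i)" for i
    by (simp add: powr_minus powr_realpow power_one_over inverse_eq_divide)
  have "(\<integral>\<^sup>+z\<in>{z \<in> S. g z \<le> 1}. ennreal (g z powr - a) \<partial>M) \<le> (\<Sum>i. \<integral>\<^sup>+z\<in>A i. ennreal (g z powr - a) \<partial>M)"
  proof (rule nn_integral_countable_cover[OF _ A])
    fix z assume "ennreal (g z powr - a) \<noteq> 0" "z \<in> {z \<in> S. g z \<le> 1}"
    then have "0 < g z" "g z \<le> 1" "z \<in> S" using nonneg[of z] by (auto simp: less_le)
    then show "\<exists>i. z \<in> A i" using power_bracket[of "1/2" "g z"] unfolding A_def by auto
  qed measurable
  also have "\<dots> \<le> (\<Sum>i. ennreal (C * 2 powr a * q ^ i))"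
  proof (rule suminf_le)
    fix i
    have "(\<integral>\<^sup>+z\<in>A i. ennreal (g z powr - a) \<partial>M) \<le> (\<integral>\<^sup>+z. ennreal (2 powr (a * Suc i)) * indicator {z \<in> S. g z \<le> (1/2) ^ i} z \<partial>M)"
    proof (rule nn_integral_mono)
      fix z
      show "ennreal (g z powr - a) * indicator (A i) z \<le> ennreal (2 powr (a * Suc i)) * indicator {z \<in> S. g z \<le> (1/2) ^ i} z"
      proof (cases "z \<in> A i")
        case True
        then have "g z powr - a \<le> ((1/2) ^ Suc i) powr - a"
          using a by (intro powr_mono2') (auto simp: A_def)
        also have "\<dots> = 2 powr (a * Suc i)" unfolding pw powr_powr by (simp add: algebra_simps)
        finally show ?thesis using True by (auto simp: A_def)
      qed simp
    qed
    also have "\<dots> = ennreal (2 powr (a * Suc i)) * emeasure M {z \<in> S. g z \<le> (1/2) ^ i}"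
      by (rule nn_integral_cmult_indicator[OF B])
    also have "\<dots> \<le> ennreal (2 powr (a * Suc i)) * ennreal (C * (1/2) ^ i)"
      by (intro mult_left_mono le) (auto simp: power_le_one)
    also have "\<dots> = ennreal (C * 2 powr a * q ^ i)"
    proof -
      have "q ^ i = 2 powr ((a - 1) * i)" unfolding q_def by (simp add: powr_powr flip: powr_realpow)
      moreover have "2 powr (a * Suc i) * (1/2) ^ i = 2 powr a * 2 powr ((a - 1) * i)"
        unfolding pw by (simp add: algebra_simps flip: powr_add)
      ultimately show ?thesis using C by (simp add: mult_ac flip: ennreal_mult)
    qed
    finally show "(\<integral>\<^sup>+z\<in>A i. ennreal (g z powr - a) \<partial>M) \<le> ennreal (C * 2 powr a * q ^ i)" .
  qed auto
  also have "\<dots> = ennreal (\<Sum>i. C * 2 powr a * q ^ i)"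
    using q C by (intro suminf_ennreal2 summable_mult summable_geometric) auto
  also have "(\<Sum>i. C * 2 powr a * q ^ i) = C * (2 powr a / (1 - q))"
    using q by (subst suminf_mult) (auto simp: suminf_geometric summable_geometric)
  finally show ?thesis by (simp add: q_def)
qed

text \<open>The complement of the support is a union of null balls, and countably many of them
  suffice by the Lindelof property.\<close>

lemma emeasure_compl_spt:
  assumes "sets \<mu> = sets borel" shows "emeasure \<mu> (UNIV - spt \<mu>) = 0" and "open (UNIV - spt \<mu>)"
proof -
  define F where "F = {ball x r | x r. emeasure \<mu> (ball x r) = 0 \<and> 0 < (r::real)}"
  have "UNIV - spt \<mu> = \<Union> F"
  proof (intro set_eqI iffI)
    fix x assume "x \<in> UNIV - spt \<mu>"
    then obtain r where "r > 0" "emeasure \<mu> (ball x r) = 0" by (auto simp: spt_def)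
    then show "x \<in> \<Union> F" unfolding F_def by (metis (mono_tags, lifting) UnionI centre_in_ball mem_Collect_eq)
  next
    fix x assume "x \<in> \<Union> F"
    then obtain y r where yr: "emeasure \<mu> (ball y r) = 0" "x \<in> ball y r" by (auto simp: F_def)
    then have "ball x (r - dist y x) \<subseteq> ball y r" "0 < r - dist y x"
      by (auto simp: subset_iff dist_commute) (metis add.commute dist_commute dist_triangle_lt less_diff_eq)
    then have "emeasure \<mu> (ball x (r - dist y x)) = 0" "0 < r - dist y x"
      using yr(1) emeasure_mono[of "ball x (r - dist y x)" "ball y r" \<mu>] assms by auto
    then show "x \<in> UNIV - spt \<mu>"
      unfolding spt_def by (auto intro!: exI[of _ "r - dist y x"])
  qed
  moreover obtain F' where F': "F' \<subseteq> F" "countable F'" "\<Union> F' = \<Union> F"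
    by (rule Lindelof[of F]) (auto simp: F_def)
  moreover have "\<Union> F' \<in> null_sets \<mu>"
  proof -
    have "(\<Union>S\<in>F'. S) \<in> null_sets \<mu>"
      using F' assms by (intro null_sets_UN') (auto simp: F_def null_sets_def)
    then show ?thesis by simp
  qed
  ultimately show "emeasure \<mu> (UNIV - spt \<mu>) = 0" by auto
  show "open (UNIV - spt \<mu>)" unfolding \<open>UNIV - spt \<mu> = \<Union> F\<close> by (auto simp: F_def)
qed

lemma closed_spt: "sets \<mu> = sets borel \<Longrightarrow> closed (spt \<mu>)"
  unfolding closed_def Compl_eq_Diff_UNIV by (rule emeasure_compl_spt(2))

lemma emeasure_Int_spt:
  assumes "sets \<mu> = sets borel" "A \<in> sets borel"
  shows "emeasure \<mu> (A \<inter> spt \<mu>) = emeasure \<mu> A"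
proof -
  have s: "spt \<mu> \<in> sets \<mu>" unfolding assms(1) by (rule borel_closed[OF closed_spt[OF assms(1)]])
  have "emeasure \<mu> A \<le> emeasure \<mu> (A \<inter> spt \<mu>) + emeasure \<mu> (UNIV - spt \<mu>)"
  proof -
    have "UNIV - spt \<mu> \<in> sets \<mu>" unfolding assms(1) by (rule borel_open[OF emeasure_compl_spt(2)[OF assms(1)]])
    moreover have "A \<inter> spt \<mu> \<in> sets \<mu>" by (rule sets.Int) (use s assms in auto)
    moreover have "A \<subseteq> (A \<inter> spt \<mu>) \<union> (UNIV - spt \<mu>)" by auto
    ultimately show ?thesis
      by (intro order_trans[OF emeasure_mono[of A "(A \<inter> spt \<mu>) \<union> (UNIV - spt \<mu>)" \<mu>] emeasure_subadditive] sets.Un)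
  qed
  then have "emeasure \<mu> A \<le> emeasure \<mu> (A \<inter> spt \<mu>)" using emeasure_compl_spt(1)[OF assms(1)] by simp
  then show ?thesis using emeasure_mono[of "A \<inter> spt \<mu>" A \<mu>] assms by (intro antisym) auto
qed

lemma measures_on_facts:
  assumes "\<mu> \<in> measures_on X" "compact X"
  shows "sets \<mu> = sets borel" "space \<mu> = UNIV" "compact (spt \<mu>)" "spt \<mu> \<subseteq> X"
    "emeasure \<mu> (spt \<mu>) = emeasure \<mu> X" "emeasure \<mu> UNIV = emeasure \<mu> X" "0 < emeasure \<mu> X"
    "finite_measure \<mu>" "spt \<mu> \<noteq> {}"
proof -
  show s: "sets \<mu> = sets borel" and "compact (spt \<mu>)" and sub: "spt \<mu> \<subseteq> X" and pos: "0 < emeasure \<mu> X"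
    using assms by (auto simp: measures_on_def)
  show sp: "space \<mu> = UNIV" using sets_eq_imp_space_eq[OF s] by simp
  have "X \<in> sets borel" using assms(2) by (simp add: borel_compact)
  from emeasure_Int_spt[OF s this] show 1: "emeasure \<mu> (spt \<mu>) = emeasure \<mu> X"
    using sub by (simp add: Int_absorb1)
  have "emeasure \<mu> (UNIV \<inter> spt \<mu>) = emeasure \<mu> UNIV"
    by (rule emeasure_Int_spt[OF s]) simp
  with 1 show 2: "emeasure \<mu> UNIV = emeasure \<mu> X" by simp
  show "finite_measure \<mu>"
    by (rule finite_measureI) (use assms 2 sp in \<open>auto simp: measures_on_def\<close>)
  show "spt \<mu> \<noteq> {}" using 1 pos by auto
qed

section \<open>Flat measures on non-concentrated sets\<close>

text \<open>What the construction keeps of non-concentration: the measure is forgotten, and only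
  hyperplanes through the centre occur, each given by a unit normal.\<close>

definition hyperplane_diffuse :: "real \<Rightarrow> 'a::euclidean_space set \<Rightarrow> bool" where
  "hyperplane_diffuse \<beta> K \<longleftrightarrow>
     (\<forall>x\<in>K. \<forall>r n. 0 < r \<longrightarrow> r \<le> 1 \<longrightarrow> norm n = 1 \<longrightarrow>
        (\<exists>y\<in>K. dist x y < r \<and> \<beta> * r \<le> \<bar>n \<bullet> (y - x)\<bar>))"

text \<open>If all of the support in a ball lay in the slab of relative width \<epsilon> about a
  hyperplane through the centre, the choice C \<epsilon> ^ \<alpha> = 1/2 would bound the mass of
  the ball by half of itself, although balls about support points have positive mass.\<close>

lemma nonconcentrated_imp_diffuse:
  fixes \<mu> :: "'a::euclidean_space measure"
  assumes \<mu>: "\<mu> \<in> measures_on X" "compact X" and C: "1 \<le> C" and \<alpha>: "0 < \<alpha>"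
    and nc: "uniformly_affinely_nonconcentrated C \<alpha> \<mu>"
  shows "\<exists>\<beta>>0. hyperplane_diffuse \<beta> (spt \<mu>)"
proof -
  note facts = measures_on_facts[OF \<mu>]
  interpret finite_measure \<mu> by (rule facts)
  define \<epsilon> where "\<epsilon> = (1 / (2 * C)) powr (1 / \<alpha>)"
  have \<epsilon>: "0 < \<epsilon>" using C by (simp add: \<epsilon>_def)
  have half: "C * \<epsilon> powr \<alpha> = 1/2" using C \<alpha> by (simp add: \<epsilon>_def powr_powr)
  have "\<exists>y\<in>spt \<mu>. dist x y < r \<and> \<epsilon> * r \<le> \<bar>n \<bullet> (y - x)\<bar>"
    if x: "x \<in> spt \<mu>" and r: "0 < r" "r \<le> 1" and n: "norm n = 1" for x r n
  proof (rule ccontr)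
    assume neg: "\<not> ?thesis"
    define W where "W = {y. n \<bullet> y = n \<bullet> x}"
    have nn: "n \<bullet> n = 1" using n by (simp add: norm_eq_1)
    have W: "Defs.affine_hyperplane W"
    proof -
      have "n \<noteq> 0" using n by auto
      from aff_dim_hyperplane[OF this, of "n \<bullet> x"] show ?thesis
        by (simp add: Defs.affine_hyperplane_def W_def Affine.affine_hyperplane)
    qed
    have sub: "ball x r \<inter> spt \<mu> \<subseteq> nbhd W (\<epsilon> * r) \<inter> ball x r"
    proof
      fix y assume y: "y \<in> ball x r \<inter> spt \<mu>"
      then have lt: "\<bar>n \<bullet> (y - x)\<bar> < \<epsilon> * r" using neg by force
      define w where "w = y - (n \<bullet> (y - x)) *\<^sub>R n"
      have "w \<in> W" by (simp add: W_def w_def inner_diff_right nn)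
      moreover have "y \<in> ball w (\<epsilon> * r)" using lt n by (simp add: w_def dist_norm)
      ultimately show "y \<in> nbhd W (\<epsilon> * r) \<inter> ball x r" using y by (auto simp: nbhd_def)
    qed
    have op: "open (nbhd W (\<epsilon> * r) \<inter> ball x r)" by (auto simp: nbhd_def)
    have "emeasure \<mu> (ball x r) = emeasure \<mu> (ball x r \<inter> spt \<mu>)"
      by (rule emeasure_Int_spt[symmetric, OF facts(1)]) simp
    also have "\<dots> \<le> emeasure \<mu> (nbhd W (\<epsilon> * r) \<inter> ball x r)"
      using op facts(1) by (intro emeasure_mono sub) auto
    also have "\<dots> \<le> ennreal (C * \<epsilon> powr \<alpha>) * emeasure \<mu> (ball x r)"
      using nc \<epsilon> x r W unfolding uniformly_affinely_nonconcentrated_def by blast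
    also have "\<dots> = ennreal (measure \<mu> (ball x r) / 2)"
      unfolding half emeasure_eq_measure by (subst ennreal_mult[symmetric]) auto
    finally have "measure \<mu> (ball x r) \<le> measure \<mu> (ball x r) / 2"
      by (simp add: emeasure_eq_measure)
    moreover have "0 < emeasure \<mu> (ball x r)" using x r by (simp add: spt_def)
    ultimately show False by (simp add: emeasure_eq_measure)
  qed
  then show ?thesis using \<epsilon> unfolding hyperplane_diffuse_def by blast
qed

text \<open>The number \<open>M\<close> of children and the spread \<open>b\<close> do not depend on the contraction ratio \<open>\<rho>\<close>:
  one child is chosen for each direction in a net of the unit sphere.\<close>

lemma diffuse_imp_spread_walk:
  fixes K :: "'a::euclidean_space set"
  assumes K: "compact K" and \<beta>: "0 < \<beta>" and diff: "hyperplane_diffuse \<beta> K"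
  shows "\<exists>M b. \<forall>\<rho>. 0 < \<rho> \<longrightarrow> \<rho> \<le> 1/8 \<longrightarrow> (\<exists>ch. spread_walk M ch \<rho> K b)"
proof -
  have "sphere (0::'a) 1 \<subseteq> (\<Union>m\<in>sphere 0 1. ball m (\<beta> / 2))" using \<beta> by force
  then obtain N where N: "N \<subseteq> sphere (0::'a) 1" "finite N" "sphere 0 1 \<subseteq> (\<Union>m\<in>N. ball m (\<beta> / 2))"
    using compactE_image[OF compact_sphere, of "sphere 0 1" "\<lambda>m. ball m (\<beta> / 2)" 0 1] by (metis open_ball)
  obtain l where l: "set l = N" using finite_list[OF N(2)] by blast
  have "\<exists>ch. spread_walk (length l) ch \<rho> K (\<beta> / 2)" if \<rho>: "0 < \<rho>" "\<rho> \<le> 1/8" for \<rho>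
  proof -
    \<comment> \<open>Child i follows entry i - 1 of the net, since index 0 is reserved for standing
      still. The default value x makes \<open>ch\<close> total and harmless beyond the list and
      outside \<open>K\<close>.\<close>
    define ch where "ch = (\<lambda>n x i. if i = 0 \<or> length l < i \<or> x \<notin> K then x
        else SOME y. y \<in> K \<and> dist x y < \<rho> ^ n \<and> \<beta> * \<rho> ^ n \<le> \<bar>l ! (i - 1) \<bullet> (y - x)\<bar>)"
    have ch: "ch n x i \<in> K \<and> dist x (ch n x i) < \<rho> ^ n \<and> \<beta> * \<rho> ^ n \<le> \<bar>l ! (i - 1) \<bullet> (ch n x i - x)\<bar>"
      if "x \<in> K" "0 < i" "i \<le> length l" for n x i
    proof -
      have "l ! (i - 1) \<in> N" using l that nth_mem[of "i - 1" l] by auto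
      then have "norm (l ! (i - 1)) = 1" using N(1) by auto
      moreover have "0 < \<rho> ^ n" "\<rho> ^ n \<le> 1" using \<rho> by (auto simp: power_le_one)
      ultimately have "\<exists>y. y \<in> K \<and> dist x y < \<rho> ^ n \<and> \<beta> * \<rho> ^ n \<le> \<bar>l ! (i - 1) \<bullet> (y - x)\<bar>"
        using diff that(1) unfolding hyperplane_diffuse_def by blast
      from someI_ex[OF this] show ?thesis using that unfolding ch_def by simp
    qed
    have triv: "ch n x i = x" if "\<not> (0 < i \<and> i \<le> length l)" for n x i using that by (auto simp: ch_def)
    have "spread_walk (length l) ch \<rho> K (\<beta> / 2)"
    proof
      show "0 < \<rho>" "\<rho> \<le> 1 / 4" "\<rho> \<le> 1 / 8" "compact K" "0 < \<beta> / 2" using \<rho> K \<beta> by auto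
      show "ch n x 0 = x" for n x by (simp add: triv)
      show "ch n x i \<in> K" if "x \<in> K" for n x i
        using ch[OF that] triv that by (cases "0 < i \<and> i \<le> length l") auto
      show "norm (ch n x i - x) \<le> \<rho> ^ n" if "x \<in> K" for n x i
        using ch[OF that, of i n] triv[of i n x] \<rho>
        by (cases "0 < i \<and> i \<le> length l") (auto simp: dist_norm norm_minus_commute less_imp_le)
      show "\<exists>i\<le>length l. \<beta> / 2 * \<rho> ^ n * norm z \<le> \<bar>z \<bullet> (ch n x i - x)\<bar>" if x: "x \<in> K" for n x z
      proof (cases "z = 0")
        case False
        define u where "u = z /\<^sub>R norm z"
        have "u \<in> sphere 0 1" using False by (simp add: u_def)
        then obtain m where m: "m \<in> N" "dist m u < \<beta> / 2" using N(3) by auto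
        then obtain k where k: "k < length l" "l ! k = m" using l by (metis in_set_conv_nth)
        let ?v = "ch n x (Suc k) - x"
        have c: "norm ?v \<le> \<rho> ^ n" "\<beta> * \<rho> ^ n \<le> \<bar>m \<bullet> ?v\<bar>"
          using ch[OF x, of "Suc k" n] k by (auto simp: dist_norm norm_minus_commute)
        \<comment> \<open>Half of \<beta> pays for replacing the direction u by the net point
          m.\<close>
        have "\<bar>(m - u) \<bullet> ?v\<bar> \<le> \<beta> / 2 * \<rho> ^ n"
          using Cauchy_Schwarz_ineq2[of "m - u" ?v] mult_mono[of "norm (m - u)" "\<beta> / 2" "norm ?v" "\<rho> ^ n"] c(1) m(2) \<beta>
          by (simp add: dist_norm)
        moreover have "(m - u) \<bullet> ?v = m \<bullet> ?v - u \<bullet> ?v" by (simp add: inner_diff_left)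
        ultimately have "\<beta> / 2 * \<rho> ^ n \<le> \<bar>u \<bullet> ?v\<bar>" using c(2) by linarith
        then have "\<beta> / 2 * \<rho> ^ n * norm z \<le> \<bar>u \<bullet> ?v\<bar> * norm z" by (intro mult_right_mono) auto
        also have "\<bar>u \<bullet> ?v\<bar> * norm z = \<bar>z \<bullet> ?v\<bar>" using False by (simp add: u_def abs_mult)
        finally show ?thesis using k by (intro exI[of _ "Suc k"]) auto
      qed (auto intro: exI[of _ 0])
    qed
    then show ?thesis by blast
  qed
  then show ?thesis by blast
qed

section \<open>Flat measures from the walk\<close>

context spread_walk
begin

definition walk_measure :: "'a \<Rightarrow> 'a measure" where
  "walk_measure x = distr S borel (endpoint 0 x)"

lemma walk_measure_on:
  assumes x: "x \<in> K" and KX: "K \<subseteq> X" "compact X"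
  shows "walk_measure x \<in> measures_on X"
proof -
  interpret P: prob_space S by (rule prob_space_S)
  note m = endpoint_measurable[OF x, of 0]
  have s: "sets (walk_measure x) = sets borel" by (simp add: walk_measure_def)
  have X: "X \<in> sets borel" using KX by (simp add: borel_compact)
  have em: "emeasure (walk_measure x) A = 1" if "A \<in> sets borel" "K \<subseteq> A" for A
  proof -
    have "endpoint 0 x -` A \<inter> space S = space S" using endpoint_mem[OF x] that by auto
    then show ?thesis unfolding walk_measure_def using emeasure_distr[OF m that(1)] P.emeasure_space_1 by simp
  qed
  have sub: "spt (walk_measure x) \<subseteq> X"
  proof
    fix y assume y: "y \<in> spt (walk_measure x)"
    show "y \<in> X"
    proof (rule ccontr)
      assume "y \<notin> X"
      then obtain r where r: "r > 0" "ball y r \<subseteq> - X"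
        using compact_imp_closed[OF KX(2)] open_contains_ball[of "- X"] by auto
      have "endpoint 0 x -` ball y r \<inter> space S = {}" using endpoint_mem[OF x] r KX by blast
      then have "emeasure (walk_measure x) (ball y r) = 0"
        unfolding walk_measure_def by (subst emeasure_distr[OF m]) auto
      then show False using y r by (auto simp: spt_def)
    qed
  qed
  have "compact (X \<inter> spt (walk_measure x))"
    by (rule compact_Int_closed[OF KX(2) closed_spt[OF s]])
  then show ?thesis using s sub em[OF X KX(1)] by (simp add: measures_on_def Int_absorb1)
qed

lemma cmod_fourier_walk_measure:
  assumes x: "x \<in> K" shows "cmod (fourier_transform (walk_measure x) z) = cmod (trans 0 x z)"
proof -
  note m = endpoint_measurable[OF x, of 0]
  have e: "exp (- 2 * complex_of_real pi * \<i> * complex_of_real (z \<bullet> y)) = cis (- (2 * pi * (z \<bullet> y)))" for y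
    by (simp add: cis_conv_exp algebra_simps)
  have "fourier_transform (walk_measure x) z = (\<integral>\<omega>. cis (- (2 * pi * (z \<bullet> endpoint 0 x \<omega>))) \<partial>S)"
    unfolding fourier_transform_def walk_measure_def e
    by (rule integral_distr[OF m]) (unfold cis_conv_exp, measurable)
  also have "\<dots> = (\<integral>\<omega>. cis (- (2 * pi * (z \<bullet> x))) * cis (- (2 * pi * (z \<bullet> (endpoint 0 x \<omega> - x)))) \<partial>S)"
    by (simp add: cis_mult inner_diff_right algebra_simps)
  also have "\<dots> = cis (- (2 * pi * (z \<bullet> x))) * trans 0 x z"
    unfolding trans_def by simp
  finally show ?thesis by (simp add: norm_mult)
qed

lemma fourier_power_ball_bound:
  assumes N1: "\<And>z r. 0 < r \<Longrightarrow> \<exists>Z. finite Z \<and> card Z \<le> N1 \<and> ball (z::'a) ((1313 * (M + 1) / b) * r) \<subseteq> (\<Union>p\<in>Z. ball p r)"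
    and N2: "\<And>z r. 0 < r \<Longrightarrow> \<exists>Z. finite Z \<and> card Z \<le> N2 \<and> ball (z::'a) (1 / \<rho> * r) \<subseteq> (\<Union>p\<in>Z. ball p r)"
    and q: "gain ^ q * N2 \<le> 1" and x: "x \<in> K"
  shows "(\<integral>\<^sup>+z\<in>ball 0 (\<rho> / \<rho> ^ m). ennreal (cmod (fourier_transform (walk_measure x) z) ^ (2 * q)) \<partial>lborel)
           \<le> ennreal (real (5 ^ (M + 1) * N1 + 1) ^ m * (unit_ball_vol DIM('a) * \<rho> ^ DIM('a)))"
proof -
  let ?W = "ennreal (unit_ball_vol DIM('a) * \<rho> ^ DIM('a))"
  have "(\<integral>\<^sup>+z\<in>ball 0 (\<rho> / \<rho> ^ m). ennreal (cmod (fourier_transform (walk_measure x) z) ^ (2 * q)) \<partial>lborel)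
      \<le> (\<integral>\<^sup>+z\<in>ball 0 (\<rho> / \<rho> ^ (0 + m)). 1 * ennreal (maj m 0 x z ^ q) \<partial>lborel)"
  proof (rule nn_integral_mono)
    fix z
    have "cmod (fourier_transform (walk_measure x) z) ^ (2 * q) \<le> maj m 0 x z ^ q"
      unfolding cmod_fourier_walk_measure[OF x] power_mult by (intro power_mono maj_bound(1)[OF x]) auto
    then show "ennreal (cmod (fourier_transform (walk_measure x) z) ^ (2 * q)) * indicator (ball 0 (\<rho> / \<rho> ^ m)) z
        \<le> 1 * ennreal (maj m 0 x z ^ q) * indicator (ball 0 (\<rho> / \<rho> ^ (0 + m))) z"
      by (auto simp: indicator_def intro: ennreal_leI)
  qed
  also have "\<dots> \<le> of_nat (5 ^ (M + 1) * N1 + 1) ^ m * ?W"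
  proof (rule weighted_majorant_bound[OF N1 N2 q x])
    show "(\<integral>\<^sup>+z\<in>ball z0 (\<rho> / \<rho> ^ 0). 1 \<partial>lborel) \<le> ?W" for z0 :: 'a
      using emeasure_ball[of \<rho> z0] rho by simp
  qed simp_all
  also have "\<dots> = ennreal (real (5 ^ (M + 1) * N1 + 1) ^ m * (unit_ball_vol DIM('a) * \<rho> ^ DIM('a)))"
    by (simp add: ennreal_of_nat_eq_real_of_nat ennreal_power ennreal_mult' del: of_nat_Suc of_nat_add of_nat_mult of_nat_power)
  finally show ?thesis .
qed

end

text \<open>With s = (d - \<epsilon>) \<theta> and \<theta> = 1 / q the energy integrand is the 2
  q-th power of the transform times |z| ^ - \<epsilon>. Balls of radius \<rho> / \<rho> ^ m have
  mass O(A ^ m) for the 2 q-th power, so the shells at \<rho> ^ - m contribute O((A \<rho> ^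
  \<epsilon>) ^ m), a convergent geometric series.\<close>

lemma flat_fourier_spectrum:
  fixes X :: "'a::euclidean_space set" and \<epsilon> :: real
  assumes X: "compact X" and C: "1 \<le> C" "0 < \<alpha>"
    and \<mu>: "\<mu> \<in> measures_on X" "uniformly_affinely_nonconcentrated C \<alpha> \<mu>"
    and \<epsilon>: "0 < \<epsilon>" "\<epsilon> < 1"
  shows "\<exists>\<theta>\<in>{0<..1}. \<exists>\<nu>\<in>measures_on X. fourier_energy ((DIM('a) - \<epsilon>) * \<theta>) \<theta> \<nu> < \<infinity>"
proof -
  note facts = measures_on_facts[OF \<mu>(1) X]
  obtain \<beta> where \<beta>: "\<beta> > 0" "hyperplane_diffuse \<beta> (spt \<mu>)"
    using nonconcentrated_imp_diffuse[OF \<mu>(1) X C \<mu>(2)] by blast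
  obtain M b where Mb: "\<And>\<rho>. 0 < \<rho> \<Longrightarrow> \<rho> \<le> 1/8 \<Longrightarrow> \<exists>ch. spread_walk M ch \<rho> (spt \<mu>) b"
    using diffuse_imp_spread_walk[OF facts(3) \<beta>] by blast
  obtain N1 where N1: "\<And>z r. 0 < r \<Longrightarrow> \<exists>Z. finite Z \<and> card Z \<le> N1 \<and> ball (z::'a) ((1313 * (M + 1) / b) * r) \<subseteq> (\<Union>p\<in>Z. ball p r)"
    using ball_cover_number[of "1313 * (M + 1) / b"] by blast
  define A where "A = real (5 ^ (M + 1) * N1 + 1)"
  have A: "1 \<le> A" by (simp add: A_def)
  \<comment> \<open>The second entry makes A \<rho> ^ \<epsilon> at most 1/2. This is not circular:
    M, b, and with them N1 and A, were obtained before \<rho>.\<close>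
  define \<rho> where "\<rho> = min (1/8) ((1 / (2 * A)) powr (1 / \<epsilon>))"
  have \<rho>: "0 < \<rho>" "\<rho> \<le> 1/8" using A by (auto simp: \<rho>_def)
  have "\<rho> powr \<epsilon> \<le> ((1 / (2 * A)) powr (1 / \<epsilon>)) powr \<epsilon>"
    using \<epsilon> A by (intro powr_mono2) (auto simp: \<rho>_def)
  also have "\<dots> = 1 / (2 * A)" using \<epsilon> A by (simp add: powr_powr)
  finally have A\<rho>: "A * \<rho> powr \<epsilon> \<le> 1/2" using A by (simp add: field_simps)
  obtain ch where "spread_walk M ch \<rho> (spt \<mu>) b" using Mb[OF \<rho>] by blast
  then interpret spread_walk M ch \<rho> "spt \<mu>" b .
  obtain N2 where N2: "\<And>z r. 0 < r \<Longrightarrow> \<exists>Z. finite Z \<and> card Z \<le> N2 \<and> ball (z::'a) (1 / \<rho> * r) \<subseteq> (\<Union>p\<in>Z. ball p r)"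
    using ball_cover_number[of "1 / \<rho>"] by blast
  \<comment> \<open>N2 and \<open>gain\<close> both depend on \<rho>, so q is chosen after
    it.\<close>
  obtain q where q: "0 < q" "gain ^ q * N2 \<le> 1"
  proof -
    obtain p where p: "gain ^ p < 1 / (real N2 + 1)"
      using real_arch_pow_inv[of "1 / (real N2 + 1)" gain] gain by auto
    have "gain ^ Suc p \<le> gain ^ p" using gain by (simp add: mult_left_le_one_le)
    then have "gain ^ Suc p * (real N2 + 1) \<le> 1 / (real N2 + 1) * (real N2 + 1)"
      using p by (intro mult_right_mono) auto
    also have "\<dots> = 1" by simp
    finally have "gain ^ Suc p * real N2 \<le> 1"
      using zero_le_power[OF less_imp_le[OF gain(3)], of "Suc p"] by (simp only: distrib_left)
    then show thesis using that[of "Suc p"] by simp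
  qed
  obtain x where x: "x \<in> spt \<mu>" using facts(9) by blast
  define \<nu> where "\<nu> = walk_measure x"
  have \<nu>: "\<nu> \<in> measures_on X" unfolding \<nu>_def by (rule walk_measure_on[OF x facts(4) X])
  define \<theta> where "\<theta> = 1 / real q"
  have \<theta>: "\<theta> \<in> {0<..1}" using q by (simp add: \<theta>_def)
  define F where "F = (\<lambda>z. cmod (fourier_transform \<nu> z) ^ (2 * q))"
  have F: "F z = cmod (trans 0 x z) ^ (2 * q)" for z
    by (simp add: F_def \<nu>_def cmod_fourier_walk_measure[OF x])
  have [measurable]: "F \<in> borel_measurable borel"
    unfolding F[abs_def] using trans_measurable[OF x, of 0] by measurable
  have F1: "F z \<le> 1" "0 \<le> F z" for z unfolding F using trans_le_1[of 0 x z] by (auto intro: power_le_one)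
  define f where "f = (\<lambda>z. ennreal (F z * norm z powr - \<epsilon>))"
  have [measurable]: "f \<in> borel_measurable borel" unfolding f_def by measurable
  define V where "V = unit_ball_vol DIM('a)"
  have V: "0 \<le> V" by (simp add: V_def)
  \<comment> \<open>Near the origin the transform is at most 1, and |z| ^ - \<epsilon> is integrable
    since \<epsilon> < 1 \<le> d.\<close>
  have small: "(\<integral>\<^sup>+z\<in>{z. norm z \<le> 1}. f z \<partial>lborel) < \<infinity>"
  proof -
    have "(\<integral>\<^sup>+z\<in>{z. norm z \<le> 1}. f z \<partial>lborel) \<le> (\<integral>\<^sup>+z\<in>{z \<in> (UNIV::'a set). norm z \<le> 1}. ennreal (norm z powr - \<epsilon>) \<partial>lborel)"
      unfolding f_def by (rule nn_integral_mono) (use F1 in \<open>auto simp: indicator_def mult_left_le_one_le intro!: ennreal_leI\<close>)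
    also have "\<dots> \<le> ennreal (V * (2 powr \<epsilon> / (1 - 2 powr (\<epsilon> - 1))))"
    proof (rule nn_integral_powr_neg_le)
      fix t :: real assume t: "0 < t" "t \<le> 1"
      have "{z \<in> UNIV. norm z \<le> t} = cball (0::'a) t" by auto
      moreover have "t ^ DIM('a) \<le> t ^ 1" using t DIM_positive[where 'a='a] by (intro power_decreasing) auto
      ultimately show "emeasure lborel {z \<in> (UNIV::'a set). norm z \<le> t} \<le> ennreal (V * t)"
        using t V emeasure_cball[of t "0::'a"] by (auto simp: V_def intro!: ennreal_leI mult_left_mono)
    qed (use \<epsilon> V in auto)
    finally show ?thesis by (simp add: le_less_trans)
  qed
  define P where "P = (\<lambda>m. {z::'a. 1 / \<rho> ^ m \<le> norm z \<and> norm z < 1 / \<rho> ^ Suc m})"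
  have large: "(\<integral>\<^sup>+z\<in>{z. 1 \<le> norm z}. f z \<partial>lborel) < \<infinity>"
  proof -
    have "(\<integral>\<^sup>+z\<in>{z. 1 \<le> norm z}. f z \<partial>lborel) \<le> (\<Sum>m. \<integral>\<^sup>+z\<in>P m. f z \<partial>lborel)"
    proof (rule nn_integral_countable_cover)
      show "P m \<in> sets lborel" for m unfolding P_def by measurable
      fix z :: 'a assume "z \<in> {z. 1 \<le> norm z}"
      then have z: "1 \<le> norm z" by simp
      obtain m where "\<rho> ^ Suc m < 1 / norm z" "1 / norm z \<le> \<rho> ^ m"
        by (rule power_bracket[of \<rho> "1 / norm z"]) (use z \<rho> zero_less_one[THEN less_le_trans, OF z] in \<open>auto simp: divide_le_eq_1\<close>)
      moreover have "0 < norm z" "0 < \<rho> ^ m" "0 < \<rho> ^ Suc m" using \<rho> zero_less_one[THEN less_le_trans, OF z] by auto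
      ultimately have "z \<in> P m" unfolding P_def by (simp add: field_simps)
      then show "\<exists>m. z \<in> P m" by blast
    qed measurable
    also have "\<dots> \<le> (\<Sum>m. ennreal (A\<^sup>2 * (V * \<rho> ^ DIM('a)) * (A * \<rho> powr \<epsilon>) ^ m))"
    proof (rule suminf_le)
      fix m
      \<comment> \<open>The shell lies in the ball of radius \<rho> / \<rho> ^ (m + 2) = 1 / \<rho>
        ^ (m + 1); the shift by 2 costs only the constant A ^ 2.\<close>
      have "(\<integral>\<^sup>+z\<in>P m. f z \<partial>lborel) \<le> (\<integral>\<^sup>+z. ennreal ((\<rho> powr \<epsilon>) ^ m) * (ennreal (F z) * indicator (ball 0 (\<rho> / \<rho> ^ (m + 2))) z) \<partial>lborel)"
      proof (rule nn_integral_mono)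
        fix z
        show "f z * indicator (P m) z \<le> ennreal ((\<rho> powr \<epsilon>) ^ m) * (ennreal (F z) * indicator (ball 0 (\<rho> / \<rho> ^ (m + 2))) z)"
        proof (cases "z \<in> P m")
          case True
          have "norm z powr - \<epsilon> \<le> (1 / \<rho> ^ m) powr - \<epsilon>"
            using True \<epsilon> \<rho> by (intro powr_mono2') (auto simp: P_def)
          also have "\<dots> = (\<rho> powr \<epsilon>) ^ m"
            using \<rho> by (simp add: powr_minus powr_divide powr_powr mult.commute flip: powr_realpow)
          finally have "norm z powr - \<epsilon> \<le> (\<rho> powr \<epsilon>) ^ m" .
          from mult_left_mono[OF this F1(2)[of z]]
          have "F z * norm z powr - \<epsilon> \<le> (\<rho> powr \<epsilon>) ^ m * F z" by (simp only: mult.commute)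
          moreover have "z \<in> ball 0 (\<rho> / \<rho> ^ (m + 2))" using True \<rho> by (simp add: P_def)
          ultimately show ?thesis using True F1(2)[of z]
            by (auto simp: f_def intro!: ennreal_leI simp flip: ennreal_mult)
        qed simp
      qed
      also have "\<dots> = ennreal ((\<rho> powr \<epsilon>) ^ m) * (\<integral>\<^sup>+z\<in>ball 0 (\<rho> / \<rho> ^ (m + 2)). ennreal (F z) \<partial>lborel)"
        by (rule nn_integral_cmult) (auto intro!: borel_measurable_times_ennreal borel_measurable_indicator)
      also have "\<dots> \<le> ennreal ((\<rho> powr \<epsilon>) ^ m) * ennreal (A ^ (m + 2) * (V * \<rho> ^ DIM('a)))"
        using fourier_power_ball_bound[OF N1 N2 q(2) x, of "m + 2"]
        unfolding F_def \<nu>_def A_def V_def by (intro mult_left_mono) auto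
      also have "\<dots> = ennreal (A\<^sup>2 * (V * \<rho> ^ DIM('a)) * (A * \<rho> powr \<epsilon>) ^ m)"
        by (subst ennreal_mult'[symmetric]) (simp_all add: power_add power_mult_distrib power2_eq_square mult_ac)
      finally show "(\<integral>\<^sup>+z\<in>P m. f z \<partial>lborel) \<le> ennreal (A\<^sup>2 * (V * \<rho> ^ DIM('a)) * (A * \<rho> powr \<epsilon>) ^ m)" .
    qed auto
    also have "\<dots> < \<infinity>"
    proof -
      have "norm (A * \<rho> powr \<epsilon>) < 1" using A\<rho> A by simp
      then have "summable (\<lambda>m. A\<^sup>2 * (V * \<rho> ^ DIM('a)) * (A * \<rho> powr \<epsilon>) ^ m)"
        by (intro summable_mult summable_geometric)
      then show ?thesis using A V \<rho> ennreal_suminf_neq_top by (auto simp: less_top)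
    qed
    finally show ?thesis .
  qed
  have "fourier_energy ((DIM('a) - \<epsilon>) * \<theta>) \<theta> \<nu> = ennreal_powr (\<integral>\<^sup>+z. f z \<partial>lborel) \<theta>"
  proof -
    have "cmod (fourier_transform \<nu> z) powr (2 / \<theta>) = F z" for z
      using q powr_realpow'[of "cmod (fourier_transform \<nu> z)" "2 * q"] by (simp add: F_def \<theta>_def)
    then show ?thesis using q by (simp add: fourier_energy_def f_def \<theta>_def)
  qed
  moreover have "(\<integral>\<^sup>+z. f z \<partial>lborel) < \<infinity>"
  proof -
    have "(\<integral>\<^sup>+z. f z \<partial>lborel) \<le> (\<integral>\<^sup>+z. f z * indicator {z. norm z \<le> 1} z + f z * indicator {z. 1 \<le> norm z} z \<partial>lborel)"
      by (rule nn_integral_mono) (auto simp: indicator_def)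
    also have "\<dots> = (\<integral>\<^sup>+z\<in>{z. norm z \<le> 1}. f z \<partial>lborel) + (\<integral>\<^sup>+z\<in>{z. 1 \<le> norm z}. f z \<partial>lborel)"
      by (rule nn_integral_add) measurable
    also have "\<dots> < \<infinity>" using small large by simp
    finally show ?thesis .
  qed
  ultimately have "fourier_energy ((DIM('a) - \<epsilon>) * \<theta>) \<theta> \<nu> < \<infinity>"
    by (auto simp: ennreal_powr_def less_top)
  then show ?thesis using \<theta> \<nu> by blast
qed

section \<open>Linear substitutions and slabs\<close>

lemma nn_integral_lborel_plus:
  fixes f :: "'a::euclidean_space \<Rightarrow> ennreal"
  assumes "f \<in> borel_measurable borel"
  shows "(\<integral>\<^sup>+x. f (a + x) \<partial>lborel) = (\<integral>\<^sup>+x. f x \<partial>lborel)"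
proof -
  have "(\<integral>\<^sup>+x. f x \<partial>lborel) = (\<integral>\<^sup>+x. f x \<partial>distr lborel borel ((+) a))"
    by (simp add: lborel_distr_plus)
  also have "\<dots> = (\<integral>\<^sup>+x. f (a + x) \<partial>lborel)"
    by (rule nn_integral_distr) (use assms in auto)
  finally show ?thesis by simp
qed

lemma nn_integral_lborel_minus:
  fixes f :: "'a::euclidean_space \<Rightarrow> ennreal"
  assumes "f \<in> borel_measurable borel"
  shows "(\<integral>\<^sup>+x. f (x - a) \<partial>lborel) = (\<integral>\<^sup>+x. f x \<partial>lborel)"
  using nn_integral_lborel_plus[OF assms, of "- a"] by simp

lemma nn_integral_lborel_uminus:
  fixes f :: "'a::euclidean_space \<Rightarrow> ennreal"
  assumes "f \<in> borel_measurable borel"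
  shows "(\<integral>\<^sup>+x. f (- x) \<partial>lborel) = (\<integral>\<^sup>+x. f x \<partial>lborel)"
proof -
  have eq: "(\<Sum>j\<in>Basis. (- 1 * (x \<bullet> j)) *\<^sub>R j) = - x" for x :: 'a
    using euclidean_representation[of "- x"] by simp
  have "lborel = density (distr lborel borel (\<lambda>x::'a. - x)) (\<lambda>_. 1)"
    using lborel_affine_euclidean[of "\<lambda>_. - 1" "0::'a"] eq by simp
  then have "lborel = distr lborel borel (\<lambda>x::'a. - x)" by (simp add: density_1)
  then have "(\<integral>\<^sup>+x. f x \<partial>lborel) = (\<integral>\<^sup>+x. f x \<partial>distr lborel borel (\<lambda>x::'a. - x))" by (rule arg_cong)
  also have "\<dots> = (\<integral>\<^sup>+x. f (- x) \<partial>lborel)"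
    by (rule nn_integral_distr) (use assms in auto)
  finally show ?thesis by simp
qed

text \<open>Uniqueness of translation-invariant measures: Fubini replaces the determinant of \<open>T\<close>
  by the value on a test function \<open>g\<close>.\<close>

lemma nn_integral_linear_substitution:
  fixes f g :: "'a::euclidean_space \<Rightarrow> ennreal"
  assumes T: "linear T" "linear T'" and inv: "\<And>x. T (T' x) = x"
    and f [measurable]: "f \<in> borel_measurable borel" and g [measurable]: "g \<in> borel_measurable borel"
  shows "(\<integral>\<^sup>+x. f (T x) \<partial>lborel) * (\<integral>\<^sup>+x. g x \<partial>lborel) = (\<integral>\<^sup>+x. g (T x) \<partial>lborel) * (\<integral>\<^sup>+x. f x \<partial>lborel)"
proof -
  have [measurable]: "T \<in> borel_measurable borel"
    using T(1) by (intro borel_measurable_continuous_onI linear_continuous_on linear_conv_bounded_linear[THEN iffD1])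
  have "(\<integral>\<^sup>+x. f (T x) \<partial>lborel) * (\<integral>\<^sup>+y. g y \<partial>lborel) = (\<integral>\<^sup>+x. (\<integral>\<^sup>+y. f (T x) * g y \<partial>lborel) \<partial>lborel)"
    by (simp add: nn_integral_cmult nn_integral_multc)
  also have "\<dots> = (\<integral>\<^sup>+x. (\<integral>\<^sup>+y. f (T x) * g (- T x + y) \<partial>lborel) \<partial>lborel)"
    by (rule nn_integral_cong) (simp add: nn_integral_cmult nn_integral_lborel_minus)
  also have "\<dots> = (\<integral>\<^sup>+y. (\<integral>\<^sup>+x. f (T x) * g (- T x + y) \<partial>lborel) \<partial>lborel)"
    by (rule lborel_pair.Fubini'[symmetric]) measurable
  also have "\<dots> = (\<integral>\<^sup>+y. (\<integral>\<^sup>+x. f (y - T x) * g (T x) \<partial>lborel) \<partial>lborel)"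
  proof (rule nn_integral_cong)
    fix y :: 'a
    have "(\<integral>\<^sup>+x. f (T x) * g (- T x + y) \<partial>lborel) = (\<integral>\<^sup>+x. f (T (T' y + x)) * g (- T (T' y + x) + y) \<partial>lborel)"
      by (rule nn_integral_lborel_plus[symmetric]) measurable
    also have "\<dots> = (\<integral>\<^sup>+x. f (T (T' y + - x)) * g (- T (T' y + - x) + y) \<partial>lborel)"
      by (rule nn_integral_lborel_uminus[symmetric]) measurable
    also have "\<dots> = (\<integral>\<^sup>+x. f (y - T x) * g (T x) \<partial>lborel)"
      using T by (simp add: linear_diff inv)
    finally show "(\<integral>\<^sup>+x. f (T x) * g (- T x + y) \<partial>lborel) = (\<integral>\<^sup>+x. f (y - T x) * g (T x) \<partial>lborel)" .
  qed
  also have "\<dots> = (\<integral>\<^sup>+x. (\<integral>\<^sup>+y. f (y - T x) * g (T x) \<partial>lborel) \<partial>lborel)"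
    by (rule lborel_pair.Fubini') measurable
  also have "\<dots> = (\<integral>\<^sup>+x. g (T x) * (\<integral>\<^sup>+y. f (- T x + y) \<partial>lborel) \<partial>lborel)"
    by (rule nn_integral_cong) (simp add: nn_integral_cmult mult.commute)
  also have "\<dots> = (\<integral>\<^sup>+x. g (T x) \<partial>lborel) * (\<integral>\<^sup>+x. f x \<partial>lborel)"
    by (simp add: nn_integral_multc nn_integral_lborel_minus)
  finally show ?thesis .
qed

section \<open>Projections, slabs and anisotropic dilations\<close>

lemma orth_proj_facts:
  fixes V :: "'a::euclidean_space set"
  assumes V: "subspace V"
  shows orth_proj_inner: "orth_proj V x \<bullet> y = x \<bullet> orth_proj V y"
    and orth_proj_perp: "v \<in> V \<Longrightarrow> (x - orth_proj V x) \<bullet> v = 0"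
    and orth_proj_id: "v \<in> V \<Longrightarrow> orth_proj V v = v"
    and orth_proj_idem: "orth_proj V (orth_proj V x) = orth_proj V x"
    and norm_orth_proj_Pythagoras: "(norm x)\<^sup>2 = (norm (orth_proj V x))\<^sup>2 + (norm (x - orth_proj V x))\<^sup>2"
    and norm_orth_proj_le: "norm (orth_proj V x) \<le> norm x"
    and norm_orth_proj_compl_le: "norm (x - orth_proj V x) \<le> norm x"
proof -
  show perp: "(x - orth_proj V x) \<bullet> v = 0" if "v \<in> V" for x v
    using orth_proj(2)[OF V that] by (simp add: orthogonal_def)
  show id: "orth_proj V v = v" if "v \<in> V" for v
    by (rule orth_proj_unique[OF V that]) (simp add: orthogonal_def)
  show "orth_proj V (orth_proj V x) = orth_proj V x" using id orth_proj(1)[OF V] by blast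
  show "orth_proj V x \<bullet> y = x \<bullet> orth_proj V y"
    using perp[OF orth_proj(1)[OF V], of x y] perp[OF orth_proj(1)[OF V], of y x]
    by (simp add: inner_diff_left inner_diff_right inner_commute)
  show pyth: "(norm x)\<^sup>2 = (norm (orth_proj V x))\<^sup>2 + (norm (x - orth_proj V x))\<^sup>2"
    using perp[OF orth_proj(1)[OF V], of x x]
    by (simp add: power2_norm_eq_inner inner_diff_left inner_diff_right inner_commute)
  show "norm (orth_proj V x) \<le> norm x" by (rule power2_le_imp_le) (simp_all add: pyth)
  show "norm (x - orth_proj V x) \<le> norm x" by (rule power2_le_imp_le) (simp_all add: pyth)
qed

lemma orth_proj_measurable [measurable]: "subspace V \<Longrightarrow> orth_proj V \<in> borel_measurable borel"
  by (intro borel_measurable_continuous_onI linear_continuous_on linear_conv_bounded_linear[THEN iffD1] linear_orth_proj)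

lemma obtain_orthonormal_basis:
  fixes V :: "'a::euclidean_space set"
  assumes "subspace V"
  obtains B where "finite B" "B \<subseteq> V" "\<forall>b\<in>B. \<forall>c\<in>B. b \<bullet> c = (if b = c then 1 else 0)"
    "card B = dim V" "span B = V"
proof -
  obtain B where B: "B \<subseteq> V" "pairwise orthogonal B" "\<And>x. x \<in> B \<Longrightarrow> norm x = 1"
    "independent B" "card B = dim V" "span B = V"
    using orthonormal_basis_subspace[OF assms] by metis
  show thesis
  proof (rule that)
    show "finite B" using B(4) by (rule independent_imp_finite)
    show "\<forall>b\<in>B. \<forall>c\<in>B. b \<bullet> c = (if b = c then 1 else 0)"
      using B(2,3) by (auto simp: pairwise_def orthogonal_def norm_eq_1)
  qed (use B in auto)
qed

text \<open>A packing argument in place of coordinates adapted to V. In each direction of an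
  orthonormal basis of V the slab has width at most 2 t, so its translates by multiples of 3 t are
  disjoint. About t ^ - dim V of them fit into a ball of radius r + 3 d.\<close>

lemma emeasure_slab_le:
  fixes V :: "'a::euclidean_space set"
  assumes V: "subspace V" and r: "0 \<le> r" and t: "0 < t" "t \<le> 1"
  shows "emeasure lborel {z. norm z \<le> r \<and> norm (orth_proj V z) \<le> t}
    \<le> ennreal (2 ^ dim V * (unit_ball_vol DIM('a) * (r + 3 * DIM('a)) ^ DIM('a)) * t ^ dim V)"
proof -
  let ?k = "dim V"
  obtain B where B: "finite B" "B \<subseteq> V" and ON: "\<forall>b\<in>B. \<forall>c\<in>B. b \<bullet> c = (if b = c then 1 else 0)"
    and "card B = ?k" "span B = V"
    using obtain_orthonormal_basis[OF V] .
  have B: "finite B" "B \<subseteq> V" "\<And>b c. b \<in> B \<Longrightarrow> c \<in> B \<Longrightarrow> b \<bullet> c = (if b = c then 1 else 0)" "card B = ?k"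
    using ON by (auto intro: \<open>finite B\<close> \<open>card B = ?k\<close> simp: subsetD[OF \<open>B \<subseteq> V\<close>])
  define A where "A = {z. norm z \<le> r \<and> norm (orth_proj V z) \<le> t}"
  have A: "A \<in> sets borel" unfolding A_def using orth_proj_measurable[OF V] by measurable
  define n where "n = nat \<lfloor>1 / t\<rfloor>"
  have n: "1 \<le> n" "real n \<le> 1 / t" "1 / t < real n + 1" using t by (auto simp: n_def le_nat_iff le_floor_iff)
  \<comment> \<open>Rounding 1 / t down loses at most a factor 2; this is the source of 2 ^ dim V in
    the bound.\<close>
  then have n2: "1 \<le> 2 * t * n" 
  proof -
    have "t * 1 \<le> t * real n" using n(1) t by (intro mult_left_mono) auto
    moreover have "1 < t * real n + t" using n(3) t by (simp add: field_simps)
    ultimately show ?thesis by linarith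
  qed
  define s where "s = (\<lambda>c. \<Sum>b\<in>B. (3 * t * real (c b)) *\<^sub>R b)"
  define I where "I = (B \<rightarrow>\<^sub>E {..<n})"
  have finI: "finite I" unfolding I_def using B(1) by (intro finite_PiE) auto
  have cardI: "card I = n ^ ?k" using B by (simp add: I_def card_PiE)
  have sb: "s c \<bullet> b = 3 * t * real (c b)" if "b \<in> B" for c b
  proof -
    have "s c \<bullet> b = (\<Sum>b'\<in>B. 3 * t * real (c b') * (b' \<bullet> b))" by (simp add: s_def inner_sum_left)
    also have "\<dots> = (\<Sum>b'\<in>B. if b' = b then 3 * t * real (c b') else 0)"
      using that by (intro sum.cong) (auto simp: B(3))
    finally show ?thesis using that B(1) by simp
  qed
  have disj: "c = c'" if c: "c \<in> I" "c' \<in> I" and z: "z - s c \<in> A" "z - s c' \<in> A" for c c' z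
  proof -
    have "c b = c' b" if b: "b \<in> B" for b
    proof -
      have nb: "norm b = 1" using B(3)[OF b b] by (simp add: norm_eq_1)
      have bV: "b \<in> V" using b B(2) by blast
      have le: "\<bar>(z - s d) \<bullet> b\<bar> \<le> t" if "z - s d \<in> A" for d
      proof -
        have "\<bar>(z - s d) \<bullet> b\<bar> = \<bar>orth_proj V (z - s d) \<bullet> b\<bar>"
          by (simp add: orth_proj_inner[OF V] orth_proj_id[OF V bV])
        also have "\<dots> \<le> norm (orth_proj V (z - s d)) * norm b" by (rule Cauchy_Schwarz_ineq2)
        finally show ?thesis using that nb by (simp add: A_def)
      qed
      have "\<bar>s c \<bullet> b - s c' \<bullet> b\<bar> \<le> 2 * t" using le[OF z(1)] le[OF z(2)] by (simp add: inner_diff_left)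
      then have "3 * t * \<bar>real (c b) - real (c' b)\<bar> \<le> 2 * t"
        using t by (simp add: sb[OF b] abs_mult flip: right_diff_distrib)
      then have "3 * \<bar>real (c b) - real (c' b)\<bar> \<le> 2"
        using t mult_right_le_imp_le[of "3 * \<bar>real (c b) - real (c' b)\<bar>" t 2] by (simp add: mult_ac)
      then have "\<bar>real_of_int (int (c b) - int (c' b))\<bar> < 1" by simp
      then show "c b = c' b" by linarith
    qed
    then show ?thesis using c unfolding I_def by (intro PiE_ext)
  qed
  have s_norm: "norm (s c) \<le> 3 * DIM('a)" if "c \<in> I" for c
  proof -
    have "norm (s c) \<le> (\<Sum>b\<in>B. 3)"
      unfolding s_def
    proof (rule order_trans[OF norm_sum sum_mono])
      fix b assume b: "b \<in> B"
      have "c b < n" using that b by (auto simp: I_def)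
      then have "t * real (c b) \<le> t * (1 / t)" using n(2) t by (intro mult_left_mono) auto
      then show "norm ((3 * t * real (c b)) *\<^sub>R b) \<le> 3"
        using B(3)[OF b b] t norm_eq_1[THEN iffD2, of b] by simp
    qed
    also have "\<dots> \<le> 3 * DIM('a)" using B(4) dim_subset_UNIV[of V] by simp
    finally show ?thesis .
  qed
  let ?C = "cball (0::'a) (r + 3 * DIM('a))"
  have "(\<Sum>c\<in>I. emeasure lborel A) = (\<Sum>c\<in>I. \<integral>\<^sup>+z. indicator A (- s c + z) \<partial>lborel)"
    using A by (intro sum.cong refl) (simp add: nn_integral_lborel_minus)
  also have "\<dots> = (\<integral>\<^sup>+z. (\<Sum>c\<in>I. indicator A (- s c + z)) \<partial>lborel)"
    using A by (subst nn_integral_sum) auto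
  also have "\<dots> \<le> (\<integral>\<^sup>+z. indicator ?C z \<partial>lborel)"
  proof (rule nn_integral_mono)
    fix z
    show "(\<Sum>c\<in>I. indicator A (- s c + z)) \<le> (indicator ?C z :: ennreal)"
    proof (cases "\<exists>c\<in>I. z - s c \<in> A")
      case True
      then obtain c where c: "c \<in> I" "z - s c \<in> A" by blast
      have "(\<Sum>c\<in>I. indicator A (- s c + z) :: ennreal) = (\<Sum>c'\<in>I. if c' = c then 1 else 0)"
        using disj c by (intro sum.cong refl) (auto simp: indicator_def)
      also have "\<dots> = 1" using finI c by simp
      also have "z \<in> ?C"
        using c(2) s_norm[OF c(1)] norm_triangle_sub[of z "s c"] by (auto simp: A_def)
      ultimately show ?thesis by simp
    next
      case False
      then have "(\<Sum>c\<in>I. indicator A (- s c + z) :: ennreal) = 0" by (intro sum.neutral) auto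
      then show ?thesis by simp
    qed
  qed
  also have "\<dots> = ennreal (unit_ball_vol DIM('a) * (r + 3 * DIM('a)) ^ DIM('a))"
    using r by (simp add: emeasure_cball)
  finally have main: "of_nat (n ^ ?k) * emeasure lborel A \<le> ennreal (unit_ball_vol DIM('a) * (r + 3 * DIM('a)) ^ DIM('a))"
    by (simp add: cardI)
  have "emeasure lborel A \<le> ennreal ((2 * t * n) ^ ?k) * emeasure lborel A"
    using n2 mult_right_mono[of 1 "ennreal ((2 * t * n) ^ ?k)" "emeasure lborel A"] by (simp add: one_le_power)
  also have "\<dots> = ennreal ((2 * t) ^ ?k) * (of_nat (n ^ ?k) * emeasure lborel A)"
    using t by (simp add: power_mult_distrib ennreal_mult ennreal_of_nat_eq_real_of_nat mult.assoc)
  also have "\<dots> \<le> ennreal ((2 * t) ^ ?k) * ennreal (unit_ball_vol DIM('a) * (r + 3 * DIM('a)) ^ DIM('a))"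
    by (intro mult_left_mono main) auto
  also have "\<dots> = ennreal (2 ^ ?k * (unit_ball_vol DIM('a) * (r + 3 * DIM('a)) ^ DIM('a)) * t ^ ?k)"
    using t by (subst ennreal_mult'[symmetric]) (auto simp: power_mult_distrib mult_ac)
  finally show ?thesis unfolding A_def .
qed

text \<open>With \<alpha> = 1 / (32 \<delta>) and \<beta> = 1 / (16 D) it has two uses. In space it
  sends a difference of diameter at most D whose projection to V is at most 2 \<delta> to a vector
  of norm at most 1/8; in frequency it sends the ball of radius 2 into the unit neighbourhood of V
  up to |z| = 1 / \<delta>. Self-adjointness connects the two.\<close>

definition stretch :: "'a::euclidean_space set \<Rightarrow> real \<Rightarrow> real \<Rightarrow> 'a \<Rightarrow> 'a" where
  "stretch V \<alpha> \<beta> x = \<alpha> *\<^sub>R orth_proj V x + \<beta> *\<^sub>R (x - orth_proj V x)"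

lemma orth_proj_diff_eq_0: "subspace V \<Longrightarrow> orth_proj V (x - orth_proj V x) = 0"
  by (simp add: linear_diff linear_orth_proj orth_proj_idem)

lemma
  fixes V :: "'a::euclidean_space set"
  assumes V: "subspace V"
  shows linear_stretch: "linear (stretch V \<alpha> \<beta>)"
    and orth_proj_stretch: "orth_proj V (stretch V \<alpha> \<beta> x) = \<alpha> *\<^sub>R orth_proj V x"
    and stretch_compl: "stretch V \<alpha> \<beta> x - orth_proj V (stretch V \<alpha> \<beta> x) = \<beta> *\<^sub>R (x - orth_proj V x)"
    and stretch_inner: "stretch V \<alpha> \<beta> x \<bullet> y = x \<bullet> stretch V \<alpha> \<beta> y"
proof -
  note lin = linear_orth_proj[OF V]
  show "linear (stretch V \<alpha> \<beta>)"
    unfolding stretch_def[abs_def]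
    by (intro linear_compose_add linear_compose_scale_right linear_compose_sub lin linear_id[unfolded id_def])
  show 1: "orth_proj V (stretch V \<alpha> \<beta> x) = \<alpha> *\<^sub>R orth_proj V x"
    unfolding stretch_def by (simp add: linear_add[OF lin] linear_cmul[OF lin] orth_proj_idem[OF V] orth_proj_diff_eq_0[OF V])
  show "stretch V \<alpha> \<beta> x - orth_proj V (stretch V \<alpha> \<beta> x) = \<beta> *\<^sub>R (x - orth_proj V x)"
    unfolding 1 by (simp add: stretch_def)
  show "stretch V \<alpha> \<beta> x \<bullet> y = x \<bullet> stretch V \<alpha> \<beta> y"
    unfolding stretch_def using orth_proj_inner[OF V, of x y]
    by (simp add: inner_add_left inner_add_right inner_diff_left inner_diff_right)
qed

lemma stretch_inverse:
  assumes "subspace V" "\<alpha> \<noteq> 0" "\<beta> \<noteq> 0"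
  shows "stretch V \<alpha> \<beta> (stretch V (1 / \<alpha>) (1 / \<beta>) x) = x"
  using assms(2,3) unfolding stretch_def[of V \<alpha> \<beta>] stretch_compl[OF assms(1)]
  unfolding orth_proj_stretch[OF assms(1)] by simp

lemma stretch_measurable [measurable]: "subspace V \<Longrightarrow> stretch V \<alpha> \<beta> \<in> borel_measurable borel"
  by (intro borel_measurable_continuous_onI linear_continuous_on linear_conv_bounded_linear[THEN iffD1] linear_stretch)

text \<open>The Jacobian is read off from the preimage of the unit ball, which is contained in a
  bounded slab where the projection to V is at most 32 \<delta> and hence has measure O(\<delta> ^
  k). The limit 1/32 keeps 32 \<delta> in the range of \<open>emeasure_slab_le\<close>. The constant
  is the same for all V.\<close>

lemma stretch_integral_le:
  fixes D :: real
  assumes D: "1 \<le> D"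
  shows "\<exists>C\<ge>0. \<forall>V\<in>grassmannian k. \<forall>\<delta>. 0 < \<delta> \<longrightarrow> \<delta> \<le> 1/32 \<longrightarrow> (\<forall>f\<in>borel_measurable borel.
     (\<integral>\<^sup>+\<zeta>\<in>ball (0::'a::euclidean_space) 2. f (stretch V (1 / (32 * \<delta>)) (1 / (16 * D)) \<zeta>) \<partial>lborel)
       \<le> ennreal (C * \<delta> ^ k) * (\<integral>\<^sup>+z\<in>{z. norm z \<le> 1 / \<delta> \<and> norm (z - orth_proj V z) \<le> 1}. f z \<partial>lborel))"
proof -
  define vB where "vB = unit_ball_vol DIM('a)"
  have vB: "0 < vB" by (simp add: vB_def)
  define r where "r = 1 + 16 * D"
  have r: "0 \<le> r" using D by (simp add: r_def)
  define C0 where "C0 = 2 ^ k * (vB * (r + 3 * DIM('a)) ^ DIM('a))"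
  have C0: "0 \<le> C0" using r vB by (simp add: C0_def)
  define C where "C = C0 * 32 ^ k / vB"
  have "(\<integral>\<^sup>+\<zeta>\<in>ball (0::'a) 2. f (stretch V (1 / (32 * \<delta>)) (1 / (16 * D)) \<zeta>) \<partial>lborel)
       \<le> ennreal (C * \<delta> ^ k) * (\<integral>\<^sup>+z\<in>{z. norm z \<le> 1 / \<delta> \<and> norm (z - orth_proj V z) \<le> 1}. f z \<partial>lborel)"
    if V': "V \<in> grassmannian k" and \<delta>: "0 < \<delta>" "\<delta> \<le> 1/32" and f: "f \<in> borel_measurable borel" for V \<delta> and f :: "'a \<Rightarrow> ennreal"
  proof -
    have V: "subspace V" and dimV: "dim V = k" using V' by (auto simp: grassmannian_def)
    define T where "T = stretch V (1 / (32 * \<delta>)) (1 / (16 * D))"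
    define T' where "T' = stretch V (32 * \<delta>) (16 * D)"
    define R where "R = {z. norm z \<le> 1 / \<delta> \<and> norm (z - orth_proj V z) \<le> 1}"
    note [measurable] = orth_proj_measurable[OF V] f
    have [measurable]: "R \<in> sets borel" unfolding R_def by measurable
    have inv: "T (T' x) = x" for x
      using stretch_inverse[OF V, of "1 / (32 * \<delta>)" "1 / (16 * D)" x] \<delta> D by (simp add: T_def T'_def)
    have P: "norm (orth_proj V (T z)) = norm (orth_proj V z) / (32 * \<delta>)"
      and Q: "norm (T z - orth_proj V (T z)) = norm (z - orth_proj V z) / (16 * D)" for z
      using \<delta> D unfolding T_def stretch_compl[OF V] unfolding orth_proj_stretch[OF V] by simp_all
    define F where "F = (\<lambda>z. f z * indicator R z)"
    have F[measurable]: "F \<in> borel_measurable borel" unfolding F_def by measurable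
    have FT: "(\<integral>\<^sup>+\<zeta>\<in>ball 0 2. f (T \<zeta>) \<partial>lborel) \<le> (\<integral>\<^sup>+\<zeta>. F (T \<zeta>) \<partial>lborel)"
    proof (rule nn_integral_mono)
      fix \<zeta> :: 'a
      show "f (T \<zeta>) * indicator (ball 0 2) \<zeta> \<le> F (T \<zeta>)"
      proof (cases "\<zeta> \<in> ball 0 2")
        case True
        then have z: "norm \<zeta> \<le> 2" by simp
        have 1: "norm (orth_proj V (T \<zeta>)) \<le> 1 / (16 * \<delta>)"
          unfolding P using norm_orth_proj_le[OF V, of \<zeta>] z \<delta> by (simp add: field_simps)
        have 2: "norm (T \<zeta> - orth_proj V (T \<zeta>)) \<le> 1/8"
          unfolding Q using norm_orth_proj_compl_le[OF V, of \<zeta>] z D by (simp add: field_simps)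
        have "norm (T \<zeta>) \<le> 1 / (16 * \<delta>) + 1/8"
          using norm_triangle_sub[of "T \<zeta>" "orth_proj V (T \<zeta>)"] 1 2 by linarith
        also have "\<dots> \<le> 1 / \<delta>" using \<delta> by (simp add: field_simps)
        finally have "T \<zeta> \<in> R" using 2 by (simp add: R_def)
        then show ?thesis using True by (simp add: F_def)
      qed simp
    qed
    have sub: "(\<integral>\<^sup>+\<zeta>. F (T \<zeta>) \<partial>lborel) * ennreal vB \<le> ennreal (C0 * (32 * \<delta>) ^ k) * (\<integral>\<^sup>+z. F z \<partial>lborel)"
    proof -
      have "(\<integral>\<^sup>+\<zeta>. F (T \<zeta>) \<partial>lborel) * (\<integral>\<^sup>+z. indicator (ball (0::'a) 1) z \<partial>lborel)
          = (\<integral>\<^sup>+\<zeta>. indicator (ball 0 1) (T \<zeta>) \<partial>lborel) * (\<integral>\<^sup>+z. F z \<partial>lborel)"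
        using linear_stretch[OF V] inv F borel_measurable_indicator[of "ball (0::'a) 1" borel]
        by (intro nn_integral_linear_substitution[of T T' F "indicator (ball 0 1)"]) (auto simp: T_def T'_def)
      also have "(\<integral>\<^sup>+z. indicator (ball (0::'a) 1) z \<partial>lborel) = ennreal vB"
        by (simp add: emeasure_ball vB_def)
      also have "(\<integral>\<^sup>+\<zeta>. indicator (ball 0 1) (T \<zeta>) \<partial>lborel)
          \<le> (\<integral>\<^sup>+\<zeta>. indicator {z. norm z \<le> r \<and> norm (orth_proj V z) \<le> 32 * \<delta>} \<zeta> \<partial>lborel)"
      proof (rule nn_integral_mono)
        fix \<zeta> :: 'a
        show "(indicator (ball 0 1) (T \<zeta>) :: ennreal) \<le> indicator {z. norm z \<le> r \<and> norm (orth_proj V z) \<le> 32 * \<delta>} \<zeta>"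
        proof (cases "T \<zeta> \<in> ball 0 1")
          case True
          then have z: "norm (T \<zeta>) \<le> 1" by simp
          have 1: "norm (orth_proj V \<zeta>) \<le> 32 * \<delta>"
            using order_trans[OF norm_orth_proj_le[OF V] z] \<delta> unfolding P by (simp add: field_simps)
          have 2: "norm (\<zeta> - orth_proj V \<zeta>) \<le> 16 * D"
            using order_trans[OF norm_orth_proj_compl_le[OF V] z] D unfolding Q by (simp add: field_simps)
          have "norm \<zeta> \<le> r"
            using norm_triangle_sub[of \<zeta> "orth_proj V \<zeta>"] 1 2 \<delta> by (simp add: r_def)
          then show ?thesis using 1 by (simp add: indicator_def)
        qed simp
      qed
      also have "\<dots> = emeasure lborel {z. norm z \<le> r \<and> norm (orth_proj V z) \<le> 32 * \<delta>}"
        by (rule nn_integral_indicator) measurable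
      also have "\<dots> \<le> ennreal (C0 * (32 * \<delta>) ^ k)"
        using emeasure_slab_le[OF V r, of "32 * \<delta>"] \<delta> by (simp add: C0_def vB_def dimV)
      finally show ?thesis by (simp add: mult_right_mono)
    qed
    have "(\<integral>\<^sup>+\<zeta>. F (T \<zeta>) \<partial>lborel) = ennreal (1 / vB) * ((\<integral>\<^sup>+\<zeta>. F (T \<zeta>) \<partial>lborel) * ennreal vB)"
    proof -
      have "ennreal (1 / vB) * ennreal vB = 1" using vB by (simp flip: ennreal_mult)
      then have "(\<integral>\<^sup>+\<zeta>. F (T \<zeta>) \<partial>lborel) = (ennreal (1 / vB) * ennreal vB) * (\<integral>\<^sup>+\<zeta>. F (T \<zeta>) \<partial>lborel)" by simp
      then show ?thesis by (simp only: mult_ac)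
    qed
    also have "\<dots> \<le> ennreal (1 / vB) * (ennreal (C0 * (32 * \<delta>) ^ k) * (\<integral>\<^sup>+z. F z \<partial>lborel))"
      by (intro mult_left_mono sub) auto
    also have "\<dots> = ennreal (C * \<delta> ^ k) * (\<integral>\<^sup>+z. F z \<partial>lborel)"
      unfolding mult.assoc[symmetric] using vB C0 \<delta>
      by (subst ennreal_mult[symmetric]) (auto simp: C_def power_mult_distrib mult_ac)
    finally have "(\<integral>\<^sup>+\<zeta>. F (T \<zeta>) \<partial>lborel) \<le> ennreal (C * \<delta> ^ k) * (\<integral>\<^sup>+z. F z \<partial>lborel)" .
    from order_trans[OF FT this] show ?thesis unfolding F_def R_def T_def .
  qed
  moreover have "0 \<le> C" using C0 vB by (simp add: C_def)
  ultimately show ?thesis by blast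
qed

text \<open>Points of a bounded ball with |P_V \<zeta>| \<le> t have measure O(t ^ k), hence O(t),
  uniformly in V; a < 1 then gives integrability. Where |P_V \<zeta>| > 1 the integrand is below
  1.\<close>

lemma stretch_powr_integral_le:
  assumes a: "0 < a" "a < 1" and k: "1 \<le> k"
  shows "\<exists>C\<ge>0. \<forall>V\<in>grassmannian k.
     (\<integral>\<^sup>+\<zeta>\<in>ball (0::'a::euclidean_space) 2. ennreal (norm (orth_proj V \<zeta>) powr - a) \<partial>lborel) \<le> ennreal C"
proof -
  define vB where "vB = unit_ball_vol DIM('a)"
  define C0 where "C0 = 2 ^ k * (vB * (2 + 3 * DIM('a)) ^ DIM('a))"
  define C1 where "C1 = C0 * (2 powr a / (1 - 2 powr (a - 1)))"
  have C0: "0 \<le> C0" by (simp add: C0_def vB_def)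
  have "2 powr (a - 1) < (1::real)" using a by (simp add: powr_less_one)
  then have C1: "0 \<le> C1" using C0 by (simp add: C1_def)
  have "(\<integral>\<^sup>+\<zeta>\<in>ball (0::'a) 2. ennreal (norm (orth_proj V \<zeta>) powr - a) \<partial>lborel) \<le> ennreal (C1 + vB * 2 ^ DIM('a))"
    if V': "V \<in> grassmannian k" for V :: "'a set"
  proof -
    have V: "subspace V" and dimV: "dim V = k" using V' by (auto simp: grassmannian_def)
    note [measurable] = orth_proj_measurable[OF V]
    have 1: "(\<integral>\<^sup>+\<zeta>\<in>{z \<in> ball 0 2. norm (orth_proj V z) \<le> 1}. ennreal (norm (orth_proj V \<zeta>) powr - a) \<partial>lborel) \<le> ennreal C1"
      unfolding C1_def
    proof (rule nn_integral_powr_neg_le)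
      fix t :: real assume t: "0 < t" "t \<le> 1"
      have "emeasure lborel {z \<in> ball 0 2. norm (orth_proj V z) \<le> t} \<le> emeasure lborel {z. norm z \<le> 2 \<and> norm (orth_proj V z) \<le> t}"
        by (intro emeasure_mono) auto
      also have "\<dots> \<le> ennreal (C0 * t ^ k)"
        using emeasure_slab_le[OF V, of 2 t] t by (simp add: C0_def vB_def dimV)
      also have "\<dots> \<le> ennreal (C0 * t)"
        using power_decreasing[OF k, of t] t C0 by (intro ennreal_leI mult_left_mono) auto
      finally show "emeasure lborel {z \<in> ball 0 2. norm (orth_proj V z) \<le> t} \<le> ennreal (C0 * t)" .
    qed (use a C0 in auto)
    have "(\<integral>\<^sup>+\<zeta>\<in>ball (0::'a) 2. ennreal (norm (orth_proj V \<zeta>) powr - a) \<partial>lborel)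
      \<le> (\<integral>\<^sup>+\<zeta>. ennreal (norm (orth_proj V \<zeta>) powr - a) * indicator {z \<in> ball 0 2. norm (orth_proj V z) \<le> 1} \<zeta> + indicator (ball 0 2) \<zeta> \<partial>lborel)"
    proof (rule nn_integral_mono)
      fix \<zeta> :: 'a
      have "norm (orth_proj V \<zeta>) powr - a \<le> 1" if "1 < norm (orth_proj V \<zeta>)"
        using powr_mono2'[of "- a" 1 "norm (orth_proj V \<zeta>)"] that a by simp
      then show "ennreal (norm (orth_proj V \<zeta>) powr - a) * indicator (ball 0 2) \<zeta>
        \<le> ennreal (norm (orth_proj V \<zeta>) powr - a) * indicator {z \<in> ball 0 2. norm (orth_proj V z) \<le> 1} \<zeta> + indicator (ball 0 2) \<zeta>"
        by (cases "1 < norm (orth_proj V \<zeta>)") (auto simp: indicator_def ennreal_le_1)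
    qed
    also have "\<dots> = (\<integral>\<^sup>+\<zeta>\<in>{z \<in> ball 0 2. norm (orth_proj V z) \<le> 1}. ennreal (norm (orth_proj V \<zeta>) powr - a) \<partial>lborel)
        + (\<integral>\<^sup>+\<zeta>. indicator (ball (0::'a) 2) \<zeta> \<partial>lborel)"
    proof (rule nn_integral_add)
      have "{z \<in> ball 0 2. norm (orth_proj V z) \<le> 1} \<in> sets borel" by measurable
      then show "(\<lambda>\<zeta>. ennreal (norm (orth_proj V \<zeta>) powr - a) * indicator {z \<in> ball 0 2. norm (orth_proj V z) \<le> 1} \<zeta>) \<in> borel_measurable lborel"
        by measurable
    qed (auto intro!: borel_measurable_indicator)
    also have "\<dots> \<le> ennreal C1 + ennreal (vB * 2 ^ DIM('a))"
      by (intro add_mono 1) (simp add: emeasure_ball vB_def)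
    also have "\<dots> = ennreal (C1 + vB * 2 ^ DIM('a))"
      using C1 by (intro ennreal_plus[symmetric]) (auto simp: vB_def)
    finally show ?thesis .
  qed
  moreover have "0 \<le> C1 + vB * 2 ^ DIM('a)" using C1 by (simp add: vB_def)
  ultimately show ?thesis by blast
qed

text \<open>Negative powers of |P_V z| serve as positive thresholds, which fails where P_V z = 0
  because \<open>powr\<close> returns 0 there. That set lies in a hyperplane.\<close>

lemma AE_orth_proj_nonzero:
  assumes "V \<in> grassmannian k" "1 \<le> k"
  shows "AE z in lborel. orth_proj V (z::'a::euclidean_space) \<noteq> 0"
proof -
  have V: "subspace V" "dim V = k" using assms(1) by (auto simp: grassmannian_def)
  obtain v where v: "v \<in> V" "v \<noteq> 0"
    using V assms(2) by (metis dim_eq_0 not_one_le_zero subsetI singletonI)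
  have "negligible {z. v \<bullet> z = 0}" using v by (intro negligible_hyperplane) auto
  moreover have "{z. v \<bullet> z = 0} \<in> sets borel" by (intro borel_closed closed_hyperplane)
  ultimately have "{z. v \<bullet> z = 0} \<in> null_sets lborel"
    by (simp add: negligible_iff_null_sets null_sets_completion_iff)
  then show ?thesis
  proof (rule AE_I', intro subsetI)
    fix z assume "z \<in> {z \<in> space lborel. \<not> orth_proj V z \<noteq> 0}"
    then show "z \<in> {z. v \<bullet> z = 0}"
      using orth_proj_inner[OF V(1), of z v] orth_proj_id[OF V(1) v(1)] by (simp add: inner_commute)
  qed
qed

section \<open>Fourier energy and close pairs\<close>

lemma integrable_bounded_finite:
  fixes f :: "'a \<Rightarrow> 'b::{banach, second_countable_topology}"
  assumes "finite_measure M" "f \<in> borel_measurable M" "\<And>x. norm (f x) \<le> B"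
  shows "integrable M f"
  by (rule finite_measure.integrable_const_bound[OF assms(1), where B=B]) (use assms in auto)

lemma pair_integral_square:
  fixes f :: "'a \<Rightarrow> real"
  assumes M: "finite_measure M" and f [measurable]: "f \<in> borel_measurable M" and B: "\<And>x. \<bar>f x\<bar> \<le> B"
  shows "(\<integral>p. f (fst p) * f (snd p) \<partial>(M \<Otimes>\<^sub>M M)) = (\<integral>x. f x \<partial>M)\<^sup>2"
    and "integrable (M \<Otimes>\<^sub>M M) (\<lambda>p. f (fst p) * f (snd p))"
proof -
  interpret finite_measure M by fact
  interpret P: pair_sigma_finite M M ..
  have fin: "finite_measure (M \<Otimes>\<^sub>M M)" by (rule finite_measure_pair_measure) fact+
  show int: "integrable (M \<Otimes>\<^sub>M M) (\<lambda>p. f (fst p) * f (snd p))"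
    by (rule integrable_bounded_finite[OF fin, where B="B * B"])
       (auto simp: abs_mult intro!: mult_mono B order_trans[OF abs_ge_zero B])
  have "(\<integral>p. f (fst p) * f (snd p) \<partial>(M \<Otimes>\<^sub>M M)) = (\<integral>x. (\<integral>y. f x * f y \<partial>M) \<partial>M)"
    using P.integral_fst'[OF int] by simp
  then show "(\<integral>p. f (fst p) * f (snd p) \<partial>(M \<Otimes>\<^sub>M M)) = (\<integral>x. f x \<partial>M)\<^sup>2"
    by (simp add: power2_eq_square)
qed

text \<open>The squared modulus of the Fourier integral as a double integral, in real form so that
  inequalities between integrands can be applied directly.\<close>

lemma pair_integral_cos:
  fixes M :: "'a::euclidean_space measure"
  assumes M: "finite_measure M" and s [measurable_cong]: "sets M = sets borel"
  shows "(\<integral>p. cos (2 * pi * (v \<bullet> (fst p - snd p))) \<partial>(M \<Otimes>\<^sub>M M))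
     = (\<integral>x. cos (2 * pi * (v \<bullet> x)) \<partial>M)\<^sup>2 + (\<integral>x. sin (2 * pi * (v \<bullet> x)) \<partial>M)\<^sup>2"
proof -
  have [measurable]: "(\<lambda>x. cos (2 * pi * (v \<bullet> x))) \<in> borel_measurable M"
    "(\<lambda>x. sin (2 * pi * (v \<bullet> x))) \<in> borel_measurable M" by measurable
  have "cos (2 * pi * (v \<bullet> (fst p - snd p))) = cos (2 * pi * (v \<bullet> fst p)) * cos (2 * pi * (v \<bullet> snd p))
      + sin (2 * pi * (v \<bullet> fst p)) * sin (2 * pi * (v \<bullet> snd p))" for p :: "'a \<times> 'a"
    by (simp add: inner_diff_right right_diff_distrib cos_diff)
  then have "(\<integral>p. cos (2 * pi * (v \<bullet> (fst p - snd p))) \<partial>(M \<Otimes>\<^sub>M M)) =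
    (\<integral>p. cos (2 * pi * (v \<bullet> fst p)) * cos (2 * pi * (v \<bullet> snd p))
      + sin (2 * pi * (v \<bullet> fst p)) * sin (2 * pi * (v \<bullet> snd p)) \<partial>(M \<Otimes>\<^sub>M M))" by simp
  also have "\<dots> = (\<integral>p. cos (2 * pi * (v \<bullet> fst p)) * cos (2 * pi * (v \<bullet> snd p)) \<partial>(M \<Otimes>\<^sub>M M))
      + (\<integral>p. sin (2 * pi * (v \<bullet> fst p)) * sin (2 * pi * (v \<bullet> snd p)) \<partial>(M \<Otimes>\<^sub>M M))"
    by (rule Bochner_Integration.integral_add)
       (auto intro!: pair_integral_square(2)[OF M, where B=1])
  also have "\<dots> = (\<integral>x. cos (2 * pi * (v \<bullet> x)) \<partial>M)\<^sup>2 + (\<integral>x. sin (2 * pi * (v \<bullet> x)) \<partial>M)\<^sup>2"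
    using pair_integral_square(1)[OF M, of "\<lambda>x. cos (2 * pi * (v \<bullet> x))" 1]
      pair_integral_square(1)[OF M, of "\<lambda>x. sin (2 * pi * (v \<bullet> x))" 1] by simp
  finally show ?thesis .
qed

lemma fourier_transform_cis:
  "fourier_transform \<mu> z = (\<integral>x. cis (- (2 * pi * (z \<bullet> x))) \<partial>\<mu>)"
proof -
  have "exp (- 2 * complex_of_real pi * \<i> * complex_of_real (z \<bullet> x)) = cis (- (2 * pi * (z \<bullet> x)))" for x
    by (simp add: cis_conv_exp algebra_simps)
  then show ?thesis unfolding fourier_transform_def by simp
qed

lemma
  fixes \<mu> :: "'a::euclidean_space measure"
  assumes M: "finite_measure \<mu>" and s [measurable_cong]: "sets \<mu> = sets borel"
  shows fourier_transform_measurable: "fourier_transform \<mu> \<in> borel_measurable borel"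
    and cmod_fourier_transform_le: "cmod (fourier_transform \<mu> z) \<le> measure \<mu> UNIV"
    and cmod_fourier_transform_square:
      "(cmod (fourier_transform \<mu> z))\<^sup>2 = (\<integral>p. cos (2 * pi * (z \<bullet> (fst p - snd p))) \<partial>(\<mu> \<Otimes>\<^sub>M \<mu>))"
proof -
  interpret finite_measure \<mu> by fact
  have sp: "space \<mu> = UNIV" using sets_eq_imp_space_eq[OF s] by simp
  have m: "(\<lambda>x. cis (- (2 * pi * (z \<bullet> x)))) \<in> borel_measurable \<mu>" for z
    unfolding cis_conv_exp by measurable
  have "(\<lambda>z. \<integral>x. cis (- (2 * pi * (z \<bullet> x))) \<partial>\<mu>) \<in> borel_measurable borel"
    by (rule borel_measurable_lebesgue_integral) (unfold cis_conv_exp, measurable)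
  then show "fourier_transform \<mu> \<in> borel_measurable borel"
    by (simp add: fourier_transform_cis[abs_def])
  have "cmod (fourier_transform \<mu> z) \<le> (\<integral>x. cmod (cis (- (2 * pi * (z \<bullet> x)))) \<partial>\<mu>)"
    unfolding fourier_transform_cis by (rule integral_norm_bound)
  then show "cmod (fourier_transform \<mu> z) \<le> measure \<mu> UNIV" by (simp add: sp)
  have int: "integrable \<mu> (\<lambda>x. cis (- (2 * pi * (z \<bullet> x))))"
    by (rule integrable_bounded_finite[OF M m, where B=1]) simp
  have "Re (fourier_transform \<mu> z) = (\<integral>x. cos (2 * pi * (z \<bullet> x)) \<partial>\<mu>)"
    unfolding fourier_transform_cis by (subst integral_Re[OF int, symmetric]) simp
  moreover have "Im (fourier_transform \<mu> z) = - (\<integral>x. sin (2 * pi * (z \<bullet> x)) \<partial>\<mu>)"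
    unfolding fourier_transform_cis by (subst integral_Im[OF int, symmetric]) simp
  ultimately show "(cmod (fourier_transform \<mu> z))\<^sup>2 = (\<integral>p. cos (2 * pi * (z \<bullet> (fst p - snd p))) \<partial>(\<mu> \<Otimes>\<^sub>M \<mu>))"
    by (simp add: cmod_power2 pair_integral_cos[OF M s])
qed

text \<open>The kernel is the law of \<open>U - U'\<close> for \<open>U, U'\<close> uniform in the unit ball: its Fourier transform
  is a square, hence nonnegative, and it has a bounded density on the ball of radius \<open>2\<close>.\<close>

lemma close_pairs_le_fourier_energy:
  fixes \<mu> :: "'a::euclidean_space measure" and T :: "'a \<Rightarrow> 'a"
  assumes M: "finite_measure \<mu>" and s [measurable_cong]: "sets \<mu> = sets borel"
    and T: "linear T" and adj: "\<And>x y. T x \<bullet> y = x \<bullet> T y"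
    and A: "A \<in> sets (borel \<Otimes>\<^sub>M borel)" and close: "\<And>p. p \<in> A \<Longrightarrow> norm (T (fst p - snd p)) \<le> 1/8"
  shows "ennreal (unit_ball_vol DIM('a) / 4) * emeasure (\<mu> \<Otimes>\<^sub>M \<mu>) A
    \<le> (\<integral>\<^sup>+\<zeta>\<in>ball 0 2. ennreal ((cmod (fourier_transform \<mu> (T \<zeta>)))\<^sup>2) \<partial>lborel)"
proof -
  interpret finite_measure \<mu> by fact
  define v where "v = unit_ball_vol DIM('a)"
  have v: "0 < v" by (simp add: v_def)
  have iB [measurable]: "(indicator (ball (0::'a) 1) :: 'a \<Rightarrow> ennreal) \<in> borel_measurable borel"
    by (rule borel_measurable_indicator) simp
  define N where "N = density lborel (indicator (ball (0::'a) 1))"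
  have sN [measurable_cong]: "sets N = sets borel" by (simp add: N_def)
  have spN: "space N = UNIV" by (simp add: N_def)
  have eN: "emeasure N UNIV = ennreal v"
    using iB by (simp add: N_def emeasure_density emeasure_ball v_def)
  have finN: "finite_measure N" by (rule finite_measureI) (simp add: spN eN)
  then interpret N: finite_measure N .
  have mN: "measure N UNIV = v" using eN v by (simp add: measure_def)
  have finNN: "finite_measure (N \<Otimes>\<^sub>M N)" by (rule finite_measure_pair_measure) fact+
  have finMM: "finite_measure (\<mu> \<Otimes>\<^sub>M \<mu>)" by (rule finite_measure_pair_measure) fact+
  interpret NN: finite_measure "N \<Otimes>\<^sub>M N" by fact
  interpret MM: finite_measure "\<mu> \<Otimes>\<^sub>M \<mu>" by fact
  interpret Q: pair_sigma_finite "N \<Otimes>\<^sub>M N" "\<mu> \<Otimes>\<^sub>M \<mu>" ..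
  interpret NP: pair_sigma_finite N N ..
  have [measurable]: "T \<in> borel_measurable borel"
    using T by (intro borel_measurable_continuous_onI linear_continuous_on linear_conv_bounded_linear[THEN iffD1])
  note [measurable] = fourier_transform_measurable[OF M s]
  define g where "g = (\<lambda>q p. cos (2 * pi * (T (fst q - snd q) \<bullet> (fst p - snd p))))"
  define H where "H = (\<lambda>\<zeta>. (cmod (fourier_transform \<mu> (T \<zeta>)))\<^sup>2)"
  have H [measurable]: "H \<in> borel_measurable borel" unfolding H_def by measurable
  have A' [measurable]: "A \<in> sets (\<mu> \<Otimes>\<^sub>M \<mu>)" using A by (simp cong: sets_pair_measure_cong add: s)
  have int: "integrable ((N \<Otimes>\<^sub>M N) \<Otimes>\<^sub>M (\<mu> \<Otimes>\<^sub>M \<mu>)) (case_prod g)"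
  proof (rule integrable_bounded_finite[OF finite_measure_pair_measure[OF finMM finNN], where B=1])
    show "case_prod g \<in> borel_measurable ((N \<Otimes>\<^sub>M N) \<Otimes>\<^sub>M (\<mu> \<Otimes>\<^sub>M \<mu>))"
      unfolding g_def split_beta' by measurable
  qed (simp add: g_def split_beta')
  \<comment> \<open>Self-adjointness moves T onto the difference of p. The integral over q becomes
    the squared modulus of the transform of N there, so it is nonnegative also for pairs outside
    A.\<close>
  have inner: "(\<integral>q. g q p \<partial>(N \<Otimes>\<^sub>M N)) = (\<integral>x. cos (2 * pi * (T (fst p - snd p) \<bullet> x)) \<partial>N)\<^sup>2
      + (\<integral>x. sin (2 * pi * (T (fst p - snd p) \<bullet> x)) \<partial>N)\<^sup>2" for p
  proof -
    have "g q p = cos (2 * pi * (T (fst p - snd p) \<bullet> (fst q - snd q)))" for q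
      unfolding g_def using adj[of "fst p - snd p" "fst q - snd q"] by (simp only: inner_commute)
    then show ?thesis using pair_integral_cos[OF finN sN, of "T (fst p - snd p)"] by simp
  qed
  have lower: "(v / 2)\<^sup>2 * indicator A p \<le> (\<integral>q. g q p \<partial>(N \<Otimes>\<^sub>M N))" for p
  proof (cases "p \<in> A")
    case True
    let ?w = "T (fst p - snd p)"
    have "(\<integral>x. 1 / 2 \<partial>N) \<le> (\<integral>x. cos (2 * pi * (?w \<bullet> x)) \<partial>N)"
    proof (rule integral_mono_AE)
      show "integrable N (\<lambda>x. cos (2 * pi * (?w \<bullet> x)))"
        by (rule integrable_bounded_finite[OF finN, where B=1]) auto
      have "AE x in N. x \<in> ball 0 1"
        unfolding N_def by (subst AE_density[OF _]) (use iB in \<open>auto simp: indicator_def\<close>)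
      then show "AE x in N. 1 / 2 \<le> cos (2 * pi * (?w \<bullet> x))"
      proof eventually_elim
        fix x :: 'a assume x: "x \<in> ball 0 1"
        \<comment> \<open>The bound 1/8 keeps the phase below pi / 4, where the cosine is still at
          least 1/2.\<close>
        have "\<bar>?w \<bullet> x\<bar> \<le> 1/8 * 1"
          using x close[OF True] by (intro order_trans[OF Cauchy_Schwarz_ineq2[of ?w x] mult_mono]) auto
        then have "2 * pi * \<bar>?w \<bullet> x\<bar> \<le> 2 * pi * (1/8)" by (intro mult_left_mono) auto
        then have "\<bar>2 * pi * (?w \<bullet> x)\<bar> \<le> pi / 3" by (simp add: abs_mult)
        then have "cos (pi / 3) \<le> cos \<bar>2 * pi * (?w \<bullet> x)\<bar>"
          by (intro cos_monotone_0_pi_le) auto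
        then show "1 / 2 \<le> cos (2 * pi * (?w \<bullet> x))" by (simp add: cos_60)
      qed
    qed simp
    then have "(v / 2)\<^sup>2 \<le> (\<integral>x. cos (2 * pi * (?w \<bullet> x)) \<partial>N)\<^sup>2"
      using v by (intro power_mono) (auto simp: spN mN)
    then show ?thesis using True unfolding inner by (simp add: add_increasing2)
  qed (simp add: inner)
  have "(v / 2)\<^sup>2 * measure (\<mu> \<Otimes>\<^sub>M \<mu>) A = (\<integral>p. (v / 2)\<^sup>2 * indicator A p \<partial>(\<mu> \<Otimes>\<^sub>M \<mu>))"
    by simp
  also have "\<dots> \<le> (\<integral>p. (\<integral>q. g q p \<partial>(N \<Otimes>\<^sub>M N)) \<partial>(\<mu> \<Otimes>\<^sub>M \<mu>))"
  proof (rule integral_mono)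
    show "integrable (\<mu> \<Otimes>\<^sub>M \<mu>) (\<lambda>p. \<integral>q. g q p \<partial>(N \<Otimes>\<^sub>M N))" by (rule Q.integrable_snd[OF int])
    show "integrable (\<mu> \<Otimes>\<^sub>M \<mu>) (\<lambda>p. (v / 2)\<^sup>2 * indicator A p)"
      by (rule integrable_bounded_finite[OF finMM, where B="(v / 2)\<^sup>2"]) (auto simp: indicator_def)
  qed (rule lower)
  \<comment> \<open>Integrated over p first, the same function gives the squared transform of \<mu>
    at T (fst q - snd q).\<close>
  also have "\<dots> = (\<integral>q. (\<integral>p. g q p \<partial>(\<mu> \<Otimes>\<^sub>M \<mu>)) \<partial>(N \<Otimes>\<^sub>M N))"
    by (rule Q.Fubini_integral[OF int])
  also have "\<dots> = (\<integral>q. H (fst q - snd q) \<partial>(N \<Otimes>\<^sub>M N))"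
    unfolding g_def H_def using cmod_fourier_transform_square[OF M s] by simp
  finally have main: "(v / 2)\<^sup>2 * measure (\<mu> \<Otimes>\<^sub>M \<mu>) A \<le> (\<integral>q. H (fst q - snd q) \<partial>(N \<Otimes>\<^sub>M N))" .
  have intH: "integrable (N \<Otimes>\<^sub>M N) (\<lambda>q. H (fst q - snd q))"
  proof (rule integrable_bounded_finite[OF finNN, where B="(measure \<mu> UNIV)\<^sup>2"])
    show "norm (H (fst q - snd q)) \<le> (measure \<mu> UNIV)\<^sup>2" for q
      using cmod_fourier_transform_le[OF M s] by (auto simp: H_def intro!: power_mono)
  qed measurable
  \<comment> \<open>The extra factor v matches the mass of the variable y of N, which is integrated
    out last, and is cancelled at the end.\<close>
  have "ennreal (v / 4) * emeasure (\<mu> \<Otimes>\<^sub>M \<mu>) A * ennreal v = ennreal ((v / 2)\<^sup>2 * measure (\<mu> \<Otimes>\<^sub>M \<mu>) A)"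
    using v by (simp add: MM.emeasure_eq_measure power2_eq_square mult_ac flip: ennreal_mult)
  also have "\<dots> \<le> ennreal (\<integral>q. H (fst q - snd q) \<partial>(N \<Otimes>\<^sub>M N))" by (intro ennreal_leI main)
  also have "\<dots> = (\<integral>\<^sup>+q. ennreal (H (fst q - snd q)) \<partial>(N \<Otimes>\<^sub>M N))"
    by (rule nn_integral_eq_integral[symmetric, OF intH]) (simp add: H_def)
  also have "\<dots> = (\<integral>\<^sup>+y. (\<integral>\<^sup>+x. ennreal (H (x - y)) \<partial>N) \<partial>N)"
  proof -
    have "(\<lambda>q. ennreal (H (fst q - snd q))) \<in> borel_measurable (N \<Otimes>\<^sub>M N)" by measurable
    from NP.nn_integral_snd[OF this] show ?thesis by simp
  qed
  also have "\<dots> \<le> (\<integral>\<^sup>+y. (\<integral>\<^sup>+\<zeta>\<in>ball 0 2. ennreal (H \<zeta>) \<partial>lborel) \<partial>N)"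
  proof (rule nn_integral_mono_AE)
    have "AE y in N. y \<in> ball 0 1"
      unfolding N_def by (subst AE_density[OF _]) (use iB in \<open>auto simp: indicator_def\<close>)
    then show "AE y in N. (\<integral>\<^sup>+x. ennreal (H (x - y)) \<partial>N) \<le> (\<integral>\<^sup>+\<zeta>\<in>ball 0 2. ennreal (H \<zeta>) \<partial>lborel)"
    proof eventually_elim
      fix y :: 'a assume y: "y \<in> ball 0 1"
      have "(\<integral>\<^sup>+x. ennreal (H (x - y)) \<partial>N) = (\<integral>\<^sup>+x. indicator (ball 0 1) (x - y + y) * ennreal (H (x - y)) \<partial>lborel)"
        unfolding N_def by (subst nn_integral_density) (use iB in auto)
      also have "\<dots> = (\<integral>\<^sup>+x. indicator (ball 0 1) (x + y) * ennreal (H x) \<partial>lborel)"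
      proof (rule nn_integral_lborel_minus[where f="\<lambda>x. indicator (ball 0 1) (x + y) * ennreal (H x)"])
        show "(\<lambda>x. indicator (ball 0 1) (x + y) * ennreal (H x)) \<in> borel_measurable borel" by measurable
      qed
      also have "\<dots> \<le> (\<integral>\<^sup>+\<zeta>\<in>ball 0 2. ennreal (H \<zeta>) \<partial>lborel)"
      proof (rule nn_integral_mono)
        fix x :: 'a
        have "norm x < 2" if "norm (x + y) < 1" using that y norm_triangle_sub[of x "- y"] by simp
        then show "indicator (ball 0 1) (x + y) * ennreal (H x) \<le> ennreal (H x) * indicator (ball 0 2) x"
          by (auto simp: indicator_def)
      qed
      finally show "(\<integral>\<^sup>+x. ennreal (H (x - y)) \<partial>N) \<le> (\<integral>\<^sup>+\<zeta>\<in>ball 0 2. ennreal (H \<zeta>) \<partial>lborel)" .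
    qed
  qed
  also have "\<dots> = (\<integral>\<^sup>+\<zeta>\<in>ball 0 2. ennreal (H \<zeta>) \<partial>lborel) * ennreal v" by (simp add: spN eN)
  finally have "ennreal v * (ennreal (v / 4) * emeasure (\<mu> \<Otimes>\<^sub>M \<mu>) A) \<le> ennreal v * (\<integral>\<^sup>+\<zeta>\<in>ball 0 2. ennreal (H \<zeta>) \<partial>lborel)"
    by (simp add: mult.commute)
  then have "ennreal (v / 4) * emeasure (\<mu> \<Otimes>\<^sub>M \<mu>) A \<le> (\<integral>\<^sup>+\<zeta>\<in>ball 0 2. ennreal (H \<zeta>) \<partial>lborel)"
    using v by (simp add: ennreal_mult_le_mult_iff)
  then show ?thesis unfolding v_def H_def .
qed

section \<open>From close pairs to spectral mass\<close>

definition close_pairs :: "'a::euclidean_space set \<Rightarrow> 'a set \<Rightarrow> real \<Rightarrow> ('a \<times> 'a) set" where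
  "close_pairs K V \<delta> = {p \<in> K \<times> K. norm (orth_proj V (fst p - snd p)) \<le> 2 * \<delta>}"

lemma close_pairs_sets:
  assumes "subspace V" "closed K"
  shows "close_pairs K V \<delta> \<in> sets (borel \<Otimes>\<^sub>M borel)"
proof -
  note [measurable] = orth_proj_measurable[OF assms(1)]
  have "K \<in> sets borel" using assms(2) by simp
  then have "K \<times> K \<in> sets (borel \<Otimes>\<^sub>M borel)" by (rule pair_measureI) fact
  moreover have "{p \<in> space (borel \<Otimes>\<^sub>M borel). norm (orth_proj V (fst p - snd p)) \<le> 2 * \<delta>} \<in> sets (borel \<Otimes>\<^sub>M borel)"
    by measurable
  ultimately have "K \<times> K \<inter> {p \<in> space (borel \<Otimes>\<^sub>M borel). norm (orth_proj V (fst p - snd p)) \<le> 2 * \<delta>} \<in> sets (borel \<Otimes>\<^sub>M borel)"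
    by (rule sets.Int)
  then show ?thesis by (simp add: close_pairs_def space_pair_measure Int_def conj_commute)
qed

text \<open>If b > K, then b = b ^ (1 / \<theta>) b ^ (1 - 1 / \<theta>), and the second exponent is
  nonpositive. The lemma takes the place of Hoelder's inequality: whatever exceeds the threshold is
  charged to the power 1 / \<theta> that occurs in the energy.\<close>

lemma le_powr_split:
  fixes b K \<theta> :: real
  assumes "0 \<le> b" "0 < K" "0 < \<theta>" "\<theta> \<le> 1"
  shows "b \<le> K + b powr (1 / \<theta>) * K powr (1 - 1 / \<theta>)"
proof (cases "b \<le> K")
  case True
  then show ?thesis by (simp add: add_increasing2)
next
  case False
  then have b: "0 < b" using assms by simp
  have "1 - 1 / \<theta> \<le> 0" using assms by simp
  then have "b powr (1 - 1 / \<theta>) \<le> K powr (1 - 1 / \<theta>)" using False assms by (intro powr_mono2') auto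
  then have "b powr (1 / \<theta>) * b powr (1 - 1 / \<theta>) \<le> b powr (1 / \<theta>) * K powr (1 - 1 / \<theta>)"
    by (intro mult_left_mono) auto
  moreover have "b powr (1 / \<theta>) * b powr (1 - 1 / \<theta>) = b" using b by (simp flip: powr_add)
  ultimately show ?thesis using assms by linarith
qed

text \<open>The power of |z| is what remains of K ^ (1 - 1 / \<theta>), for K a multiple of |P_V z|
  ^ -a, after |P_V z| has been bounded by |z|. The result no longer depends on V, so one density
  serves all planes in the double counting.\<close>

definition spectral_density :: "real \<Rightarrow> real \<Rightarrow> 'a::euclidean_space measure \<Rightarrow> 'a \<Rightarrow> real" where
  "spectral_density \<theta> a \<mu> z = cmod (fourier_transform \<mu> z) powr (2 / \<theta>) * norm z powr (a * (1 / \<theta> - 1))"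

text \<open>The threshold \<open>K\<close> in \<open>le_powr_split\<close> is \<open>\<kappa> |P\<^sub>V z| ^ -a\<close>, whose kernel average is of
  order \<open>\<kappa> \<delta> ^ a\<close> and is absorbed by the left hand side for small \<open>\<kappa>\<close>.\<close>

lemma close_pairs_imp_spectral_mass:
  fixes \<mu> :: "'a::euclidean_space measure"
  assumes \<mu>: "\<mu> \<in> measures_on X" "compact X" and \<theta>: "0 < \<theta>" "\<theta> \<le> 1" and a: "0 < a" "a < 1" and k: "1 \<le> k"
    and c: "0 < c"
  shows "\<exists>c'>0. \<forall>V\<in>grassmannian k. \<forall>\<delta>. 0 < \<delta> \<longrightarrow> \<delta> \<le> 1/32 \<longrightarrow>
    ennreal (c * \<delta> powr a) \<le> emeasure (\<mu> \<Otimes>\<^sub>M \<mu>) (close_pairs (spt \<mu>) V \<delta>) \<longrightarrow>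
    ennreal (c' * \<delta> powr a) \<le> ennreal (\<delta> ^ k) *
      (\<integral>\<^sup>+z\<in>{z. norm z \<le> 1 / \<delta> \<and> norm (z - orth_proj V z) \<le> 1}. ennreal (spectral_density \<theta> a \<mu> z) \<partial>lborel)"
proof -
  note facts = measures_on_facts[OF \<mu>]
  note [measurable] = fourier_transform_measurable[OF facts(8,1)]
  define v where "v = unit_ball_vol DIM('a)"
  have v: "0 < v" by (simp add: v_def)
  obtain D0 where D0: "\<And>x y. x \<in> spt \<mu> \<Longrightarrow> y \<in> spt \<mu> \<Longrightarrow> dist x y \<le> D0"
    using compact_imp_bounded[OF facts(3)] by (auto simp: bounded_any_center bounded_two_points)
  define D where "D = max 1 D0"
  have D: "1 \<le> D" "\<And>x y. x \<in> spt \<mu> \<Longrightarrow> y \<in> spt \<mu> \<Longrightarrow> norm (x - y) \<le> D"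
    using D0 by (auto simp: D_def dist_norm intro: max.coboundedI2)
  obtain C1 where C1: "0 \<le> C1" "\<And>V \<delta> f. V \<in> grassmannian k \<Longrightarrow> 0 < \<delta> \<Longrightarrow> \<delta> \<le> 1/32 \<Longrightarrow> f \<in> borel_measurable borel \<Longrightarrow>
     (\<integral>\<^sup>+\<zeta>\<in>ball (0::'a) 2. f (stretch V (1 / (32 * \<delta>)) (1 / (16 * D)) \<zeta>) \<partial>lborel)
       \<le> ennreal (C1 * \<delta> ^ k) * (\<integral>\<^sup>+z\<in>{z. norm z \<le> 1 / \<delta> \<and> norm (z - orth_proj V z) \<le> 1}. f z \<partial>lborel)"
    using stretch_integral_le[OF D(1), of k, where 'a='a] by blast
  obtain C2 where C2: "0 \<le> C2" "\<And>V. V \<in> grassmannian k \<Longrightarrow>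
     (\<integral>\<^sup>+\<zeta>\<in>ball (0::'a) 2. ennreal (norm (orth_proj V \<zeta>) powr - a) \<partial>lborel) \<le> ennreal C2"
    using stretch_powr_integral_le[OF a k, where 'a='a] by blast
  \<comment> \<open>With this \<kappa> the part below the threshold contributes at most v c / 8
    times \<delta> ^ a, half of the lower bound v c / 4 times \<delta> ^ a.\<close>
  define \<kappa> where "\<kappa> = v * c / (8 * 32 powr a * (C2 + 1))"
  have \<kappa>: "0 < \<kappa>" using v c C2(1) by (simp add: \<kappa>_def)
  have \<kappa>C2: "\<kappa> * 32 powr a * C2 \<le> v * c / 8"
  proof -
    have "\<kappa> * 32 powr a * C2 = v * c / 8 * (C2 / (C2 + 1))" by (simp add: \<kappa>_def)
    also have "\<dots> \<le> v * c / 8 * 1" using v c C2(1) by (intro mult_left_mono) auto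
    finally show ?thesis by simp
  qed
  define L where "L = \<kappa> powr (1 - 1 / \<theta>)"
  have L: "0 < L" using \<kappa> by (simp add: L_def)
  define c' where "c' = v * c / (8 * L * (C1 + 1))"
  have c': "0 < c'" using v c L C1(1) by (simp add: c'_def)
  have "ennreal (c' * \<delta> powr a) \<le> ennreal (\<delta> ^ k) *
      (\<integral>\<^sup>+z\<in>{z. norm z \<le> 1 / \<delta> \<and> norm (z - orth_proj V z) \<le> 1}. ennreal (spectral_density \<theta> a \<mu> z) \<partial>lborel)"
    if V': "V \<in> grassmannian k" and \<delta>: "0 < \<delta>" "\<delta> \<le> 1/32"
      and E: "ennreal (c * \<delta> powr a) \<le> emeasure (\<mu> \<Otimes>\<^sub>M \<mu>) (close_pairs (spt \<mu>) V \<delta>)" for V \<delta>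
  proof -
    have V: "subspace V" using V' by (auto simp: grassmannian_def)
    note [measurable] = orth_proj_measurable[OF V]
    define T where "T = stretch V (1 / (32 * \<delta>)) (1 / (16 * D))"
    have Tm [measurable]: "T \<in> borel_measurable borel" unfolding T_def by (rule stretch_measurable[OF V])
    have P: "norm (orth_proj V (T z)) = norm (orth_proj V z) / (32 * \<delta>)"
      and Q: "norm (T z - orth_proj V (T z)) = norm (z - orth_proj V z) / (16 * D)" for z
      using \<delta> D(1) unfolding T_def stretch_compl[OF V] unfolding orth_proj_stretch[OF V] by simp_all
    let ?I = "\<integral>\<^sup>+z\<in>{z. norm z \<le> 1 / \<delta> \<and> norm (z - orth_proj V z) \<le> 1}. ennreal (spectral_density \<theta> a \<mu> z) \<partial>lborel"
    have sd: "(\<lambda>z. ennreal (spectral_density \<theta> a \<mu> z)) \<in> borel_measurable borel"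
      unfolding spectral_density_def by measurable
    note [measurable] = sd
    have close: "norm (T (fst p - snd p)) \<le> 1/8" if "p \<in> close_pairs (spt \<mu>) V \<delta>" for p
    proof -
      let ?w = "fst p - snd p"
      have p: "fst p \<in> spt \<mu>" "snd p \<in> spt \<mu>" "norm (orth_proj V ?w) \<le> 2 * \<delta>"
        using that by (auto simp: close_pairs_def)
      have "norm (orth_proj V (T ?w)) \<le> 1/16" using p(3) \<delta> unfolding P by (simp add: field_simps)
      moreover have "norm (T ?w - orth_proj V (T ?w)) \<le> 1/16"
        using order_trans[OF norm_orth_proj_compl_le[OF V] D(2)[OF p(1,2)]] D(1) unfolding Q by (simp add: field_simps)
      ultimately show ?thesis using norm_triangle_sub[of "T ?w" "orth_proj V (T ?w)"] by linarith
    qed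
    have "ennreal (v / 4) * ennreal (c * \<delta> powr a) \<le> ennreal (v / 4) * emeasure (\<mu> \<Otimes>\<^sub>M \<mu>) (close_pairs (spt \<mu>) V \<delta>)"
      by (intro mult_left_mono E) auto
    also have "\<dots> \<le> (\<integral>\<^sup>+\<zeta>\<in>ball 0 2. ennreal ((cmod (fourier_transform \<mu> (T \<zeta>)))\<^sup>2) \<partial>lborel)"
      unfolding v_def
    proof (rule close_pairs_le_fourier_energy[OF facts(8,1)])
      show "close_pairs (spt \<mu>) V \<delta> \<in> sets (borel \<Otimes>\<^sub>M borel)"
        by (rule close_pairs_sets[OF V closed_spt[OF facts(1)]])
      show "linear T" unfolding T_def by (rule linear_stretch[OF V])
      show "T x \<bullet> y = x \<bullet> T y" for x y unfolding T_def by (rule stretch_inner[OF V])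
    qed (rule close)
    also have "\<dots> \<le> (\<integral>\<^sup>+\<zeta>. ennreal (\<kappa> * (32 * \<delta>) powr a) * (ennreal (norm (orth_proj V \<zeta>) powr - a) * indicator (ball 0 2) \<zeta>)
        + ennreal L * (ennreal (spectral_density \<theta> a \<mu> (T \<zeta>)) * indicator (ball 0 2) \<zeta>) \<partial>lborel)"
    proof (rule nn_integral_mono_AE)
      show "AE \<zeta> in lborel. ennreal ((cmod (fourier_transform \<mu> (T \<zeta>)))\<^sup>2) * indicator (ball 0 2) \<zeta> \<le>
        ennreal (\<kappa> * (32 * \<delta>) powr a) * (ennreal (norm (orth_proj V \<zeta>) powr - a) * indicator (ball 0 2) \<zeta>)
        + ennreal L * (ennreal (spectral_density \<theta> a \<mu> (T \<zeta>)) * indicator (ball 0 2) \<zeta>)"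
        using AE_orth_proj_nonzero[OF V' k]
      proof eventually_elim
        fix \<zeta> :: 'a assume nz: "orth_proj V \<zeta> \<noteq> 0"
        let ?b = "(cmod (fourier_transform \<mu> (T \<zeta>)))\<^sup>2" and ?n = "norm (orth_proj V (T \<zeta>))"
        have n: "0 < ?n" using nz \<delta> unfolding P by simp
        define K where "K = \<kappa> * ?n powr - a"
        have K: "0 < K" using \<kappa> n by (simp add: K_def)
        have s1: "?b \<le> K + ?b powr (1 / \<theta>) * K powr (1 - 1 / \<theta>)"
          by (rule le_powr_split) (use K \<theta> in auto)
        have s2: "K = \<kappa> * (32 * \<delta>) powr a * norm (orth_proj V \<zeta>) powr - a"
          unfolding K_def P using \<delta> by (simp add: powr_divide powr_minus field_simps)
        have s3: "?b powr (1 / \<theta>) * K powr (1 - 1 / \<theta>) \<le> L * spectral_density \<theta> a \<mu> (T \<zeta>)"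
        proof -
          have "?b powr (1 / \<theta>) = cmod (fourier_transform \<mu> (T \<zeta>)) powr (2 / \<theta>)"
            by (cases "cmod (fourier_transform \<mu> (T \<zeta>)) = 0") (auto simp: powr_powr simp flip: powr_numeral)
          moreover have "K powr (1 - 1 / \<theta>) = L * ?n powr (a * (1 / \<theta> - 1))"
            using \<kappa> n by (simp add: K_def L_def powr_mult powr_powr algebra_simps)
          moreover have "?n powr (a * (1 / \<theta> - 1)) \<le> norm (T \<zeta>) powr (a * (1 / \<theta> - 1))"
            using a \<theta> norm_orth_proj_le[OF V, of "T \<zeta>"] by (intro powr_mono2) auto
          ultimately show ?thesis using L unfolding spectral_density_def
            by (simp add: mult_left_mono mult.left_commute)
        qed
        have "?b \<le> \<kappa> * (32 * \<delta>) powr a * norm (orth_proj V \<zeta>) powr - a + L * spectral_density \<theta> a \<mu> (T \<zeta>)"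
          using s1 s3 unfolding s2[symmetric] by linarith
        then have "ennreal ?b \<le> ennreal (\<kappa> * (32 * \<delta>) powr a * norm (orth_proj V \<zeta>) powr - a + L * spectral_density \<theta> a \<mu> (T \<zeta>))"
          by (rule ennreal_leI)
        also have "\<dots> = ennreal (\<kappa> * (32 * \<delta>) powr a) * ennreal (norm (orth_proj V \<zeta>) powr - a) + ennreal L * ennreal (spectral_density \<theta> a \<mu> (T \<zeta>))"
          using \<kappa> L by (simp add: ennreal_mult spectral_density_def)
        finally show "ennreal ?b * indicator (ball 0 2) \<zeta> \<le>
          ennreal (\<kappa> * (32 * \<delta>) powr a) * (ennreal (norm (orth_proj V \<zeta>) powr - a) * indicator (ball 0 2) \<zeta>)
          + ennreal L * (ennreal (spectral_density \<theta> a \<mu> (T \<zeta>)) * indicator (ball 0 2) \<zeta>)"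
          by (auto simp: indicator_def)
      qed
    qed
    also have "\<dots> = ennreal (\<kappa> * (32 * \<delta>) powr a) * (\<integral>\<^sup>+\<zeta>\<in>ball 0 2. ennreal (norm (orth_proj V \<zeta>) powr - a) \<partial>lborel)
        + ennreal L * (\<integral>\<^sup>+\<zeta>\<in>ball 0 2. ennreal (spectral_density \<theta> a \<mu> (T \<zeta>)) \<partial>lborel)"
    proof -
      have 1: "(\<lambda>\<zeta>. ennreal (norm (orth_proj V \<zeta>) powr - a) * indicator (ball 0 2) \<zeta>) \<in> borel_measurable lborel"
        by (intro borel_measurable_times_ennreal borel_measurable_indicator) (simp_all, measurable)
      have 2: "(\<lambda>\<zeta>. ennreal (spectral_density \<theta> a \<mu> (T \<zeta>)) * indicator (ball 0 2) \<zeta>) \<in> borel_measurable lborel"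
        by (intro borel_measurable_times_ennreal borel_measurable_indicator measurable_compose[OF _ sd]) (use Tm in simp_all)
      show ?thesis
        unfolding nn_integral_cmult[OF 1, symmetric] nn_integral_cmult[OF 2, symmetric]
        by (rule nn_integral_add) (use 1 2 in \<open>auto intro!: borel_measurable_times_ennreal\<close>)
    qed
    also have "\<dots> \<le> ennreal (\<kappa> * (32 * \<delta>) powr a) * ennreal C2 + ennreal L * (ennreal (C1 * \<delta> ^ k) * ?I)"
      unfolding T_def by (intro add_mono mult_left_mono C2(2) C1(2) V' \<delta> sd) auto
    also have "ennreal (\<kappa> * (32 * \<delta>) powr a) * ennreal C2 \<le> ennreal (v * c / 8 * \<delta> powr a)"
    proof -
      have "\<kappa> * (32 * \<delta>) powr a * C2 = (\<kappa> * 32 powr a * C2) * \<delta> powr a"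
        using \<delta> by (simp add: powr_mult mult_ac)
      also have "\<dots> \<le> v * c / 8 * \<delta> powr a" using \<kappa>C2 by (intro mult_right_mono) auto
      finally show ?thesis using C2(1) \<kappa> by (simp add: ennreal_leI flip: ennreal_mult)
    qed
    finally have main: "ennreal (v / 4) * ennreal (c * \<delta> powr a) \<le> ennreal (v * c / 8 * \<delta> powr a) + ennreal L * (ennreal (C1 * \<delta> ^ k) * ?I)"
      by (simp add: add_right_mono)
    have "ennreal (v / 4) * ennreal (c * \<delta> powr a) = ennreal (v * c / 8 * \<delta> powr a) + ennreal (v * c / 8 * \<delta> powr a)"
      using v c by (simp add: field_simps flip: ennreal_mult ennreal_plus)
    with main have main2: "ennreal (v * c / 8 * \<delta> powr a) \<le> ennreal L * (ennreal (C1 * \<delta> ^ k) * ?I)"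
      by (simp add: ennreal_add_left_cancel_le)
    have "ennreal (c' * \<delta> powr a) = ennreal (1 / (L * (C1 + 1))) * ennreal (v * c / 8 * \<delta> powr a)"
      using L C1(1) v c by (subst ennreal_mult[symmetric]) (auto simp: c'_def)
    also have "\<dots> \<le> ennreal (1 / (L * (C1 + 1))) * (ennreal L * (ennreal (C1 * \<delta> ^ k) * ?I))"
      by (intro mult_left_mono main2) auto
    also have "\<dots> = ennreal (1 / (L * (C1 + 1)) * (L * (C1 * \<delta> ^ k))) * ?I"
    proof -
      have *: "ennreal (x * (y * z)) = ennreal x * (ennreal y * ennreal z)" if "0 \<le> x" "0 \<le> y" "0 \<le> z" for x y z :: real
        using that by (simp add: ennreal_mult)
      have eq: "ennreal (1 / (L * (C1 + 1)) * (L * (C1 * \<delta> ^ k)))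
          = ennreal (1 / (L * (C1 + 1))) * (ennreal L * ennreal (C1 * \<delta> ^ k))"
        by (rule *) (use L C1(1) \<delta> in auto)
      show ?thesis unfolding eq by (simp only: mult.assoc)
    qed
    also have "\<dots> \<le> ennreal (\<delta> ^ k) * ?I"
    proof (intro mult_right_mono ennreal_leI)
      have "1 / (L * (C1 + 1)) * (L * (C1 * \<delta> ^ k)) = C1 / (C1 + 1) * \<delta> ^ k" using L by simp
      also have "\<dots> \<le> 1 * \<delta> ^ k" using C1(1) \<delta> by (intro mult_right_mono) auto
      finally show "1 / (L * (C1 + 1)) * (L * (C1 * \<delta> ^ k)) \<le> \<delta> ^ k" by simp
    qed simp
    finally show ?thesis .
  qed
  then show ?thesis using c' by blast
qed

section \<open>Small projections\<close>

text \<open>Discarding the cells of mass below \<open>M / (2 N)\<close> loses at most half of the total mass \<open>M\<close>,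
  and every remaining point is paired with its whole cell.\<close>

lemma pairs_in_cells_measure:
  fixes G :: "'i \<Rightarrow> 'a set" and N :: real
  assumes \<mu>: "finite_measure \<mu>" and I: "finite I" "card I \<le> N" "0 < N"
    and G: "\<And>i. i \<in> I \<Longrightarrow> G i \<in> sets \<mu>" and A: "A \<in> sets (\<mu> \<Otimes>\<^sub>M \<mu>)"
    and sub: "\<And>i. i \<in> I \<Longrightarrow> G i \<times> G i \<subseteq> A"
  shows "(measure \<mu> (\<Union>i\<in>I. G i))\<^sup>2 / (4 * N) \<le> measure (\<mu> \<Otimes>\<^sub>M \<mu>) A"
proof -
  interpret finite_measure \<mu> by fact
  interpret P: pair_sigma_finite \<mu> \<mu> ..
  interpret MM: finite_measure "\<mu> \<Otimes>\<^sub>M \<mu>" by (rule finite_measure_pair_measure) fact+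
  define W where "W = (\<Union>i\<in>I. G i)"
  define m where "m = measure \<mu> W"
  define t where "t = m / (2 * N)"
  define good where "good = {i \<in> I. t \<le> measure \<mu> (G i)}"
  define W' where "W' = (\<Union>i\<in>good. G i)"
  have W': "W' \<in> sets \<mu>" unfolding W'_def using I G by (intro sets.finite_UN) (auto simp: good_def)
  have t: "0 \<le> t" using I by (simp add: t_def m_def)
  have "m \<le> measure \<mu> W' + measure \<mu> (\<Union>i\<in>I - good. G i)"
  proof -
    have "W = W' \<union> (\<Union>i\<in>I - good. G i)" by (auto simp: W_def W'_def good_def)
    moreover have "(\<Union>i\<in>I - good. G i) \<in> sets \<mu>" using I G by (intro sets.finite_UN) auto
    ultimately show ?thesis unfolding m_def using measure_Un_le[OF W'] by simp
  qed
  also have "measure \<mu> (\<Union>i\<in>I - good. G i) \<le> (\<Sum>i\<in>I - good. measure \<mu> (G i))"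
    using I G by (intro finite_measure_subadditive_finite) auto
  also have "\<dots> \<le> (\<Sum>i\<in>I - good. t)" by (intro sum_mono) (auto simp: good_def)
  also have "\<dots> \<le> N * t"
    using I t card_mono[OF I(1), of "I - good"] by (auto intro!: mult_right_mono)
  also have "N * t = m / 2" using I by (simp add: t_def)
  finally have half: "m / 2 \<le> measure \<mu> W'" by simp
  have "ennreal (t * measure \<mu> W') = (\<integral>\<^sup>+x. ennreal t * indicator W' x \<partial>\<mu>)"
    using W' t by (simp add: nn_integral_cmult_indicator emeasure_eq_measure ennreal_mult)
  also have "\<dots> \<le> (\<integral>\<^sup>+x. emeasure \<mu> (Pair x -` A) \<partial>\<mu>)"
  proof (rule nn_integral_mono)
    fix x
    show "ennreal t * indicator W' x \<le> emeasure \<mu> (Pair x -` A)"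
    proof (cases "x \<in> W'")
      case True
      then obtain i where i: "i \<in> good" "x \<in> G i" by (auto simp: W'_def)
      then have "G i \<subseteq> Pair x -` A" using sub[of i] by (auto simp: good_def)
      then have "emeasure \<mu> (G i) \<le> emeasure \<mu> (Pair x -` A)"
        by (rule emeasure_mono) (rule sets_Pair1[OF A])
      moreover have "ennreal t \<le> emeasure \<mu> (G i)"
        using i by (simp add: good_def emeasure_eq_measure ennreal_leI)
      ultimately show ?thesis using True by simp
    qed simp
  qed
  also have "\<dots> = emeasure (\<mu> \<Otimes>\<^sub>M \<mu>) A" by (rule emeasure_pair_measure_alt[OF A, symmetric])
  finally have "t * measure \<mu> W' \<le> measure (\<mu> \<Otimes>\<^sub>M \<mu>) A" by (simp add: MM.emeasure_eq_measure)
  moreover have "t * (m / 2) \<le> t * measure \<mu> W'" using half t by (intro mult_left_mono)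
  moreover have "t * (m / 2) = m\<^sup>2 / (4 * N)" by (simp add: t_def power2_eq_square)
  ultimately show ?thesis unfolding m_def W_def by linarith
qed

lemma half_powr: "((1/2) ^ j) powr t = (2::real) powr (- (t * j))"
proof -
  have "(1/2) ^ j = (2::real) powr (- real j)"
    by (simp add: powr_minus powr_realpow power_one_over inverse_eq_divide)
  then show ?thesis by (simp add: powr_powr mult.commute)
qed

lemma dimension_lt_covers:
  assumes "hausdorff_dim dist (Y :: 'a::euclidean_space set) < ereal u" "0 < \<epsilon>"
  obtains s U where "0 < s" "s < u" "Y \<subseteq> (\<Union>i. U i)" "\<And>i::nat. ediam dist (U i) \<le> ennreal ((1/2) ^ J)"
    "(\<Sum>i. ennreal_powr (ediam dist (U i)) s) < ennreal \<epsilon>"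
proof -
  obtain s where s: "0 < s" "hausdorff_measure dist s Y = 0" "s < u"
    using assms(1) unfolding hausdorff_dim_def Inf_less_iff by auto
  have "hausdorff_premeasure dist s ((1/2) ^ J) Y \<le> hausdorff_measure dist s Y"
    unfolding hausdorff_measure_def by (rule SUP_upper) simp
  then have "hausdorff_premeasure dist s ((1/2) ^ J) Y < ennreal \<epsilon>" using s assms(2) by simp
  then obtain U where "Y \<subseteq> (\<Union>i. U i)" "\<forall>i. ediam dist (U i) \<le> ennreal ((1/2) ^ J)"
    "(\<Sum>i. ennreal_powr (ediam dist (U i)) s) < ennreal \<epsilon>"
    unfolding hausdorff_premeasure_def INF_less_iff by blast
  then show thesis using s that by blast
qed

lemma dist_le_ediam:
  assumes "x \<in> U" "y \<in> U" "ediam dist U \<le> ennreal B" "0 \<le> B"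
  shows "dist x y \<le> enn2real (ediam dist U)"
proof -
  have "ennreal (dist x y) \<le> (SUP y\<in>U. ennreal (dist x y))" using assms by (intro SUP_upper)
  also have "\<dots> \<le> ediam dist U" unfolding ediam_def using assms by (intro SUP_upper)
  finally have 1: "ennreal (dist x y) \<le> ediam dist U" .
  moreover have fin: "ediam dist U < top" using assms(3) by (rule le_less_trans) simp
  ultimately show ?thesis using enn2real_mono[OF 1 fin] by simp
qed

text \<open>A cover of P_V X is sorted by dyadic diameter. Level j holds O(2 ^ (u j)) sets. As the
  preimages cover the support, some level j \<ge> J has mass at least c1 2 ^ (- \<eta> j). Pairing
  points within the cells of this level gives pair mass of order 2 ^ (- 2 \<eta> j) / 2 ^ (u j),
  whence the exponent u + 2 \<eta>. The constant is uniform in V and J.\<close>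

lemma dimension_lt_imp_close_pairs:
  fixes \<mu> :: "'a::euclidean_space measure"
  assumes \<mu>: "\<mu> \<in> measures_on X" "compact X" and \<eta>: "0 < \<eta>" and u: "0 < u"
  shows "\<exists>c>0. \<forall>V. subspace V \<longrightarrow> hausdorff_dim dist (orth_proj V ` X) < ereal u \<longrightarrow>
    (\<forall>J. \<exists>j\<ge>J. ennreal (c * ((1/2) ^ j) powr (u + 2 * \<eta>)) \<le> emeasure (\<mu> \<Otimes>\<^sub>M \<mu>) (close_pairs (spt \<mu>) V ((1/2) ^ j)))"
proof -
  note facts = measures_on_facts[OF \<mu>]
  interpret finite_measure \<mu> by (rule facts)
  interpret MM: finite_measure "\<mu> \<Otimes>\<^sub>M \<mu>" by (rule finite_measure_pair_measure) (fact facts(8))+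
  define m where "m = measure \<mu> (spt \<mu>)"
  have m: "0 < m" using facts(5,7) by (simp add: m_def emeasure_eq_measure)
  define q where "q = 2 powr (- \<eta>)"
  have q: "0 < q" "q < 1" using \<eta> by (auto simp: q_def powr_less_one)
  \<comment> \<open>The masses c1 q ^ n then add up to m / 2, less than the total mass m.\<close>
  define c1 where "c1 = m / 2 * (1 - q)"
  have c1: "0 < c1" using m q by (simp add: c1_def)
  define c where "c = c1\<^sup>2 / 8"
  have c: "0 < c" using c1 by (simp add: c_def)
  have "\<exists>j\<ge>J. ennreal (c * ((1/2) ^ j) powr (u + 2 * \<eta>)) \<le> emeasure (\<mu> \<Otimes>\<^sub>M \<mu>) (close_pairs (spt \<mu>) V ((1/2) ^ j))"
    if V: "subspace V" and dimV: "hausdorff_dim dist (orth_proj V ` X) < ereal u" for V J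
  proof -
    let ?P = "orth_proj V"
    \<comment> \<open>The bound 2 ^ - u on the sum absorbs the loss from j to j + 1 in the lower
      bound for diameters: s (j + 1) - u \<le> u j.\<close>
    obtain s U where s: "0 < s" "s < u" and cov: "?P ` X \<subseteq> (\<Union>i::nat. U i)"
      and dm: "\<And>i. ediam dist (U i) \<le> ennreal ((1/2) ^ J)"
      and sm: "(\<Sum>i. ennreal_powr (ediam dist (U i)) s) < ennreal (2 powr - u)"
      using dimension_lt_covers[OF dimV, of "2 powr - u" J] by auto
    define d where "d = (\<lambda>i. enn2real (ediam dist (U i)))"
    have fin: "ediam dist (U i) \<noteq> top" for i using dm[of i] by (auto simp: top_unique)
    have d: "0 \<le> d i" "d i \<le> (1/2) ^ J" for i
      using enn2real_mono[OF dm[of i]] by (auto simp: d_def)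
    \<comment> \<open>Sets of diameter zero have no dyadic size. Sending the i-th of them to level J
      + i puts at most one on each level.\<close>
    define lev where "lev = (\<lambda>i. if d i = 0 then J + i else SOME j. (1/2) ^ Suc j < d i \<and> d i \<le> (1/2) ^ j)"
    have lev_pos: "(1/2) ^ Suc (lev i) < d i \<and> d i \<le> (1/2) ^ lev i" if "d i \<noteq> 0" for i
    proof -
      have "d i \<le> 1" using d(2)[of i] power_le_one[of "1/2::real" J] by linarith
      moreover have "0 < d i" using that d(1)[of i] by simp
      ultimately obtain j where "(1/2) ^ Suc j < d i" "d i \<le> (1/2) ^ j"
        using power_bracket[of "1/2" "d i"] by auto
      then have "(1/2) ^ Suc j < d i \<and> d i \<le> (1/2) ^ j" by simp
      then have "(1/2) ^ Suc (SOME j. (1/2) ^ Suc j < d i \<and> d i \<le> (1/2) ^ j) < d i \<and> d i \<le> (1/2) ^ (SOME j. (1/2) ^ Suc j < d i \<and> d i \<le> (1/2) ^ j)"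
        by (rule someI)
      then show ?thesis using that by (simp add: lev_def)
    qed
    have lev_J: "J \<le> lev i" for i
    proof (cases "d i = 0")
      case False
      have "(1/2::real) ^ Suc (lev i) < (1/2) ^ J" using lev_pos[OF False] d(2)[of i] by linarith
      then have "J < Suc (lev i)"
        using power_strict_decreasing_iff[of "1/2::real" "Suc (lev i)" J] by (simp del: power_Suc)
      then show ?thesis by simp
    qed (simp add: lev_def)
    have d_lev: "d i \<le> (1/2) ^ lev i" for i using lev_pos[of i] by (cases "d i = 0") auto
    define I where "I = (\<lambda>j. {i. lev i = j})"
    have cardI: "finite (I j) \<and> card (I j) \<le> 2 * 2 powr (u * j)" for j
    proof -
      define I1 where "I1 = {i \<in> I j. d i \<noteq> 0}"
      have bd: "card F \<le> 2 powr (u * j)" if F: "finite F" "F \<subseteq> I1" for F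
      proof -
        have "ennreal (card F * 2 powr (- s * Suc j)) = (\<Sum>i\<in>F. ennreal (2 powr (- s * Suc j)))"
          by (simp add: ennreal_mult ennreal_of_nat_eq_real_of_nat)
        also have "\<dots> \<le> (\<Sum>i\<in>F. ennreal_powr (ediam dist (U i)) s)"
        proof (rule sum_mono)
          fix i assume "i \<in> F"
          then have i: "lev i = j" "d i \<noteq> 0" using F by (auto simp: I1_def I_def)
          have "2 powr (- s * Suc j) = ((1/2) ^ Suc j) powr s" unfolding half_powr by simp
          also have "\<dots> \<le> d i powr s" using lev_pos[OF i(2)] i(1) s by (intro powr_mono2) auto
          finally show "ennreal (2 powr (- s * Suc j)) \<le> ennreal_powr (ediam dist (U i)) s"
            using fin[of i] by (simp add: ennreal_powr_def d_def ennreal_leI)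
        qed
        also have "\<dots> \<le> (\<Sum>i. ennreal_powr (ediam dist (U i)) s)" by (rule sum_le_suminf) (use F in auto)
        also have "\<dots> < ennreal (2 powr - u)" by (rule sm)
        finally have "card F * 2 powr (- s * Suc j) < 2 powr - u" by (simp add: ennreal_less_iff)
        then have "card F * 2 powr (- s * Suc j) * 2 powr (s * Suc j) \<le> 2 powr - u * 2 powr (s * Suc j)"
          by (intro mult_right_mono) auto
        also have "card F * 2 powr (- s * Suc j) * 2 powr (s * Suc j) = card F"
          by (simp add: mult.assoc flip: powr_add)
        also have "2 powr - u * 2 powr (s * Suc j) = 2 powr (s * Suc j - u)" by (simp flip: powr_add)
        also have "\<dots> \<le> 2 powr (u * j)"
          using s mult_right_mono[of s u "real j"] by (intro powr_mono) (auto simp: algebra_simps)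
        finally show ?thesis .
      qed
      have finI1: "finite I1"
        using finite_if_finite_subsets_card_bdd[of I1 "nat \<lfloor>2 powr (u * j)\<rfloor>"] bd by (simp add: le_nat_floor)
      have sub: "I j \<subseteq> insert (j - J) I1" by (auto simp: I_def I1_def lev_def)
      have "card (I j) \<le> card (insert (j - J) I1)" using finI1 sub by (intro card_mono) auto
      also have "\<dots> \<le> card I1 + 1" using finI1 by (simp add: card_insert_if)
      finally have "real (card (I j)) \<le> card I1 + 1" by linarith
      moreover have "1 \<le> 2 powr (u * j)" using u by (simp add: ge_one_powr_ge_zero)
      ultimately show ?thesis using bd[OF finI1 subset_refl] finite_subset[OF sub] finI1 by auto
    qed
    define p where "p = (\<lambda>i. SOME y. y \<in> U i)"
    have p: "dist (p i) y \<le> (1/2) ^ lev i" if "y \<in> U i" for i y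
    proof -
      have "p i \<in> U i" unfolding p_def by (rule someI) (rule that)
      from dist_le_ediam[OF this that dm[of i]] show ?thesis using d_lev[of i] by (simp add: d_def)
    qed
    note [measurable] = orth_proj_measurable[OF V]
    define G where "G = (\<lambda>i. {x \<in> spt \<mu>. dist (p i) (?P x) \<le> (1/2) ^ lev i})"
    have G: "G i \<in> sets \<mu>" for i
    proof -
      have "spt \<mu> \<in> sets borel" by (rule borel_closed[OF closed_spt[OF facts(1)]])
      moreover have "{x \<in> space borel. dist (p i) (?P x) \<le> (1/2) ^ lev i} \<in> sets borel" by measurable
      ultimately have "spt \<mu> \<inter> {x \<in> space borel. dist (p i) (?P x) \<le> (1/2) ^ lev i} \<in> sets borel" by (rule sets.Int)
      then show ?thesis by (simp add: G_def facts(1) Int_def)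
    qed
    define W where "W = (\<lambda>j. \<Union>i\<in>I j. G i)"
    have Wm: "W j \<in> sets \<mu>" for j unfolding W_def using cardI G by (intro sets.finite_UN) auto
    have covW: "spt \<mu> \<subseteq> (\<Union>n. W (J + n))"
    proof
      fix x assume x: "x \<in> spt \<mu>"
      then obtain i where i: "?P x \<in> U i" using cov facts(4) by blast
      then have "x \<in> W (lev i)" using p[OF i] x by (auto simp: W_def I_def G_def)
      moreover have "lev i = J + (lev i - J)" using lev_J[of i] by simp
      ultimately show "x \<in> (\<Union>n. W (J + n))" by (metis UN_I UNIV_I)
    qed
    have "\<exists>n. c1 * q ^ n < measure \<mu> (W (J + n))"
    proof (rule ccontr)
      assume "\<nexists>n. c1 * q ^ n < measure \<mu> (W (J + n))"
      then have le: "measure \<mu> (W (J + n)) \<le> c1 * q ^ n" for n by (simp add: not_less)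
      have "emeasure \<mu> (spt \<mu>) \<le> emeasure \<mu> (\<Union>n. W (J + n))" using Wm by (intro emeasure_mono covW) auto
      also have "\<dots> \<le> (\<Sum>n. emeasure \<mu> (W (J + n)))" using Wm by (intro emeasure_subadditive_countably) auto
      also have "\<dots> \<le> (\<Sum>n. ennreal (c1 * q ^ n))"
        using le by (intro suminf_le) (auto simp: emeasure_eq_measure intro: ennreal_leI)
      also have "\<dots> = ennreal (\<Sum>n. c1 * q ^ n)"
        using q c1 by (intro suminf_ennreal2 summable_mult summable_geometric) auto
      also have "(\<Sum>n. c1 * q ^ n) = m / 2"
        using q by (subst suminf_mult) (auto simp: suminf_geometric summable_geometric c1_def field_simps)
      finally show False using m by (simp add: m_def emeasure_eq_measure)
    qed
    then obtain n where n: "c1 * q ^ n < measure \<mu> (W (J + n))" by blast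
    define j where "j = J + n"
    have "c1 * q ^ j \<le> c1 * q ^ n" using q c1 by (simp add: j_def power_decreasing)
    then have Wj: "c1 * q ^ j \<le> measure \<mu> (W j)" using n by (simp add: j_def)
    define A where "A = close_pairs (spt \<mu>) V ((1/2) ^ j)"
    have A: "A \<in> sets (\<mu> \<Otimes>\<^sub>M \<mu>)"
      using close_pairs_sets[OF V closed_spt[OF facts(1)]] unfolding A_def
      by (simp cong: sets_pair_measure_cong add: facts(1))
    have "(measure \<mu> (W j))\<^sup>2 / (4 * (2 * 2 powr (u * j))) \<le> measure (\<mu> \<Otimes>\<^sub>M \<mu>) A"
      unfolding W_def
    proof (rule pairs_in_cells_measure)
      show "finite_measure \<mu>" by (rule facts(8))
      show "finite (I j)" "card (I j) \<le> 2 * 2 powr (u * j)" using cardI by auto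
      show "0 < 2 * 2 powr (u * j)" by simp
      show "G i \<in> sets \<mu>" for i by (rule G)
      show "A \<in> sets (\<mu> \<Otimes>\<^sub>M \<mu>)" by (rule A)
      fix i assume i: "i \<in> I j"
      show "G i \<times> G i \<subseteq> A"
      proof clarify
        fix x y assume xy: "x \<in> G i" "y \<in> G i"
        then have "dist (?P x) (?P y) \<le> 2 * (1/2) ^ j"
          using i dist_triangle3[of "?P x" "?P y" "p i"] by (auto simp: G_def I_def)
        then show "(x, y) \<in> A"
          using xy by (simp add: A_def close_pairs_def G_def dist_norm linear_diff[OF linear_orth_proj[OF V]])
      qed
    qed
    moreover have "c * ((1/2) ^ j) powr (u + 2 * \<eta>) \<le> (measure \<mu> (W j))\<^sup>2 / (4 * (2 * 2 powr (u * j)))"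
    proof -
      have "c * ((1/2) ^ j) powr (u + 2 * \<eta>) = (c1 * q ^ j)\<^sup>2 / (4 * (2 * 2 powr (u * j)))"
      proof -
        have "q ^ j = 2 powr (- (\<eta> * j))" unfolding q_def by (simp add: powr_powr flip: powr_realpow)
        then have "(q ^ j)\<^sup>2 = 2 powr (- (2 * \<eta> * j))" by (simp add: power2_eq_square mult.assoc flip: powr_add)
        moreover have "2 powr (- ((u + 2 * \<eta>) * j)) = 2 powr (- (2 * \<eta> * j)) / 2 powr (u * j)"
          unfolding powr_diff[symmetric] by (rule arg_cong[where f="\<lambda>t. 2 powr t"]) (simp add: algebra_simps)
        ultimately show ?thesis unfolding half_powr by (simp add: c_def power_mult_distrib)
      qed
      also have "\<dots> \<le> (measure \<mu> (W j))\<^sup>2 / (4 * (2 * 2 powr (u * j)))"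
        using Wj c1 q by (intro divide_right_mono power_mono) auto
      finally show ?thesis .
    qed
    ultimately have "ennreal (c * ((1/2) ^ j) powr (u + 2 * \<eta>)) \<le> emeasure (\<mu> \<Otimes>\<^sub>M \<mu>) A"
      by (simp add: MM.emeasure_eq_measure ennreal_leI)
    then show ?thesis unfolding A_def by (intro exI[of _ j]) (simp add: j_def)
  qed
  then show ?thesis using c by blast
qed

section \<open>Packings in the Grassmannian\<close>

lemma orthonormal_expand:
  fixes B :: "'a::euclidean_space set"
  assumes "finite B" and ON: "\<forall>b\<in>B. \<forall>c\<in>B. b \<bullet> c = (if b = c then 1 else 0)" and x: "x \<in> span B"
  shows "(\<Sum>b\<in>B. (x \<bullet> b) *\<^sub>R b) = x"
proof (rule orthonormal_basis_expand)
  show "pairwise orthogonal B" using ON by (auto simp: pairwise_def orthogonal_def)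
  show "norm b = 1" if "b \<in> B" for b using ON that by (simp add: norm_eq_1)
qed fact+

text \<open>P_V - P_W = P_V (I - P_W) - (I - P_V) P_W. The second operator is controlled by the
  closeness of W to V; the first is the adjoint of (I - P_W) P_V and so is controlled by the
  closeness of V to W.\<close>

lemma gr_dist_le:
  fixes V W :: "'a::euclidean_space set"
  assumes V: "subspace V" and W: "subspace W" and \<epsilon>: "0 \<le> \<epsilon>"
    and VW: "\<And>v. v \<in> V \<Longrightarrow> \<exists>w\<in>W. norm (v - w) \<le> \<epsilon> * norm v"
    and WV: "\<And>w. w \<in> W \<Longrightarrow> \<exists>v\<in>V. norm (w - v) \<le> \<epsilon> * norm w"
  shows "gr_dist V W \<le> 2 * \<epsilon>"
  unfolding gr_dist_def
proof (rule onorm_le)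
  have closest: "norm (v - orth_proj W v) \<le> norm (v - w)" if W: "subspace W" and w: "w \<in> W" for v w and W :: "'a set"
  proof -
    have "v - orth_proj W v = (v - w) - orth_proj W (v - w)"
      using linear_orth_proj[OF W] orth_proj_id[OF W w] by (simp add: linear_diff)
    then show ?thesis using norm_orth_proj_compl_le[OF W, of "v - w"] by (simp only:)
  qed
  fix x :: 'a
  let ?P = "orth_proj V" and ?Q = "orth_proj W"
  define v where "v = ?P (x - ?Q x)"
  have vV: "v \<in> V" unfolding v_def by (rule orth_proj(1)[OF V])
  have "norm v * norm v \<le> \<epsilon> * norm x * norm v"
  proof -
    have "v \<bullet> v = v \<bullet> (x - ?Q x)"
      using orth_proj_inner[OF V, of v "x - ?Q x"] orth_proj_id[OF V vV] by (simp add: v_def[symmetric] inner_commute)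
    also have "\<dots> = (v - ?Q v) \<bullet> x"
      using orth_proj_inner[OF W, of v x] by (simp add: inner_diff_left inner_diff_right)
    also have "\<dots> \<le> norm (v - ?Q v) * norm x" by (rule norm_cauchy_schwarz)
    also have "norm (v - ?Q v) \<le> \<epsilon> * norm v"
      using VW[OF vV] closest[OF W] by (meson order_trans)
    finally have "v \<bullet> v \<le> \<epsilon> * norm v * norm x" by (simp add: mult_right_mono)
    then show ?thesis by (simp add: mult_ac flip: power2_norm_eq_inner power2_eq_square)
  qed
  then have 1: "norm v \<le> \<epsilon> * norm x"
    using \<epsilon> by (cases "v = 0") auto
  have QW: "?Q x \<in> W" by (rule orth_proj(1)[OF W])
  have "norm (?Q x - ?P (?Q x)) \<le> \<epsilon> * norm (?Q x)"
    using WV[OF QW] closest[OF V] by (meson order_trans)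
  also have "\<dots> \<le> \<epsilon> * norm x" using \<epsilon> norm_orth_proj_le[OF W] by (intro mult_left_mono) auto
  finally have 2: "norm (?Q x - ?P (?Q x)) \<le> \<epsilon> * norm x" .
  have "?P x - ?Q x = v - (?Q x - ?P (?Q x))"
    unfolding v_def using linear_orth_proj[OF V] by (simp add: linear_diff)
  then have "norm (?P x - ?Q x) \<le> norm v + norm (?Q x - ?P (?Q x))"
    by (simp only: norm_triangle_ineq4)
  then show "norm (?P x - ?Q x) \<le> 2 * \<epsilon> * norm x" using 1 2 by linarith
qed

section \<open>A finite net and graph charts\<close>

text \<open>Projections are coded by their matrix entries rounded at resolution 1 / M. The entries
  lie in [-1, 1], so there are finitely many codes, and equal codes give operators at distance at
  most d ^ 2 / M = 1/2.\<close>

lemma grassmannian_half_net: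
  "\<exists>F. finite F \<and> F \<subseteq> grassmannian k \<and>
     (\<forall>V\<in>grassmannian k. \<exists>W\<in>F. \<forall>x::'a::euclidean_space. norm (orth_proj V x - orth_proj W x) \<le> 1/2 * norm x)"
proof -
  let ?d = "DIM('a)"
  define M where "M = 2 * (real ?d)\<^sup>2"
  have M: "0 < M" by (simp add: M_def)
  define m where "m = \<lceil>M\<rceil>"
  define code where "code = (\<lambda>V::'a set. restrict (\<lambda>(e, e'). \<lfloor>M * (orth_proj V e \<bullet> e')\<rfloor>) (Basis \<times> Basis))"
  define G where "G = (grassmannian k :: 'a set set)"
  have "code V \<in> Basis \<times> Basis \<rightarrow>\<^sub>E {-m..m}" if "V \<in> G" for V
  proof -
    have V: "subspace V" using that by (auto simp: G_def grassmannian_def)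
    have "\<lfloor>M * (orth_proj V e \<bullet> e')\<rfloor> \<in> {-m..m}" if "e \<in> Basis" "e' \<in> Basis" for e e'
    proof -
      have "\<bar>orth_proj V e \<bullet> e'\<bar> \<le> 1"
        using Cauchy_Schwarz_ineq2[of "orth_proj V e" e'] norm_orth_proj_le[OF V, of e] that by simp
      then have "\<bar>M * (orth_proj V e \<bullet> e')\<bar> \<le> M * 1" unfolding abs_mult using M by (intro mult_mono) auto
      then have "M * (orth_proj V e \<bullet> e') \<le> M" "- M \<le> M * (orth_proj V e \<bullet> e')" by (auto simp: abs_le_iff)
      then show ?thesis unfolding m_def by (auto simp: le_floor_iff floor_le_iff) linarith+
    qed
    then show ?thesis by (auto simp: code_def)
  qed
  then have "code ` G \<subseteq> Basis \<times> Basis \<rightarrow>\<^sub>E {-m..m}" by blast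
  moreover have "finite ((Basis::'a set) \<times> (Basis::'a set) \<rightarrow>\<^sub>E {-m..m})" by (intro finite_PiE) auto
  ultimately have fin: "finite (code ` G)" by (rule finite_subset)
  define rep where "rep = (\<lambda>c. SOME V. V \<in> G \<and> code V = c)"
  have rep: "rep (code V) \<in> G \<and> code (rep (code V)) = code V" if "V \<in> G" for V
    unfolding rep_def by (rule someI_ex) (use that in blast)
  have near: "norm (orth_proj V x - orth_proj W x) \<le> 1/2 * norm x"
    if VW: "V \<in> G" "W \<in> G" and eq: "code V = code W" for V W and x :: 'a
  proof -
    have V: "subspace V" and W: "subspace W" using VW by (auto simp: G_def grassmannian_def)
    let ?D = "\<lambda>x. orth_proj V x - orth_proj W x"
    have linD: "linear ?D" by (intro linear_compose_sub linear_orth_proj V W)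
    have ee: "\<bar>?D e \<bullet> e'\<bar> \<le> 1 / M" if "e \<in> Basis" "e' \<in> Basis" for e e'
    proof -
      have "\<lfloor>M * (orth_proj V e \<bullet> e')\<rfloor> = \<lfloor>M * (orth_proj W e \<bullet> e')\<rfloor>"
        using fun_cong[OF eq, of "(e, e')"] that by (simp add: code_def)
      then have "\<bar>M * (orth_proj V e \<bullet> e') - M * (orth_proj W e \<bullet> e')\<bar> \<le> 1" by linarith
      then have "M * \<bar>?D e \<bullet> e'\<bar> \<le> 1" using M by (simp add: inner_diff_left abs_mult flip: right_diff_distrib)
      then show ?thesis using M by (simp add: field_simps)
    qed
    have De: "norm (?D e) \<le> ?d / M" if "e \<in> Basis" for e
      using norm_le_l1[of "?D e"] sum_bounded_above[of Basis "\<lambda>e'. \<bar>?D e \<bullet> e'\<bar>" "1 / M"] ee[OF that] by simp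
    have "?D x = ?D (\<Sum>e\<in>Basis. (x \<bullet> e) *\<^sub>R e)" by (simp add: euclidean_representation)
    also have "\<dots> = (\<Sum>e\<in>Basis. (x \<bullet> e) *\<^sub>R ?D e)"
      by (simp only: linear_sum[OF linD, of "\<lambda>e. (x \<bullet> e) *\<^sub>R e" Basis] linear_cmul[OF linD])
    finally have "norm (?D x) \<le> (\<Sum>e\<in>Basis. norm ((x \<bullet> e) *\<^sub>R ?D e))" by (simp only: norm_sum)
    also have "\<dots> \<le> (\<Sum>e\<in>(Basis::'a set). norm x * (?d / M))"
      unfolding norm_scaleR using De by (intro sum_mono mult_mono) (auto simp: Basis_le_norm)
    also have "\<dots> = 1/2 * norm x" by (simp add: M_def power2_eq_square)
    finally show ?thesis .
  qed
  have "\<exists>W\<in>rep ` code ` G. \<forall>x. norm (orth_proj V x - orth_proj W x) \<le> 1/2 * norm x" if "V \<in> G" for V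
    using near[OF that conjunct1[OF rep[OF that]] conjunct2[OF rep[OF that], symmetric]] that by blast
  moreover have "rep ` code ` G \<subseteq> G" using rep by blast
  ultimately show ?thesis using fin unfolding G_def by blast
qed

text \<open>Subspaces within \<open>1/2\<close> of \<open>W\<close> are graphs over \<open>W\<close>; \<open>lift V b\<close> is the point above \<open>b\<close>.\<close>

locale graph_chart =
  fixes W :: "'a::euclidean_space set" and k :: nat
  assumes W: "W \<in> grassmannian k"
begin

definition near :: "'a set \<Rightarrow> bool" where
  "near V \<longleftrightarrow> V \<in> grassmannian k \<and> (\<forall>x. norm (orth_proj V x - orth_proj W x) \<le> 1/2 * norm x)"

definition lift :: "'a set \<Rightarrow> 'a \<Rightarrow> 'a" where
  "lift V b = (THE v. v \<in> V \<and> orth_proj W v = b)"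

lemma subW: "subspace W" and dimW: "dim W = k"
  using W by (auto simp: grassmannian_def)

lemma near_subspace: "near V \<Longrightarrow> subspace V"
  by (auto simp: near_def grassmannian_def)

text \<open>The source of injectivity of P_W on V and of the factor 2 in the norm of lifts.\<close>

lemma near_norm:
  assumes "near V" "v \<in> V" shows "norm v \<le> 2 * norm (orth_proj W v)"
proof -
  have "orth_proj V v = v" using assms near_subspace by (simp add: orth_proj_id)
  then have "norm (v - orth_proj W v) \<le> 1/2 * norm v" using assms(1) unfolding near_def by metis
  then show ?thesis using norm_triangle_sub[of v "orth_proj W v"] by linarith
qed

lemma lift_unique:
  assumes "near V" "v \<in> V" "v' \<in> V" "orth_proj W v = orth_proj W v'" shows "v = v'"
proof -
  have "v - v' \<in> V" using assms near_subspace by (simp add: subspace_diff)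
  from near_norm[OF assms(1) this] show ?thesis
    using assms(4) by (simp add: linear_diff[OF linear_orth_proj[OF subW]])
qed

text \<open>P_W is injective on V, and V and W have the same dimension; hence it maps V onto
  W.\<close>

lemma
  assumes V: "near V" and b: "b \<in> W"
  shows lift_mem: "lift V b \<in> V" and lift_proj: "orth_proj W (lift V b) = b"
proof -
  let ?P = "orth_proj W"
  have sV: "subspace V" and dV: "dim V = k" using V by (auto simp: near_def grassmannian_def)
  have "inj_on ?P (span V)"
    using lift_unique[OF V] sV by (auto intro!: inj_onI simp: span_eq_iff[THEN iffD2])
  then have "dim (?P ` V) = k"
    using dim_image_eq[OF linear_orth_proj[OF subW]] dV by simp
  then have "?P ` V = W"
    using subspace_dim_equal[of "?P ` V" W] subW sV dimW orth_proj(1)[OF subW]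
      linear_subspace_image[OF linear_orth_proj[OF subW]] by fastforce
  then obtain v where v: "v \<in> V" "?P v = b" using b by (metis imageE)
  have "lift V b \<in> V \<and> ?P (lift V b) = b"
    unfolding lift_def by (rule theI[of _ v]) (use v lift_unique[OF V] in auto)
  then show "lift V b \<in> V" "?P (lift V b) = b" by auto
qed

lemma lift_eq: "near V \<Longrightarrow> v \<in> V \<Longrightarrow> lift V (orth_proj W v) = v"
  using lift_unique[OF _ lift_mem[OF _ orth_proj(1)[OF subW]] _ lift_proj[OF _ orth_proj(1)[OF subW]]] by simp

lemma norm_lift: "near V \<Longrightarrow> b \<in> W \<Longrightarrow> norm (lift V b) \<le> 2 * norm b"
  using near_norm[of V "lift V b"] lift_mem[of V b] lift_proj[of V b] by simp

lemma lift_add: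
  assumes "near V" "b \<in> W" "b' \<in> W" shows "lift V (b + b') = lift V b + lift V b'"
proof (rule lift_unique[OF assms(1)])
  have m: "b + b' \<in> W" using assms subW by (simp add: subspace_add)
  show "lift V (b + b') \<in> V" by (rule lift_mem[OF assms(1) m])
  show "lift V b + lift V b' \<in> V"
    by (intro subspace_add near_subspace lift_mem assms)
  show "orth_proj W (lift V (b + b')) = orth_proj W (lift V b + lift V b')"
    unfolding lift_proj[OF assms(1) m] linear_add[OF linear_orth_proj[OF subW]]
      lift_proj[OF assms(1,2)] lift_proj[OF assms(1,3)] ..
qed

lemma lift_scale:
  assumes "near V" "b \<in> W" shows "lift V (t *\<^sub>R b) = t *\<^sub>R lift V b"
proof (rule lift_unique[OF assms(1)])
  have m: "t *\<^sub>R b \<in> W" using assms subW by (simp add: subspace_scale)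
  show "lift V (t *\<^sub>R b) \<in> V" by (rule lift_mem[OF assms(1) m])
  show "t *\<^sub>R lift V b \<in> V"
    by (intro subspace_scale near_subspace lift_mem assms)
  show "orth_proj W (lift V (t *\<^sub>R b)) = orth_proj W (t *\<^sub>R lift V b)"
    unfolding lift_proj[OF assms(1) m] linear_cmul[OF linear_orth_proj[OF subW]] lift_proj[OF assms] ..
qed

lemma lift_sum:
  assumes V: "near V" and "finite B" "B \<subseteq> W"
  shows "lift V (\<Sum>b\<in>B. f b *\<^sub>R b) = (\<Sum>b\<in>B. f b *\<^sub>R lift V b)"
  using assms(2,3)
proof (induction B rule: finite_induct)
  case empty
  have "lift V 0 = 0" using lift_scale[OF V subspace_0[OF subW], of 0] by simp
  then show ?case by simp
next
  case (insert b B)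
  have "(\<Sum>b\<in>B. f b *\<^sub>R b) \<in> W" using insert subW by (intro subspace_sum subspace_scale) auto
  moreover have "b \<in> W" "B \<subseteq> W" using insert by auto
  ultimately show ?case using insert(1,2) insert(3)[OF \<open>B \<subseteq> W\<close>] subspace_scale[OF subW \<open>b \<in> W\<close>]
    by (simp add: lift_add[OF V] lift_scale[OF V])
qed

text \<open>Lifts are linear, so differences on an orthonormal basis of W control the distance
  between the points of V and V' above any vector of W. The argument is symmetric, which supplies
  both hypotheses of \<open>gr_dist_le\<close>.\<close>

lemma gr_dist_le_of_lifts:
  assumes V: "near V" "near V'" and B: "finite B" "B \<subseteq> W" "card B \<le> D"
    and ON: "\<forall>b\<in>B. \<forall>c\<in>B. b \<bullet> c = (if b = c then 1 else 0)" and sp: "W \<subseteq> span B"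
    and \<epsilon>: "0 \<le> \<epsilon>" and le: "\<And>b. b \<in> B \<Longrightarrow> norm (lift V b - lift V' b) \<le> \<epsilon>"
  shows "gr_dist V V' \<le> 2 * (D * \<epsilon>)"
proof -
  have one: "\<exists>w\<in>V2. norm (v - w) \<le> D * \<epsilon> * norm v"
    if V1: "near V1" "near V2" and v: "v \<in> V1" and le: "\<And>b. b \<in> B \<Longrightarrow> norm (lift V1 b - lift V2 b) \<le> \<epsilon>" for V1 V2 v
  proof
    let ?p = "orth_proj W v"
    have p: "?p \<in> W" by (rule orth_proj(1)[OF subW])
    show "lift V2 ?p \<in> V2" by (rule lift_mem[OF V1(2) p])
    have ex: "?p = (\<Sum>b\<in>B. (?p \<bullet> b) *\<^sub>R b)" using orthonormal_expand[OF B(1) ON] p sp by auto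
    have "v - lift V2 ?p = lift V1 ?p - lift V2 ?p" using lift_eq[OF V1(1) v] by simp
    also have "\<dots> = (\<Sum>b\<in>B. (?p \<bullet> b) *\<^sub>R (lift V1 b - lift V2 b))"
      by (subst (1 2) ex) (simp add: lift_sum[OF V1(1) B(1,2)] lift_sum[OF V1(2) B(1,2)] scaleR_diff_right sum_subtractf)
    also have "norm \<dots> \<le> (\<Sum>b\<in>B. norm v * \<epsilon>)"
    proof (rule order_trans[OF norm_sum sum_mono])
      fix b assume b: "b \<in> B"
      have "norm b = 1" using ON b by (simp add: norm_eq_1)
      then have "\<bar>?p \<bullet> b\<bar> \<le> norm v"
        using Cauchy_Schwarz_ineq2[of ?p b] norm_orth_proj_le[OF subW, of v] by simp
      then show "norm ((?p \<bullet> b) *\<^sub>R (lift V1 b - lift V2 b)) \<le> norm v * \<epsilon>"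
        using le[OF b] by (simp add: mult_mono)
    qed
    also have "\<dots> \<le> D * \<epsilon> * norm v"
      using B(3) \<epsilon> mult_right_mono[of "real (card B)" D "norm v * \<epsilon>"] by (simp add: mult_ac)
    finally show "norm (v - lift V2 ?p) \<le> D * \<epsilon> * norm v" .
  qed
  have "0 \<le> real D * \<epsilon>" using \<epsilon> by simp
  then show ?thesis
    using one[OF V _ le] one[OF V(2,1)] le
    by (intro gr_dist_le near_subspace V) (auto simp: norm_minus_commute)
qed


text \<open>If \<open>e\<close> is \<open>\<delta>\<close>-close to \<open>V\<close> then \<open>lift V\<close> is already determined up to \<open>O(\<delta>)\<close> on the
  direction \<open>b\<^sub>1\<close> of \<open>P\<^sub>W e\<close>. So only the other \<open>k - 1\<close> basis vectors of \<open>W\<close> contribute factors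
  \<open>1 / \<delta>\<close> to the number of codes.\<close>

lemma card_near_containing_le:
  assumes k: "1 \<le> k" and \<delta>: "0 < \<delta>" "\<delta> \<le> 1/4" and e: "norm e = 1"
    and P: "finite P" "\<And>V. V \<in> P \<Longrightarrow> near V" "\<And>V. V \<in> P \<Longrightarrow> norm (e - orth_proj V e) \<le> \<delta>"
    and sep: "\<And>V V'. V \<in> P \<Longrightarrow> V' \<in> P \<Longrightarrow> V \<noteq> V' \<Longrightarrow> \<delta> \<le> gr_dist V V'"
  shows "card P \<le> (120 * (real DIM('a))\<^sup>2) ^ DIM('a) * (30 * (real DIM('a))\<^sup>2 / \<delta>) ^ ((k - 1) * (DIM('a) - k))"
proof (cases "P = {}")
  case False
  define d where "d = real DIM('a)"
  have d: "1 \<le> d" unfolding d_def using DIM_positive[where 'a='a] by linarith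
  then have d2: "1 \<le> d\<^sup>2" by (simp add: one_le_power)
  define x0 where "x0 = orth_proj W e"
  have x0W: "x0 \<in> W" unfolding x0_def by (rule orth_proj(1)[OF subW])
  \<comment> \<open>The unit vector e loses at most \<delta> \<le> 1/4 on the way to V and at most
    1/2 from there to W.\<close>
  have x0: "1/4 \<le> norm x0"
  proof -
    obtain V where V: "V \<in> P" using False by blast
    have "norm (orth_proj V e - orth_proj W e) \<le> 1/2" using P(2)[OF V, unfolded near_def, THEN conjunct2, THEN spec, of e] e by simp
    moreover have "norm e \<le> norm (e - orth_proj V e) + norm (orth_proj V e - orth_proj W e) + norm x0"
      unfolding x0_def by norm
    ultimately show ?thesis using P(3)[OF V] e \<delta> by linarith
  qed
  define b1 where "b1 = x0 /\<^sub>R norm x0"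
  have b1: "b1 \<bullet> b1 = 1" "b1 \<in> W" "norm b1 = 1" "x0 = norm x0 *\<^sub>R b1"
  proof -
    have nz: "norm x0 \<noteq> 0" using x0 by linarith
    then show "b1 \<bullet> b1 = 1" "norm b1 = 1" "x0 = norm x0 *\<^sub>R b1"
      by (simp_all add: b1_def dot_square_norm power2_eq_square)
    show "b1 \<in> W" using x0W subW by (simp add: b1_def subspace_scale)
  qed
  define W' where "W' = {y \<in> W. \<forall>x\<in>span {b1}. orthogonal x y}"
  have subW': "subspace W'"
    using subspace_inter[OF subW subspace_orthogonal_to_vectors[of "span {b1}"]] by (simp add: W'_def Int_def)
  have "span {b1} \<subseteq> W" using b1(2) subW by (simp add: span_minimal)
  then have "dim W' + dim (span {b1}) = k"
    unfolding W'_def using dim_subspace_orthogonal_to_vectors[OF subspace_span subW, of "{b1}"] dimW by (simp only: mp)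
  moreover have "dim {b1} = 1" using b1(3) dim_singleton[of b1] by (auto split: if_splits)
  ultimately have dimW': "dim W' = k - 1" by (simp add: dim_span)
  obtain B' where B': "finite B'" "B' \<subseteq> W'" "\<forall>b\<in>B'. \<forall>c\<in>B'. b \<bullet> c = (if b = c then 1 else 0)"
    "card B' = k - 1" "span B' = W'"
    using obtain_orthonormal_basis[OF subW'] dimW' by auto
  have perp: "b1 \<bullet> b = 0" if "b \<in> B'" for b
  proof -
    have "b \<in> W'" using that B'(2) by blast
    then have "orthogonal b1 b" using span_base[of b1 "{b1}"] by (simp add: W'_def)
    then show ?thesis by (simp add: orthogonal_def)
  qed
  then have b1B': "b1 \<notin> B'" using b1(1) by fastforce
  define B where "B = insert b1 B'"
  have B: "finite B" "B \<subseteq> W" "card B \<le> DIM('a)"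
  proof -
    show "finite B" "B \<subseteq> W" using B'(1,2) b1(2) by (auto simp: B_def W'_def)
    have "card B = k" using B'(1,4) b1B' k by (simp add: B_def)
    then show "card B \<le> DIM('a)" using dimW dim_subset_UNIV[of W] by simp
  qed
  have ON: "\<forall>b\<in>B. \<forall>c\<in>B. b \<bullet> c = (if b = c then 1 else 0)"
    using B'(3) b1(1) perp b1B' by (auto simp: B_def inner_commute)
  have sp: "W \<subseteq> span B"
  proof
    fix b assume b: "b \<in> W"
    have "b - (b \<bullet> b1) *\<^sub>R b1 \<in> W" using b b1(2) subW by (simp add: subspace_diff subspace_scale)
    moreover have "orthogonal x (b - (b \<bullet> b1) *\<^sub>R b1)" if "x \<in> span {b1}" for x
      using that b1(1) by (auto simp: span_singleton orthogonal_def inner_diff_right inner_commute)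
    ultimately have "b - (b \<bullet> b1) *\<^sub>R b1 \<in> span B'" using B'(5) by (simp add: W'_def)
    then have "b - (b \<bullet> b1) *\<^sub>R b1 \<in> span B" using span_mono[of B' B] by (auto simp: B_def)
    moreover have "(b \<bullet> b1) *\<^sub>R b1 \<in> span B" by (intro span_scale span_base) (simp add: B_def)
    ultimately show "b \<in> span B" using span_add by fastforce
  qed
  define Wp where "Wp = {y. \<forall>x\<in>W. orthogonal x y}"
  have subWp: "subspace Wp" unfolding Wp_def by (rule subspace_orthogonal_to_vectors)
  have dimWp: "dim Wp = DIM('a) - k"
    using dim_subspace_orthogonal_to_vectors[OF subW subspace_UNIV] dimW by (simp add: Wp_def)
  obtain C where C: "finite C" "C \<subseteq> Wp" "\<forall>b\<in>C. \<forall>c\<in>C. b \<bullet> c = (if b = c then 1 else 0)"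
    "card C = DIM('a) - k" "span C = Wp"
    using obtain_orthonormal_basis[OF subWp] dimWp by auto
  have cardC: "real (card C) \<le> d" using C(4) by (simp add: d_def)
  have normC: "norm c = 1" if "c \<in> C" for c using C(3) that by (simp add: norm_eq_1)
  have WpC: "norm y \<le> d * t" if y: "y \<in> Wp" and t: "\<And>c. c \<in> C \<Longrightarrow> \<bar>y \<bullet> c\<bar> \<le> t" "0 \<le> t" for y t
  proof -
    have "norm y = norm (\<Sum>c\<in>C. (y \<bullet> c) *\<^sub>R c)"
      using orthonormal_expand[OF C(1,3), of y] y C(5) by simp
    also have "\<dots> \<le> (\<Sum>c\<in>C. t)"
      by (rule order_trans[OF norm_sum sum_mono]) (simp add: normC t)
    also have "\<dots> \<le> d * t" using cardC t(2) by (simp add: mult_right_mono)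
    finally show ?thesis .
  qed
  \<comment> \<open>The resolution of the code: equal codes put lifts of basis vectors within d h,
    hence the planes within 2 d (d h) = \<delta> / 2, below their separation.\<close>
  define h where "h = \<delta> / (4 * d\<^sup>2)"
  have h: "0 < h" using \<delta> d by (simp add: h_def)
  \<comment> \<open>Codes over b1 are taken relative to e / |x0|, near which the lift of b1 must lie
    for every plane in P. This is where the factors 1 / \<delta> are saved.\<close>
  define tt where "tt = (\<lambda>p. if p = b1 then e /\<^sub>R norm x0 else 0)"
  define code where "code = (\<lambda>V. restrict (\<lambda>(p, c). \<lfloor>(lift V p - tt p) \<bullet> c / h\<rfloor>) (B \<times> C))"
  define m0 where "m0 = \<lceil>48 * d\<^sup>2\<rceil>"
  define m1 where "m1 = \<lceil>8 * d\<^sup>2 / \<delta>\<rceil>"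
  have floor_mem: "\<lfloor>x\<rfloor> \<in> {-\<lceil>y\<rceil>..\<lceil>y\<rceil>}" if "\<bar>x\<bar> \<le> y" for x y :: real
    using that by (auto simp: abs_le_iff le_floor_iff floor_le_iff) linarith+
  \<comment> \<open>P_V e is within \<delta> of e, so its projection to W is within \<delta> of x0,
    and lifting at most doubles this. Together that is 3 \<delta> for the lift of x0, and 12
    \<delta> after division by |x0| \<ge> 1/4.\<close>
  have l1: "norm (lift V b1 - e /\<^sub>R norm x0) \<le> 12 * \<delta>" if V: "V \<in> P" for V
  proof -
    note nV = P(2)[OF V]
    let ?u = "orth_proj V e"
    have uV: "?u \<in> V" by (rule orth_proj(1)[OF near_subspace[OF nV]])
    have m: "orth_proj W ?u - x0 \<in> W" using orth_proj(1)[OF subW] x0W subW by (simp add: subspace_diff)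
    have "norm (orth_proj W ?u - x0) \<le> \<delta>"
    proof -
      have "orth_proj W ?u - x0 = orth_proj W (?u - e)" by (simp add: x0_def linear_diff[OF linear_orth_proj[OF subW]])
      then show ?thesis using norm_orth_proj_le[OF subW, of "?u - e"] P(3)[OF V] by (simp add: norm_minus_commute)
    qed
    then have "norm (lift V (orth_proj W ?u - x0)) \<le> 2 * \<delta>" using norm_lift[OF nV m] by linarith
    moreover have "?u = lift V x0 + lift V (orth_proj W ?u - x0)"
      using lift_add[OF nV x0W m] lift_eq[OF nV uV] by simp
    then have "lift V x0 - e = (?u - e) - lift V (orth_proj W ?u - x0)"
      by (metis add_diff_cancel_right' diff_diff_eq diff_diff_add add.commute)
    then have "norm (lift V x0 - e) \<le> norm (?u - e) + norm (lift V (orth_proj W ?u - x0))"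
      by (simp only: norm_triangle_ineq4)
    ultimately have "norm (lift V x0 - e) \<le> 3 * \<delta>"
      using P(3)[OF V] norm_minus_commute[of ?u e] by linarith
    moreover have "lift V x0 = norm x0 *\<^sub>R lift V b1"
      using lift_scale[OF nV b1(2), of "norm x0"] b1(4) by simp
    then have "norm (norm x0 *\<^sub>R (lift V b1 - e /\<^sub>R norm x0)) \<le> 3 * \<delta>"
    proof -
      have "norm x0 \<noteq> 0" using x0 by linarith
      then have "norm x0 *\<^sub>R (lift V b1 - e /\<^sub>R norm x0) = norm x0 *\<^sub>R lift V b1 - e"
        by (simp add: scaleR_diff_right)
      then show ?thesis using \<open>norm (lift V x0 - e) \<le> 3 * \<delta>\<close> \<open>lift V x0 = norm x0 *\<^sub>R lift V b1\<close> by simp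
    qed
    then have "norm x0 * norm (lift V b1 - e /\<^sub>R norm x0) \<le> 3 * \<delta>" by simp
    moreover have "1/4 * norm (lift V b1 - e /\<^sub>R norm x0) \<le> norm x0 * norm (lift V b1 - e /\<^sub>R norm x0)"
      using x0 by (intro mult_right_mono) auto
    ultimately show ?thesis by linarith
  qed
  define R where "R = (\<lambda>(p, c::'a). if p = b1 then {-m0..m0} else {-m1..m1})"
  have codeR: "code V \<in> PiE (B \<times> C) R" if V: "V \<in> P" for V
  proof -
    have "\<lfloor>(lift V p - tt p) \<bullet> c / h\<rfloor> \<in> R (p, c)" if p: "p \<in> B" and c: "c \<in> C" for p c
    proof (cases "p = b1")
      case True
      have "\<bar>(lift V p - tt p) \<bullet> c\<bar> \<le> 12 * \<delta>"
        using Cauchy_Schwarz_ineq2[of "lift V p - tt p" c] l1[OF V] normC[OF c] True by (simp add: tt_def)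
      then have "\<bar>(lift V p - tt p) \<bullet> c / h\<bar> \<le> 12 * \<delta> / h" using h by (simp add: divide_right_mono)
      also have "\<dots> = 48 * d\<^sup>2" using \<delta> d by (simp add: h_def)
      finally have "\<lfloor>(lift V p - tt p) \<bullet> c / h\<rfloor> \<in> {-m0..m0}" unfolding m0_def by (rule floor_mem)
      then show ?thesis using True by (simp add: R_def)
    next
      case False
      have "norm p = 1" using ON p by (simp add: norm_eq_1)
      then have "norm (lift V p) \<le> 2" using norm_lift[OF P(2)[OF V], of p] p B(2) by auto
      then have "\<bar>(lift V p - tt p) \<bullet> c\<bar> \<le> 2"
        using Cauchy_Schwarz_ineq2[of "lift V p" c] normC[OF c] False by (simp add: tt_def)
      then have "\<bar>(lift V p - tt p) \<bullet> c / h\<bar> \<le> 2 / h" using h by (simp add: divide_right_mono)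
      also have "\<dots> = 8 * d\<^sup>2 / \<delta>" using \<delta> d by (simp add: h_def)
      finally have "\<lfloor>(lift V p - tt p) \<bullet> c / h\<rfloor> \<in> {-m1..m1}" unfolding m1_def by (rule floor_mem)
      then show ?thesis using False by (simp add: R_def)
    qed
    then show ?thesis by (auto simp: code_def)
  qed
  have inj: "inj_on code P"
  proof (rule inj_onI, rule ccontr)
    fix V V' assume VV: "V \<in> P" "V' \<in> P" "code V = code V'" "V \<noteq> V'"
    note nV = P(2)[OF VV(1)] and nV' = P(2)[OF VV(2)]
    have "norm (lift V p - lift V' p) \<le> d * h" if p: "p \<in> B" for p
    proof (rule WpC)
      have pW: "p \<in> W" using p B(2) by blast
      have "orth_proj W (lift V p - lift V' p) = 0"
        using lift_proj[OF nV pW] lift_proj[OF nV' pW] by (simp add: linear_diff[OF linear_orth_proj[OF subW]])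
      then show "lift V p - lift V' p \<in> Wp"
        using orth_proj_perp[OF subW, of _ "lift V p - lift V' p"] by (auto simp: Wp_def orthogonal_def inner_commute)
      show "\<bar>(lift V p - lift V' p) \<bullet> c\<bar> \<le> h" if c: "c \<in> C" for c
      proof -
        have "\<lfloor>(lift V p - tt p) \<bullet> c / h\<rfloor> = \<lfloor>(lift V' p - tt p) \<bullet> c / h\<rfloor>"
          using fun_cong[OF VV(3), of "(p, c)"] p c by (simp add: code_def)
        then have "\<bar>(lift V p - tt p) \<bullet> c / h - (lift V' p - tt p) \<bullet> c / h\<bar> \<le> 1" by linarith
        moreover have "(lift V p - tt p) \<bullet> c / h - (lift V' p - tt p) \<bullet> c / h = (lift V p - lift V' p) \<bullet> c / h"
          by (simp add: inner_diff_left diff_divide_distrib)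
        ultimately show ?thesis using h by (simp add: field_simps)
      qed
    qed (use h in simp)
    then have "gr_dist V V' \<le> 2 * (real DIM('a) * (d * h))"
      using d h by (intro gr_dist_le_of_lifts[OF nV nV' B ON sp]) auto
    also have "\<dots> = \<delta> / 2" using d by (simp add: h_def d_def power2_eq_square)
    finally show False using sep[OF VV(1,2,4)] \<delta> by linarith
  qed
  have fin: "finite (PiE (B \<times> C) R)" using B(1) C(1) by (intro finite_PiE) (auto simp: R_def)
  have "card P = card (code ` P)" using inj by (simp add: card_image)
  also have "\<dots> \<le> card (PiE (B \<times> C) R)" using codeR by (intro card_mono fin) auto
  also have "\<dots> = (\<Prod>x\<in>B \<times> C. card (R x))" using B(1) C(1) by (intro card_PiE) auto
  also have "\<dots> = (\<Prod>p\<in>B. \<Prod>c\<in>C. card (R (p, c)))" by (simp add: prod.cartesian_product)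
  \<comment> \<open>The vector b1 contributes d - k coordinates with O(1) values, each of the other
    k - 1 basis vectors d - k coordinates with O(1 / \<delta>) values.\<close>
  also have "\<dots> = card {-m0..m0} ^ (DIM('a) - k) * (card {-m1..m1} ^ (DIM('a) - k)) ^ (k - 1)"
  proof -
    have "(\<Prod>p\<in>B'. \<Prod>c\<in>C. card (R (p, c))) = (\<Prod>p\<in>B'. card {-m1..m1} ^ (DIM('a) - k))"
      using b1B' C(4) by (intro prod.cong refl) (auto simp: R_def)
    then show ?thesis unfolding B_def using B'(1,4) b1B' C(4) by (simp add: R_def)
  qed
  finally have "real (card P) \<le> real (card {-m0..m0}) ^ (DIM('a) - k) * real (card {-m1..m1}) ^ ((DIM('a) - k) * (k - 1))"
    by (simp add: power_mult flip: of_nat_power of_nat_mult)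
  also have "\<dots> \<le> (120 * d\<^sup>2) ^ DIM('a) * (30 * d\<^sup>2 / \<delta>) ^ ((k - 1) * (DIM('a) - k))"
  proof (rule mult_mono)
    have "0 \<le> m0" unfolding m0_def using d2 by simp
    then have "real (card {-m0..m0}) = 2 * of_int m0 + 1" by simp
    also have "\<dots> \<le> 120 * d\<^sup>2" unfolding m0_def using d2 by linarith
    finally have "real (card {-m0..m0}) ^ (DIM('a) - k) \<le> (120 * d\<^sup>2) ^ (DIM('a) - k)" by (intro power_mono) auto
    also have "\<dots> \<le> (120 * d\<^sup>2) ^ DIM('a)" using d2 by (intro power_increasing) auto
    finally show "real (card {-m0..m0}) ^ (DIM('a) - k) \<le> (120 * d\<^sup>2) ^ DIM('a)" .
    have big: "1 \<le> d\<^sup>2 / \<delta>" using d2 \<delta> by (simp add: field_simps)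
    then have "0 \<le> m1" unfolding m1_def by simp
    then have "real (card {-m1..m1}) = 2 * of_int m1 + 1" by simp
    also have "\<dots> \<le> 30 * d\<^sup>2 / \<delta>" unfolding m1_def using big by linarith
    finally have "real (card {-m1..m1}) ^ ((k - 1) * (DIM('a) - k)) \<le> (30 * d\<^sup>2 / \<delta>) ^ ((k - 1) * (DIM('a) - k))"
      by (intro power_mono) auto
    then show "real (card {-m1..m1}) ^ ((DIM('a) - k) * (k - 1)) \<le> (30 * d\<^sup>2 / \<delta>) ^ ((k - 1) * (DIM('a) - k))"
      by (simp only: mult.commute[of "DIM('a) - k"])
  qed (use d in auto)
  finally show ?thesis unfolding d_def .
qed (use \<delta> in auto)

end

text \<open>Being within distance 1 of z, where |z| \<ge> 1 / \<delta>, means being within \<delta>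
  of the unit vector z / |z|. The count in one chart then applies, and finitely many charts cover
  the Grassmannian.\<close>

lemma card_containing_le:
  fixes k :: nat
  assumes k: "1 \<le> k"
  shows "\<exists>N\<ge>0. \<forall>\<delta>. 0 < \<delta> \<longrightarrow> \<delta> \<le> 1/4 \<longrightarrow> (\<forall>z::'a::euclidean_space. 1 / \<delta> \<le> norm z \<longrightarrow>
    (\<forall>P. finite P \<longrightarrow> P \<subseteq> grassmannian k \<longrightarrow> (\<forall>V\<in>P. \<forall>V'\<in>P. V \<noteq> V' \<longrightarrow> \<delta> \<le> gr_dist V V') \<longrightarrow>
      card {V \<in> P. norm (z - orth_proj V z) \<le> 1} \<le> N * (1 / \<delta>) ^ ((k - 1) * (DIM('a) - k))))"
proof -
  obtain F where F: "finite F" "F \<subseteq> grassmannian k"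
    "\<forall>V\<in>grassmannian k. \<exists>W\<in>F. \<forall>x::'a. norm (orth_proj V x - orth_proj W x) \<le> 1/2 * norm x"
    using grassmannian_half_net[of k, where 'a='a] by blast
  let ?d = "real DIM('a)" and ?K = "(k - 1) * (DIM('a) - k)"
  define N0 where "N0 = (120 * ?d\<^sup>2) ^ DIM('a) * (30 * ?d\<^sup>2) ^ ?K"
  have "card {V \<in> P. norm (z - orth_proj V z) \<le> 1} \<le> (card F * N0) * (1 / \<delta>) ^ ?K"
    if \<delta>: "0 < \<delta>" "\<delta> \<le> 1/4" and z: "1 / \<delta> \<le> norm z" and P: "finite P" "P \<subseteq> grassmannian k"
      and sep: "\<forall>V\<in>P. \<forall>V'\<in>P. V \<noteq> V' \<longrightarrow> \<delta> \<le> gr_dist V V'" for \<delta> and z :: 'a and P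
  proof -
    define Q where "Q = (\<lambda>W. {V \<in> P. norm (z - orth_proj V z) \<le> 1 \<and> (\<forall>x. norm (orth_proj V x - orth_proj W x) \<le> 1/2 * norm x)})"
    have nz: "0 < norm z" using z \<delta> by (metis less_le_trans zero_less_divide_1_iff)
    have "{V \<in> P. norm (z - orth_proj V z) \<le> 1} \<subseteq> (\<Union>W\<in>F. Q W)"
      using P(2) F(3) unfolding Q_def by blast
    then have "card {V \<in> P. norm (z - orth_proj V z) \<le> 1} \<le> card (\<Union>W\<in>F. Q W)"
      using F(1) P(1) by (intro card_mono) (auto simp: Q_def)
    also have "\<dots> \<le> (\<Sum>W\<in>F. card (Q W))" by (rule card_UN_le[OF F(1)])
    finally have "real (card {V \<in> P. norm (z - orth_proj V z) \<le> 1}) \<le> (\<Sum>W\<in>F. real (card (Q W)))"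
      by (simp flip: of_nat_sum)
    also have "\<dots> \<le> (\<Sum>W\<in>F. N0 * (1 / \<delta>) ^ ?K)"
    proof (rule sum_mono)
      fix W assume W: "W \<in> F"
      interpret graph_chart W k by unfold_locales (use W F(2) in blast)
      have "real (card (Q W)) \<le> (120 * ?d\<^sup>2) ^ DIM('a) * (30 * ?d\<^sup>2 / \<delta>) ^ ?K"
      proof (rule card_near_containing_le[OF k \<delta>])
        show "norm (z /\<^sub>R norm z) = 1" using nz by simp
        show "finite (Q W)" using P(1) by (simp add: Q_def)
        show "near V" if "V \<in> Q W" for V using that P(2) by (auto simp: Q_def near_def)
        show "norm (z /\<^sub>R norm z - orth_proj V (z /\<^sub>R norm z)) \<le> \<delta>" if "V \<in> Q W" for V
        proof -
          have V: "subspace V" using that P(2) by (auto simp: Q_def grassmannian_def)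
          have "z /\<^sub>R norm z - orth_proj V (z /\<^sub>R norm z) = (z - orth_proj V z) /\<^sub>R norm z"
            by (simp add: linear_cmul[OF linear_orth_proj[OF V]] scaleR_diff_right)
          then have "norm (z /\<^sub>R norm z - orth_proj V (z /\<^sub>R norm z)) = norm (z - orth_proj V z) / norm z"
            by (simp add: divide_inverse_commute)
          also have "\<dots> \<le> 1 / norm z"
            using that by (intro divide_right_mono) (auto simp: Q_def)
          also have "\<dots> \<le> \<delta>" using z \<delta> nz by (simp add: field_simps)
          finally show ?thesis .
        qed
        show "\<delta> \<le> gr_dist V V'" if "V \<in> Q W" "V' \<in> Q W" "V \<noteq> V'" for V V'
          using that sep by (auto simp: Q_def)
      qed
      also have "\<dots> = N0 * (1 / \<delta>) ^ ?K" by (simp add: N0_def power_divide)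
      finally show "real (card (Q W)) \<le> N0 * (1 / \<delta>) ^ ?K" .
    qed
    finally show ?thesis by simp
  qed
  moreover have "0 \<le> real (card F) * N0" by (simp add: N0_def)
  ultimately show ?thesis by blast
qed

section \<open>The exceptional set\<close>

lemma ennreal_powr_le:
  assumes "x \<le> ennreal r" "0 \<le> r" "0 \<le> t" shows "ennreal_powr x t \<le> ennreal (r powr t)"
proof -
  have "x \<noteq> top" using assms(1) by (auto simp: top_unique)
  moreover have "enn2real x \<le> r" using enn2real_mono[OF assms(1)] assms(2) by simp
  ultimately show ?thesis using assms(3) by (simp add: ennreal_powr_def ennreal_leI powr_mono2)
qed

text \<open>The sizes of separated subsets are bounded, so one of largest cardinality exists; a
  point at distance at least r from all of it could be added.\<close>

lemma maximal_separated_subset: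
  fixes \<rho> :: "'m \<Rightarrow> 'm \<Rightarrow> real" and C r :: real
  assumes bd: "\<And>P. finite P \<Longrightarrow> P \<subseteq> F \<Longrightarrow> (\<forall>V\<in>P. \<forall>W\<in>P. V \<noteq> W \<longrightarrow> r \<le> \<rho> V W) \<Longrightarrow> card P \<le> C"
    and sym: "\<And>V W. V \<in> F \<Longrightarrow> W \<in> F \<Longrightarrow> \<rho> V W = \<rho> W V" and refl: "\<And>V. V \<in> F \<Longrightarrow> \<rho> V V < r"
  obtains P where "finite P" "P \<subseteq> F" "card P \<le> C" "\<And>W. W \<in> F \<Longrightarrow> \<exists>V\<in>P. \<rho> V W < r"
proof -
  define S where "S = {P. finite P \<and> P \<subseteq> F \<and> (\<forall>V\<in>P. \<forall>W\<in>P. V \<noteq> W \<longrightarrow> r \<le> \<rho> V W)}"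
  have "card ` S \<subseteq> {..nat \<lfloor>C\<rfloor>}"
  proof clarify
    fix P assume "P \<in> S"
    then have "real (card P) \<le> C" by (intro bd) (simp_all add: S_def)
    then show "card P \<le> nat \<lfloor>C\<rfloor>" by (rule le_nat_floor)
  qed
  then have fin: "finite (card ` S)" by (rule finite_subset) simp
  have "{} \<in> S" by (simp add: S_def)
  then have ne: "card ` S \<noteq> {}" by blast
  obtain P where P: "P \<in> S" "card P = Max (card ` S)" using Max_in[OF fin ne] by auto
  have "\<exists>V\<in>P. \<rho> V W < r" if W: "W \<in> F" for W
  proof (rule ccontr)
    assume "\<not> ?thesis"
    then have far: "\<And>V. V \<in> P \<Longrightarrow> r \<le> \<rho> V W" by (simp add: not_less)
    then have nW: "W \<notin> P" using refl[OF W] by force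
    have P': "finite P" "P \<subseteq> F" "\<forall>V\<in>P. \<forall>W\<in>P. V \<noteq> W \<longrightarrow> r \<le> \<rho> V W" using P(1) by (simp_all add: S_def)
    have "r \<le> \<rho> W V" if "V \<in> P" for V using far[OF that] sym[OF W, of V] P'(2) that by auto
    then have "insert W P \<in> S" using P' W far unfolding S_def by blast
    then have "card (insert W P) \<le> card P" unfolding P(2) using fin by (intro Max_ge) auto
    then show False using nW P(1) by (simp add: S_def)
  qed
  moreover have "finite P" "P \<subseteq> F" "real (card P) \<le> C" using P(1) bd[of P] by (simp_all add: S_def)
  ultimately show thesis using that by blast
qed

text \<open>A Borel-Cantelli argument for covers. E lies in every tail union of the F i, maximal
  separated sets cover F i by at most C 2 ^ (b i) balls of radius 2 ^ - i, and for b < \<tau> the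
  corresponding sums of diameters to the power \<tau> are tails of a geometric series.\<close>

lemma hausdorff_measure_limsup_eq_0:
  fixes \<rho> :: "'m \<Rightarrow> 'm \<Rightarrow> real" and C b \<tau> :: real
  assumes sym: "\<And>V W. V \<in> G \<Longrightarrow> W \<in> G \<Longrightarrow> \<rho> V W = \<rho> W V" and refl: "\<And>V. V \<in> G \<Longrightarrow> \<rho> V V = 0"
    and tri: "\<And>U V W. U \<in> G \<Longrightarrow> V \<in> G \<Longrightarrow> W \<in> G \<Longrightarrow> \<rho> U W \<le> \<rho> U V + \<rho> V W"
    and F: "\<And>i. F i \<subseteq> G" and E: "\<And>V i0. V \<in> E \<Longrightarrow> \<exists>i\<ge>i0. V \<in> F i"
    and C: "0 \<le> C" and bd: "\<And>i P. i1 \<le> i \<Longrightarrow> finite P \<Longrightarrow> P \<subseteq> F i \<Longrightarrow>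
      (\<forall>V\<in>P. \<forall>W\<in>P. V \<noteq> W \<longrightarrow> (1/2) ^ i \<le> \<rho> V W) \<Longrightarrow> card P \<le> C * 2 powr (b * i)"
    and \<tau>: "0 < \<tau>" "b < \<tau>"
  shows "hausdorff_measure \<rho> \<tau> E = 0"
proof -
  have "hausdorff_premeasure \<rho> \<tau> \<delta> E \<le> ennreal \<epsilon>" if \<delta>: "0 < \<delta>" and \<epsilon>: "0 < \<epsilon>" for \<delta> \<epsilon>
  proof -
    define q where "q = 2 powr (b - \<tau>)"
    have q: "0 < q" "q < 1" using \<tau> by (auto simp: q_def powr_less_one)
    define D where "D = C * 2 powr \<tau> / (1 - q)"
    have D: "0 \<le> D" using C q by (simp add: D_def)
    obtain n1 where n1: "q ^ n1 < \<epsilon> / (D + 1)" using real_arch_pow_inv[of "\<epsilon> / (D + 1)" q] q \<epsilon> D by auto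
    obtain n2 where n2: "(1/2) ^ n2 < \<delta> / 2" using real_arch_pow_inv[of "\<delta> / 2" "1/2"] \<delta> by auto
    define i0 where "i0 = max i1 (max n1 n2)"
    have i0: "i1 \<le> i0" "q ^ i0 \<le> \<epsilon> / (D + 1)" "2 * (1/2) ^ i0 \<le> \<delta>"
    proof -
      show "i1 \<le> i0" by (simp add: i0_def)
      have "q ^ i0 \<le> q ^ n1" using q by (intro power_decreasing) (auto simp: i0_def)
      then show "q ^ i0 \<le> \<epsilon> / (D + 1)" using n1 by simp
      have "(1/2::real) ^ i0 \<le> (1/2) ^ n2" by (intro power_decreasing) (auto simp: i0_def)
      then show "2 * (1/2) ^ i0 \<le> \<delta>" using n2 by linarith
    qed
    have "\<exists>P. finite P \<and> P \<subseteq> F i \<and> card P \<le> C * 2 powr (b * i) \<and> (\<forall>W\<in>F i. \<exists>V\<in>P. \<rho> V W < (1/2) ^ i)" if i: "i0 \<le> i" for i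
    proof -
      obtain P where "finite P" "P \<subseteq> F i" "card P \<le> C * 2 powr (b * i)" "\<And>W. W \<in> F i \<Longrightarrow> \<exists>V\<in>P. \<rho> V W < (1/2) ^ i"
      proof (rule maximal_separated_subset[of "F i" "(1/2) ^ i" \<rho> "C * 2 powr (b * i)"])
        show "card P \<le> C * 2 powr (b * i)" if "finite P" "P \<subseteq> F i" "\<forall>V\<in>P. \<forall>W\<in>P. V \<noteq> W \<longrightarrow> (1/2) ^ i \<le> \<rho> V W" for P
          using bd[OF _ that] i i0(1) by simp
        show "\<rho> V W = \<rho> W V" if "V \<in> F i" "W \<in> F i" for V W using sym F that by blast
        show "\<rho> V V < (1/2) ^ i" if "V \<in> F i" for V using refl[OF subsetD[OF F that]] by simp
      qed blast
      then show ?thesis by blast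
    qed
    then obtain P where P: "\<And>i. i0 \<le> i \<Longrightarrow> finite (P i)" "\<And>i. i0 \<le> i \<Longrightarrow> P i \<subseteq> F i"
      "\<And>i. i0 \<le> i \<Longrightarrow> card (P i) \<le> C * 2 powr (b * i)" "\<And>i W. i0 \<le> i \<Longrightarrow> W \<in> F i \<Longrightarrow> \<exists>V\<in>P i. \<rho> V W < (1/2) ^ i"
      by metis
    have "\<exists>e. bij_betw e {..<card (P i)} (P i)" if "i0 \<le> i" for i
      using ex_bij_betw_nat_finite[OF P(1)[OF that]] by (auto simp: atLeast0LessThan)
    then obtain e where e: "\<And>i. i0 \<le> i \<Longrightarrow> bij_betw (e i) {..<card (P i)} (P i)" by metis
    \<comment> \<open>Balls are cut down to F i because \<open>\<rho>\<close> is known to behave as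
      a metric only on G. Indices beyond the number of centres give the empty set, which contributes
      nothing to the sum, so a double sequence of sets results.\<close>
    define U where "U = (\<lambda>(i', m). let i = i0 + i' in
       if m < card (P i) then {W \<in> F i. \<rho> (e i m) W < (1/2) ^ i} else {})"
    have dU: "ediam \<rho> (U (i', m)) \<le> ennreal (2 * (1/2) ^ (i0 + i'))" for i' m
      unfolding ediam_def
    proof (intro SUP_least ennreal_leI)
      fix V W assume "V \<in> U (i', m)" "W \<in> U (i', m)"
      then have m: "m < card (P (i0 + i'))" and VW: "V \<in> F (i0 + i')" "W \<in> F (i0 + i')"
        "\<rho> (e (i0 + i') m) V < (1/2) ^ (i0 + i')" "\<rho> (e (i0 + i') m) W < (1/2) ^ (i0 + i')"
        by (auto simp: U_def Let_def split: if_splits)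
      have "e (i0 + i') m \<in> P (i0 + i')" using e[of "i0 + i'"] m by (auto simp: bij_betw_def)
      then have c: "e (i0 + i') m \<in> G" using P(2)[of "i0 + i'"] F by auto
      have VG: "V \<in> G" "W \<in> G" using VW F by auto
      show "\<rho> V W \<le> 2 * (1/2) ^ (i0 + i')"
        using tri[OF VG(1) c VG(2)] sym[OF VG(1) c] VW(3,4) by linarith
    qed
    have dU0: "ediam \<rho> (U (i', m)) = 0" if "\<not> m < card (P (i0 + i'))" for i' m
      using that by (simp add: U_def ediam_def bot_ennreal)
    have cov: "E \<subseteq> (\<Union>n. U (prod_decode n))"
    proof
      fix W assume "W \<in> E"
      then obtain i where i: "i0 \<le> i" "W \<in> F i" using E by blast
      then obtain V where V: "V \<in> P i" "\<rho> V W < (1/2) ^ i" using P(4) by blast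
      have "V \<in> e i ` {..<card (P i)}" unfolding bij_betw_imp_surj_on[OF e[OF i(1)]] by (rule V(1))
      then obtain m where m: "m < card (P i)" "e i m = V" by auto
      have "W \<in> U (i - i0, m)" using i V m by (simp add: U_def)
      then have "W \<in> U (prod_decode (prod_encode (i - i0, m)))" by simp
      then show "W \<in> (\<Union>n. U (prod_decode n))" by blast
    qed
    let ?f = "\<lambda>p. ennreal_powr (ediam \<rho> (U p)) \<tau>"
    have "hausdorff_premeasure \<rho> \<tau> \<delta> E \<le> (\<Sum>n. ?f (prod_decode n))"
      unfolding hausdorff_premeasure_def
    proof (rule INF_lower2[of "\<lambda>n. U (prod_decode n)"])
      have "ediam \<rho> (U p) \<le> ennreal \<delta>" for p
      proof (cases p)
        case (Pair i' m)
        have "2 * (1/2::real) ^ (i0 + i') \<le> 2 * (1/2) ^ i0" by (intro mult_left_mono power_decreasing) auto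
        then have "ennreal (2 * (1/2) ^ (i0 + i')) \<le> ennreal \<delta>" using i0(3) by (intro ennreal_leI) linarith
        then show ?thesis using dU[of i' m] Pair by (metis order_trans)
      qed
      then show "(\<lambda>n. U (prod_decode n)) \<in> {U. E \<subseteq> (\<Union>i. U i) \<and> (\<forall>i. ediam \<rho> (U i) \<le> ennreal \<delta>)}"
        using cov by simp
    qed simp
    also have "\<dots> = (\<Sum>i'. \<Sum>m. ?f (i', m))"
      by (rule suminf_ennreal_2dimen) simp
    also have "\<dots> \<le> (\<Sum>i'. ennreal (C * 2 powr \<tau> * q ^ i0 * q ^ i'))"
    proof (rule suminf_le)
      fix i'
      let ?i = "i0 + i'"
      have "(\<Sum>m. ?f (i', m)) = (\<Sum>m\<in>{..<card (P ?i)}. ?f (i', m))"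
        by (rule suminf_finite) (auto simp: dU0 ennreal_powr_def \<tau>)
      also have "\<dots> \<le> (\<Sum>m\<in>{..<card (P ?i)}. ennreal ((2 * (1/2) ^ ?i) powr \<tau>))"
        using dU \<tau> by (intro sum_mono ennreal_powr_le) auto
      also have "\<dots> = ennreal (card (P ?i) * (2 * (1/2) ^ ?i) powr \<tau>)"
        by (simp add: ennreal_mult ennreal_of_nat_eq_real_of_nat)
      also have "\<dots> \<le> ennreal (C * 2 powr (b * ?i) * (2 * (1/2) ^ ?i) powr \<tau>)"
        using P(3)[of ?i] by (intro ennreal_leI mult_right_mono) auto
      also have "C * 2 powr (b * ?i) * (2 * (1/2) ^ ?i) powr \<tau> = C * 2 powr \<tau> * q ^ i0 * q ^ i'"
      proof -
        have "(2 * (1/2) ^ ?i) powr \<tau> = 2 powr \<tau> * 2 powr (- (\<tau> * ?i))"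
          by (simp add: powr_mult half_powr)
        moreover have "q ^ i0 * q ^ i' = 2 powr (b * ?i) * 2 powr (- (\<tau> * ?i))"
          unfolding power_add[symmetric] q_def
          by (simp add: powr_powr algebra_simps flip: powr_realpow powr_add)
        ultimately show ?thesis by (simp add: mult_ac)
      qed
      finally show "(\<Sum>m. ?f (i', m)) \<le> ennreal (C * 2 powr \<tau> * q ^ i0 * q ^ i')" .
    qed auto
    also have "\<dots> = ennreal (\<Sum>i'. C * 2 powr \<tau> * q ^ i0 * q ^ i')"
      using q C by (intro suminf_ennreal2 summable_mult summable_geometric) auto
    also have "(\<Sum>i'. C * 2 powr \<tau> * q ^ i0 * q ^ i') = D * q ^ i0"
      using q by (subst suminf_mult) (auto simp: suminf_geometric summable_geometric D_def)
    also have "ennreal (D * q ^ i0) \<le> ennreal \<epsilon>"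
    proof (rule ennreal_leI)
      have "D * q ^ i0 \<le> D * (\<epsilon> / (D + 1))" using i0(2) D by (intro mult_left_mono)
      also have "\<dots> = \<epsilon> * (D / (D + 1))" by simp
      also have "\<dots> \<le> \<epsilon> * 1" using \<epsilon> D by (intro mult_left_mono) auto
      finally show "D * q ^ i0 \<le> \<epsilon>" by simp
    qed
    finally show ?thesis .
  qed
  then have "hausdorff_premeasure \<rho> \<tau> \<delta> E = 0" if "0 < \<delta>" for \<delta>
    using that by (metis ennreal_le_epsilon add_0 ennreal_0 le_zero_eq zero_le)
  then show ?thesis unfolding hausdorff_measure_def by (intro antisym SUP_least) auto
qed

section \<open>Dyadic shells and double counting\<close>

definition shell_mass :: "nat \<Rightarrow> ('a::euclidean_space \<Rightarrow> real) \<Rightarrow> 'a set \<Rightarrow> ennreal" where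
  "shell_mass i \<Phi> V = (\<integral>\<^sup>+z\<in>{z. 2 ^ i \<le> norm z \<and> norm z < 2 ^ Suc i \<and> norm (z - orth_proj V z) \<le> 1}. ennreal (\<Phi> z) \<partial>lborel)"

text \<open>Put r = 2 ^ (k - a) > 1. The hypothesis provides mass c r ^ j up to frequency 2 ^ j for
  arbitrarily large j. If every shell from i0 on were small, their geometric sum would supply at
  most half of it, and the fixed ball of radius 2 ^ i0 cannot supply the rest. The shell found need
  not be near frequency 2 ^ j; it is only required to be beyond i0.\<close>

lemma large_mass_imp_large_shell:
  fixes \<Phi> :: "'a::euclidean_space \<Rightarrow> real" and a c :: real
  assumes \<Phi>: "\<Phi> \<in> borel_measurable borel" and V: "subspace V" and a: "a < k" and c: "0 < c"
    and fin: "\<And>i::nat. (\<integral>\<^sup>+z\<in>ball 0 (2 ^ i). ennreal (\<Phi> z) \<partial>lborel) < \<infinity>"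
    and large: "\<And>J. \<exists>j\<ge>J. ennreal (c * ((1/2) ^ j) powr a) \<le> ennreal (((1/2) ^ j) ^ k) *
      (\<integral>\<^sup>+z\<in>{z. norm z \<le> 1 / (1/2) ^ j \<and> norm (z - orth_proj V z) \<le> 1}. ennreal (\<Phi> z) \<partial>lborel)"
  shows "\<exists>i\<ge>i0. ennreal (c * ((2 powr (k - a) - 1) / (2 * 2 powr (k - a))) * 2 powr ((k - a) * i)) \<le> shell_mass i \<Phi> V"
proof (rule ccontr)
  assume neg: "\<not> ?thesis"
  define r where "r = 2 powr (k - a)"
  have r: "1 < r" using a by (simp add: r_def)
  \<comment> \<open>Chosen so that the geometric sum up to j is at most c2 r ^ (j + 1) / (r - 1) = c
    / 2 r ^ j.\<close>
  define c2 where "c2 = c * ((r - 1) / (2 * r))"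
  have c2: "0 < c2" using c r by (simp add: c2_def)
  have rp: "2 powr ((k - a) * i) = r ^ i" for i :: nat
    unfolding r_def by (simp add: powr_powr flip: powr_realpow)
  have lt: "shell_mass i \<Phi> V < ennreal (c2 * r ^ i)" if "i0 \<le> i" for i
    using neg that unfolding r_def[symmetric] c2_def[symmetric] rp by (meson not_le)
  obtain L where L: "0 \<le> L" "(\<integral>\<^sup>+z\<in>ball 0 (2 ^ i0). ennreal (\<Phi> z) \<partial>lborel) = ennreal L"
    using fin[of i0] by (metis ennreal_cases less_irrefl infinity_ennreal_def)
  note [measurable] = orth_proj_measurable[OF V] \<Phi>
  define T where "T = (\<lambda>i. {z. 2 ^ i \<le> norm z \<and> norm z < 2 ^ Suc i \<and> norm (z - orth_proj V z) \<le> 1})"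
  have T [measurable]: "T i \<in> sets borel" for i unfolding T_def by measurable
  have bound: "c * r ^ j \<le> L + c / 2 * r ^ j"
    if j: "ennreal (c * ((1/2) ^ j) powr a) \<le> ennreal (((1/2) ^ j) ^ k) *
      (\<integral>\<^sup>+z\<in>{z. norm z \<le> 1 / (1/2) ^ j \<and> norm (z - orth_proj V z) \<le> 1}. ennreal (\<Phi> z) \<partial>lborel)" for j
  proof -
    let ?S = "{z. norm z \<le> 1 / (1/2) ^ j \<and> norm (z - orth_proj V z) \<le> 1}"
    have "(\<integral>\<^sup>+z\<in>?S. ennreal (\<Phi> z) \<partial>lborel) \<le> (\<integral>\<^sup>+z. ennreal (\<Phi> z) * indicator (ball 0 (2 ^ i0)) z + (\<Sum>i\<in>{i0..j}. ennreal (\<Phi> z) * indicator (T i) z) \<partial>lborel)"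
    proof (rule nn_integral_mono)
      fix z :: 'a
      show "ennreal (\<Phi> z) * indicator ?S z \<le> ennreal (\<Phi> z) * indicator (ball 0 (2 ^ i0)) z + (\<Sum>i\<in>{i0..j}. ennreal (\<Phi> z) * indicator (T i) z)"
      proof (cases "z \<in> ?S \<and> z \<notin> ball 0 (2 ^ i0)")
        case True
        then have z: "norm z \<le> 2 ^ j" "norm (z - orth_proj V z) \<le> 1" "2 ^ i0 \<le> norm z"
          by (auto simp: power_one_over)
        have z1: "1 \<le> norm z" using z(3) one_le_power[of "2::real" i0] by linarith
        have "0 < 1 / norm z" "1 / norm z \<le> 1" using z1 by (auto simp: divide_le_eq_1 intro: less_le_trans[OF zero_less_one])
        then obtain i where i: "(1/2) ^ Suc i < 1 / norm z" "1 / norm z \<le> (1/2) ^ i"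
          using power_bracket[of "1/2" "1 / norm z"] by auto
        have nz: "0 < norm z" using z1 by linarith
        have i2: "2 ^ i \<le> norm z" "norm z < 2 ^ Suc i"
          using i nz by (auto simp: power_one_over field_simps)
        have "(2::real) ^ i0 < 2 ^ Suc i" "(2::real) ^ i \<le> 2 ^ j" using i2 z by linarith+
        then have "i0 < Suc i" "i \<le> j" by (simp_all only: power_strict_increasing_iff power_increasing_iff one_less_numeral_iff semiring_norm)
        then have ij: "i \<in> {i0..j}" by simp
        have "z \<in> T i" using i2 z by (simp add: T_def)
        then have "ennreal (\<Phi> z) * indicator ?S z = ennreal (\<Phi> z) * indicator (T i) z" using True by simp
        also have "\<dots> \<le> (\<Sum>i\<in>{i0..j}. ennreal (\<Phi> z) * indicator (T i) z)"
          using ij by (intro member_le_sum) auto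
        finally show ?thesis by (simp add: add_increasing)
      qed (auto simp: indicator_def)
    qed
    also have "\<dots> = (\<integral>\<^sup>+z\<in>ball 0 (2 ^ i0). ennreal (\<Phi> z) \<partial>lborel) + (\<Sum>i\<in>{i0..j}. shell_mass i \<Phi> V)"
    proof -
      have m1: "(\<lambda>z. ennreal (\<Phi> z) * indicator (ball 0 (2 ^ i0)) z) \<in> borel_measurable lborel"
        by (intro borel_measurable_times_ennreal borel_measurable_indicator) auto
      have m2: "(\<lambda>z. ennreal (\<Phi> z) * indicator (T i) z) \<in> borel_measurable lborel" for i by measurable
      have m3: "(\<lambda>z. \<Sum>i\<in>{i0..j}. ennreal (\<Phi> z) * indicator (T i) z) \<in> borel_measurable lborel" by measurable
      show ?thesis
        unfolding nn_integral_add[OF m1 m3] nn_integral_sum[OF m2] by (simp add: shell_mass_def T_def)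
    qed
    also have "\<dots> \<le> ennreal L + (\<Sum>i\<in>{i0..j}. ennreal (c2 * r ^ i))"
      unfolding L(2) using lt by (intro add_left_mono sum_mono) (auto intro: less_imp_le)
    also have "\<dots> = ennreal (L + (\<Sum>i\<in>{i0..j}. c2 * r ^ i))"
      using L(1) c2 r by (simp add: sum_nonneg)
    also have "\<dots> \<le> ennreal (L + c / 2 * r ^ j)"
    proof (intro ennreal_leI add_left_mono)
      have "(\<Sum>i\<in>{i0..j}. c2 * r ^ i) \<le> (\<Sum>i<Suc j. c2 * r ^ i)"
        using c2 r by (intro sum_mono2) auto
      also have "\<dots> = c2 * ((r ^ Suc j - 1) / (r - 1))"
        using r geometric_sum[of r "Suc j"] by (simp only: sum_distrib_left[symmetric])
      also have "\<dots> \<le> c2 * (r ^ Suc j / (r - 1))"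
        using c2 r by (intro mult_left_mono divide_right_mono) auto
      also have "\<dots> = c / 2 * r ^ j" using r by (simp add: c2_def field_simps)
      finally show "(\<Sum>i\<in>{i0..j}. c2 * r ^ i) \<le> c / 2 * r ^ j" .
    qed
    finally have I: "(\<integral>\<^sup>+z\<in>?S. ennreal (\<Phi> z) \<partial>lborel) \<le> ennreal (L + c / 2 * r ^ j)" .
    have "ennreal (c * ((1/2) ^ j) powr a) \<le> ennreal (((1/2) ^ j) ^ k) * ennreal (L + c / 2 * r ^ j)"
      by (rule order_trans[OF j]) (intro mult_left_mono I, simp)
    also have "\<dots> = ennreal (((1/2) ^ j) ^ k * (L + c / 2 * r ^ j))"
      using L(1) c r by (simp add: ennreal_mult)
    finally have "c * ((1/2) ^ j) powr a \<le> ((1/2) ^ j) ^ k * (L + c / 2 * r ^ j)"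
      using L(1) c r by (simp add: ennreal_le_iff)
    moreover have "((1/2::real) ^ j) ^ k = ((1/2) ^ j) powr k" by (simp add: powr_realpow)
    ultimately have "c * 2 powr (- (a * j)) \<le> 2 powr (- (k * j)) * (L + c / 2 * r ^ j)"
      by (simp add: half_powr)
    then have "2 powr (k * j) * (c * 2 powr (- (a * j))) \<le> 2 powr (k * j) * (2 powr (- (k * j)) * (L + c / 2 * r ^ j))"
      by (intro mult_left_mono) auto
    also have "\<dots> = L + c / 2 * r ^ j" by (simp add: mult.assoc[symmetric] flip: powr_add)
    also have "2 powr (k * j) * (c * 2 powr (- (a * j))) = c * r ^ j"
      unfolding rp[symmetric] by (simp add: algebra_simps flip: powr_add)
    finally show ?thesis .
  qed
  obtain J where J: "2 * L / c < r ^ J" using real_arch_pow[OF r] by blast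
  obtain j where j: "J \<le> j" "ennreal (c * ((1/2) ^ j) powr a) \<le> ennreal (((1/2) ^ j) ^ k) *
      (\<integral>\<^sup>+z\<in>{z. norm z \<le> 1 / (1/2) ^ j \<and> norm (z - orth_proj V z) \<le> 1}. ennreal (\<Phi> z) \<partial>lborel)"
    using large by blast
  have "r ^ J \<le> r ^ j" using r j(1) by (intro power_increasing) auto
  then have "2 * L < c * r ^ j" using J c by (simp add: field_simps) (smt (verit) mult_left_mono)
  then show False using bound[OF j(2)] by linarith
qed

lemma powr_shell_le:
  fixes n e :: real
  assumes "2 ^ i \<le> n" "n < 2 ^ Suc i"
  shows "n powr e \<le> 2 powr \<bar>e\<bar> * 2 powr (e * i)"
proof (cases "0 \<le> e")
  case True
  have "0 < n" using assms(1) by (rule less_le_trans[rotated]) simp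
  then have "n powr e \<le> (2 ^ Suc i) powr e" using assms True by (intro powr_mono2) auto
  also have "\<dots> = 2 powr (e * Suc i)" by (simp add: powr_powr mult.commute del: power_Suc flip: powr_realpow)
  also have "\<dots> = 2 powr \<bar>e\<bar> * 2 powr (e * i)" using True by (simp add: algebra_simps flip: powr_add)
  finally show ?thesis .
next
  case False
  then have "n powr e \<le> (2 ^ i) powr e" using assms by (intro powr_mono2') auto
  also have "\<dots> = 1 * 2 powr (e * i)" by (simp add: powr_powr mult.commute flip: powr_realpow)
  also have "\<dots> \<le> 2 powr \<bar>e\<bar> * 2 powr (e * i)" by (intro mult_right_mono) (auto simp: ge_one_powr_ge_zero)
  finally show ?thesis .
qed

text \<open>The shell masses of the planes in P are summed and the sum is taken inside the integral.
  A point of the shell lies near at most N 2 ^ (i (k - 1) (d - k)) of the planes, and there the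
  density is O(2 ^ (e i)) times the energy integrand. Division by 2 ^ ((k - a) i) leaves the
  exponent (k - 1) (d - k) + e - (k - a) = k (d - k) + (a - s) / \<theta>.\<close>

lemma card_large_shell_le:
  fixes \<mu> :: "'a::euclidean_space measure"
  assumes k: "1 \<le> k" "k < DIM('a)" and \<mu>: "\<mu> \<in> measures_on X" "compact X"
    and \<theta>: "0 < \<theta>" "\<theta> \<le> 1" and c: "0 < c" and energy: "fourier_energy s \<theta> \<mu> < \<infinity>"
  shows "\<exists>C\<ge>0. \<forall>i\<ge>2. \<forall>P. finite P \<longrightarrow>
    P \<subseteq> {V \<in> grassmannian k. ennreal (c * 2 powr ((k - a) * i)) \<le> shell_mass i (spectral_density \<theta> a \<mu>) V} \<longrightarrow>
    (\<forall>V\<in>P. \<forall>W\<in>P. V \<noteq> W \<longrightarrow> (1/2) ^ i \<le> gr_dist V W) \<longrightarrow>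
    card P \<le> C * 2 powr ((k * (DIM('a) - real k) + (a - s) / \<theta>) * i)"
proof -
  note facts = measures_on_facts[OF \<mu>]
  note [measurable] = fourier_transform_measurable[OF facts(8,1)]
  let ?d = "real DIM('a)" and ?K = "(k - 1) * (DIM('a) - k)"
  define \<Phi> where "\<Phi> = spectral_density \<theta> a \<mu>"
  have \<Phi>m [measurable]: "\<Phi> \<in> borel_measurable borel" unfolding \<Phi>_def spectral_density_def by measurable
  define \<Psi> where "\<Psi> = (\<lambda>z. cmod (fourier_transform \<mu> z) powr (2 / \<theta>) * norm z powr (s / \<theta> - ?d))"
  have \<Psi>m [measurable]: "\<Psi> \<in> borel_measurable borel" unfolding \<Psi>_def by measurable
  have "(\<integral>\<^sup>+z. ennreal (\<Psi> z) \<partial>lborel) \<noteq> top"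
    using energy unfolding fourier_energy_def ennreal_powr_def \<Psi>_def by (auto split: if_splits)
  then obtain J where J: "0 \<le> J" "(\<integral>\<^sup>+z. ennreal (\<Psi> z) \<partial>lborel) = ennreal J"
    by (metis ennreal_cases)
  \<comment> \<open>The exponent of |z| in \<open>spectral_density\<close> minus the one in the
    energy.\<close>
  define e where "e = a * (1 / \<theta> - 1) - (s / \<theta> - ?d)"
  obtain N where N': "0 \<le> N" "\<forall>\<delta>. 0 < \<delta> \<longrightarrow> \<delta> \<le> 1/4 \<longrightarrow> (\<forall>z::'a. 1 / \<delta> \<le> norm z \<longrightarrow>
    (\<forall>P. finite P \<longrightarrow> P \<subseteq> grassmannian k \<longrightarrow> (\<forall>V\<in>P. \<forall>V'\<in>P. V \<noteq> V' \<longrightarrow> \<delta> \<le> gr_dist V V') \<longrightarrow>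
      card {V \<in> P. norm (z - orth_proj V z) \<le> 1} \<le> N * (1 / \<delta>) ^ ?K))"
    using card_containing_le[OF k(1), where 'a='a] by (elim exE conjE)
  have N: "0 \<le> N" "\<And>\<delta> z P. 0 < \<delta> \<Longrightarrow> \<delta> \<le> 1/4 \<Longrightarrow> 1 / \<delta> \<le> norm (z::'a) \<Longrightarrow> finite P \<Longrightarrow> P \<subseteq> grassmannian k \<Longrightarrow>
      (\<forall>V\<in>P. \<forall>V'\<in>P. V \<noteq> V' \<longrightarrow> \<delta> \<le> gr_dist V V') \<Longrightarrow>
      card {V \<in> P. norm (z - orth_proj V z) \<le> 1} \<le> N * (1 / \<delta>) ^ ?K"
    using N' by simp_all
  define C where "C = N * 2 powr \<bar>e\<bar> * J / c"
  have "card P \<le> C * 2 powr ((k * (?d - real k) + (a - s) / \<theta>) * i)"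
    if i: "2 \<le> i" and P: "finite P" "P \<subseteq> {V \<in> grassmannian k. ennreal (c * 2 powr ((k - a) * i)) \<le> shell_mass i \<Phi> V}"
      and sep: "\<forall>V\<in>P. \<forall>W\<in>P. V \<noteq> W \<longrightarrow> (1/2) ^ i \<le> gr_dist V W" for i P
  proof -
    have PG: "P \<subseteq> grassmannian k" using P by blast
    let ?S = "{z::'a. 2 ^ i \<le> norm z \<and> norm z < 2 ^ Suc i}"
    define T where "T = (\<lambda>V. {z::'a. 2 ^ i \<le> norm z \<and> norm z < 2 ^ Suc i \<and> norm (z - orth_proj V z) \<le> 1})"
    have T: "T V \<in> sets borel" if "V \<in> P" for V
    proof -
      have V: "subspace V" using that PG by (auto simp: grassmannian_def)
      note [measurable] = orth_proj_measurable[OF V]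
      show ?thesis unfolding T_def by measurable
    qed
    \<comment> \<open>The range i \<ge> 2 is the condition \<delta> \<le> 1/4 of the counting lemma
      at \<delta> = 2 ^ - i.\<close>
    have small: "(1/2::real) ^ i \<le> 1/4"
      using power_decreasing[OF i, of "1/2::real"] by (simp add: power2_eq_square)
    have count: "(\<Sum>V\<in>P. indicator (T V) z) \<le> ennreal (N * (2 ^ i) ^ ?K) * indicator ?S z" for z
    proof (cases "z \<in> ?S")
      case True
      have "(\<Sum>V\<in>P. indicator (T V) z :: ennreal) = (\<Sum>V\<in>{V \<in> P. norm (z - orth_proj V z) \<le> 1}. 1)"
        using True P(1) by (intro sum.mono_neutral_cong_right) (auto simp: T_def indicator_def)
      also have "\<dots> = ennreal (card {V \<in> P. norm (z - orth_proj V z) \<le> 1})"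
        by (simp add: ennreal_of_nat_eq_real_of_nat)
      also have "\<dots> \<le> ennreal (N * (1 / (1/2) ^ i) ^ ?K)"
      proof (intro ennreal_leI N(2))
        show "1 / (1/2) ^ i \<le> norm z" using True by (simp add: power_one_over)
      qed (use small P(1) PG sep in auto)
      also have "1 / (1/2::real) ^ i = 2 ^ i" by (simp add: power_one_over)
      finally show ?thesis using True by simp
    qed (auto simp: T_def indicator_def)
    have pt: "ennreal (\<Phi> z) * indicator ?S z \<le> ennreal (2 powr \<bar>e\<bar> * 2 powr (e * i)) * ennreal (\<Psi> z)" for z
    proof (cases "z \<in> ?S")
      case True
      then have n: "2 ^ i \<le> norm z" "norm z < 2 ^ Suc i" by auto
      have "0 < norm z" by (rule less_le_trans[OF _ n(1)]) simp
      then have "\<Phi> z = \<Psi> z * norm z powr e"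
        unfolding \<Phi>_def \<Psi>_def e_def spectral_density_def by (simp add: mult.assoc flip: powr_add)
      also have "\<dots> \<le> \<Psi> z * (2 powr \<bar>e\<bar> * 2 powr (e * i))"
        using powr_shell_le[OF n, of e] by (intro mult_left_mono) (auto simp: \<Psi>_def)
      finally have "ennreal (\<Phi> z) \<le> ennreal ((2 powr \<bar>e\<bar> * 2 powr (e * i)) * \<Psi> z)"
        by (intro ennreal_leI) (simp add: mult.commute)
      also have "\<dots> = ennreal (2 powr \<bar>e\<bar> * 2 powr (e * i)) * ennreal (\<Psi> z)"
        by (rule ennreal_mult) (auto simp: \<Psi>_def)
      finally show ?thesis using True by simp
    qed simp
    have "ennreal (card P * (c * 2 powr ((k - a) * i))) = (\<Sum>V\<in>P. ennreal (c * 2 powr ((k - a) * i)))"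
      using c by (simp add: ennreal_mult ennreal_of_nat_eq_real_of_nat)
    also have "\<dots> \<le> (\<Sum>V\<in>P. \<integral>\<^sup>+z. ennreal (\<Phi> z) * indicator (T V) z \<partial>lborel)"
      using P(2) unfolding shell_mass_def T_def by (intro sum_mono) blast
    also have "\<dots> = (\<integral>\<^sup>+z. (\<Sum>V\<in>P. ennreal (\<Phi> z) * indicator (T V) z) \<partial>lborel)"
      by (rule nn_integral_sum[symmetric])
         (use T in \<open>auto intro!: borel_measurable_times_ennreal borel_measurable_indicator measurable_compose[OF \<Phi>m]\<close>)
    also have "\<dots> \<le> (\<integral>\<^sup>+z. ennreal (N * (2 ^ i) ^ ?K * (2 powr \<bar>e\<bar> * 2 powr (e * i))) * ennreal (\<Psi> z) \<partial>lborel)"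
    proof (rule nn_integral_mono)
      fix z
      have "(\<Sum>V\<in>P. ennreal (\<Phi> z) * indicator (T V) z) \<le> ennreal (\<Phi> z) * (ennreal (N * (2 ^ i) ^ ?K) * indicator ?S z)"
        unfolding sum_distrib_left[symmetric] by (intro mult_left_mono count) simp
      also have "\<dots> = ennreal (N * (2 ^ i) ^ ?K) * (ennreal (\<Phi> z) * indicator ?S z)" by (simp only: mult_ac)
      also have "\<dots> \<le> ennreal (N * (2 ^ i) ^ ?K) * (ennreal (2 powr \<bar>e\<bar> * 2 powr (e * i)) * ennreal (\<Psi> z))"
        by (intro mult_left_mono pt) simp
      also have "\<dots> = ennreal (N * (2 ^ i) ^ ?K * (2 powr \<bar>e\<bar> * 2 powr (e * i))) * ennreal (\<Psi> z)"
      proof -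
        have "ennreal (N * (2 ^ i) ^ ?K * (2 powr \<bar>e\<bar> * 2 powr (e * i))) = ennreal (N * (2 ^ i) ^ ?K) * ennreal (2 powr \<bar>e\<bar> * 2 powr (e * i))"
          using N(1) by (intro ennreal_mult) auto
        then show ?thesis by (simp only: mult.assoc)
      qed
      finally show "(\<Sum>V\<in>P. ennreal (\<Phi> z) * indicator (T V) z) \<le> \<dots>" .
    qed
    also have "\<dots> = ennreal (N * (2 ^ i) ^ ?K * (2 powr \<bar>e\<bar> * 2 powr (e * i))) * ennreal J"
      unfolding J(2)[symmetric] by (rule nn_integral_cmult) measurable
    also have "\<dots> = ennreal (N * (2 ^ i) ^ ?K * (2 powr \<bar>e\<bar> * 2 powr (e * i)) * J)"
      using N(1) J(1) by (intro ennreal_mult[symmetric]) auto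
    finally have main: "card P * (c * 2 powr ((k - a) * i)) \<le> N * (2 ^ i) ^ ?K * (2 powr \<bar>e\<bar> * 2 powr (e * i)) * J"
      using N(1) J(1) by (simp add: ennreal_le_iff)
    have "card P = card P * (c * 2 powr ((k - a) * i)) * (2 powr (- ((k - a) * i)) / c)"
      using c by (simp add: powr_minus)
    also have "\<dots> \<le> N * (2 ^ i) ^ ?K * (2 powr \<bar>e\<bar> * 2 powr (e * i)) * J * (2 powr (- ((k - a) * i)) / c)"
      using main c by (intro mult_right_mono) auto
    also have "\<dots> = C * ((2 ^ i) ^ ?K * 2 powr (e * i) * 2 powr (- ((k - a) * i)))"
      by (simp add: C_def)
    also have "(2 ^ i) ^ ?K * 2 powr (e * i) * 2 powr (- ((k - a) * i)) = 2 powr ((k * (?d - real k) + (a - s) / \<theta>) * i)"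
    proof -
      have P: "(2 ^ i) ^ ?K = (2::real) powr (real i * real ?K)" by (simp only: power_mult[symmetric] powr_realpow zero_less_numeral flip: of_nat_mult)
      have E: "real i * real ?K + e * i + - ((k - a) * i) = (k * (?d - real k) + (a - s) / \<theta>) * i"
      proof -
        have K: "real ?K = (real k - 1) * (?d - real k)" using k by (simp add: of_nat_diff)
        show ?thesis unfolding K e_def by (simp add: diff_divide_distrib algebra_simps)
      qed
      show ?thesis unfolding P powr_add[symmetric] E ..
    qed
    finally show ?thesis .
  qed
  moreover have "0 \<le> C" using N(1) J(1) c by (simp add: C_def)
  ultimately show ?thesis unfolding \<Phi>_def by blast
qed

lemma exceptional_set_null:
  fixes X :: "'a::euclidean_space set"
  assumes k: "1 \<le> k" "k < DIM('a)" and \<mu>: "\<mu> \<in> measures_on X" "compact X"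
    and \<theta>: "0 < \<theta>" "\<theta> \<le> 1" and energy: "fourier_energy s \<theta> \<mu> < \<infinity>" and u: "0 < u" "u < 1"
    and \<tau>: "0 < \<tau>" "k * (DIM('a) - real k) + (u - s) / \<theta> < \<tau>"
  shows "hausdorff_measure gr_dist \<tau> {V \<in> grassmannian k. hausdorff_dim dist (orth_proj V ` X) < ereal u} = 0"
proof -
  note facts = measures_on_facts[OF \<mu>]
  let ?\<beta> = "k * (DIM('a) - real k) + (u - s) / \<theta>"
  \<comment> \<open>The first entry keeps a = u + 2 \<eta> below 1; the second lets the exponent
    grow by at most half of its distance to \<tau>.\<close>
  define \<eta> where "\<eta> = min ((1 - u) / 4) (\<theta> * (\<tau> - ?\<beta>) / 4)"
  have "0 < \<theta> * (\<tau> - ?\<beta>) / 4" using \<tau> \<theta> by (intro divide_pos_pos mult_pos_pos) auto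
  then have \<eta>0: "0 < \<eta>" unfolding \<eta>_def using u by (simp only: min_less_iff_conj) simp
  have "\<eta> \<le> (1 - u) / 4" "\<eta> \<le> \<theta> * (\<tau> - ?\<beta>) / 4"
    unfolding \<eta>_def by (rule min.cobounded1, rule min.cobounded2)
  note \<eta> = \<eta>0 this
  define a where "a = u + 2 * \<eta>"
  have a: "0 < a" "a < 1" using u \<eta> by (auto simp: a_def)
  have ak: "a < real k" using a k by simp
  let ?b = "k * (DIM('a) - real k) + (a - s) / \<theta>"
  have b: "?b < \<tau>"
  proof -
    have "2 * \<eta> / \<theta> \<le> t / 2" if "\<eta> \<le> \<theta> * t / 4" for t using that \<theta> by (simp add: field_simps)
    from this[OF \<eta>(3)] have "2 * \<eta> / \<theta> \<le> (\<tau> - ?\<beta>) / 2" .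
    moreover have "?b = ?\<beta> + 2 * \<eta> / \<theta>" by (simp add: a_def add_divide_distrib diff_divide_distrib)
    moreover have "x < y" if "q \<le> (y - w) / 2" "x = w + q" "w < y" for x y w q :: real
      using that by (simp add: field_simps)
    ultimately show ?thesis using \<tau>(2) by blast
  qed
  obtain c where c: "0 < c" "\<And>V J. subspace V \<Longrightarrow> hausdorff_dim dist (orth_proj V ` X) < ereal u \<Longrightarrow>
    \<exists>j\<ge>J. ennreal (c * ((1/2) ^ j) powr a) \<le> emeasure (\<mu> \<Otimes>\<^sub>M \<mu>) (close_pairs (spt \<mu>) V ((1/2) ^ j))"
    using dimension_lt_imp_close_pairs[OF \<mu> \<eta>(1) u(1)] unfolding a_def by blast
  obtain c' where c': "0 < c'" "\<And>V \<delta>. V \<in> grassmannian k \<Longrightarrow> 0 < \<delta> \<Longrightarrow> \<delta> \<le> 1/32 \<Longrightarrow>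
    ennreal (c * \<delta> powr a) \<le> emeasure (\<mu> \<Otimes>\<^sub>M \<mu>) (close_pairs (spt \<mu>) V \<delta>) \<Longrightarrow>
    ennreal (c' * \<delta> powr a) \<le> ennreal (\<delta> ^ k) *
      (\<integral>\<^sup>+z\<in>{z. norm z \<le> 1 / \<delta> \<and> norm (z - orth_proj V z) \<le> 1}. ennreal (spectral_density \<theta> a \<mu> z) \<partial>lborel)"
    using close_pairs_imp_spectral_mass[OF \<mu> \<theta> a k(1) c(1)] by blast
  define \<Phi> where "\<Phi> = spectral_density \<theta> a \<mu>"
  note [measurable] = fourier_transform_measurable[OF facts(8,1)]
  have \<Phi>m [measurable]: "\<Phi> \<in> borel_measurable borel" unfolding \<Phi>_def spectral_density_def by measurable
  have fin: "(\<integral>\<^sup>+z\<in>ball 0 (2 ^ i). ennreal (\<Phi> z) \<partial>lborel) < \<infinity>" for i :: nat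
  proof -
    define B where "B = (measure \<mu> UNIV) powr (2 / \<theta>) * (2 ^ i) powr (a * (1 / \<theta> - 1))"
    have "(\<integral>\<^sup>+z\<in>ball 0 (2 ^ i). ennreal (\<Phi> z) \<partial>lborel) \<le> (\<integral>\<^sup>+z. ennreal B * indicator (ball (0::'a) (2 ^ i)) z \<partial>lborel)"
    proof (rule nn_integral_mono)
      fix z :: 'a
      have "\<Phi> z \<le> B" if "z \<in> ball 0 (2 ^ i)"
        unfolding \<Phi>_def spectral_density_def B_def using that \<theta> a cmod_fourier_transform_le[OF facts(8,1), of z]
        by (intro mult_mono powr_mono2) auto
      then show "ennreal (\<Phi> z) * indicator (ball 0 (2 ^ i)) z \<le> ennreal B * indicator (ball 0 (2 ^ i)) z"
        by (auto simp: indicator_def intro: ennreal_leI)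
    qed
    also have "\<dots> = ennreal B * emeasure lborel (ball (0::'a) (2 ^ i))"
      by (rule nn_integral_cmult_indicator) simp
    also have "\<dots> < \<infinity>" by (simp add: emeasure_ball ennreal_mult_less_top)
    finally show ?thesis .
  qed
  define c'' where "c'' = c' * ((2 powr (k - a) - 1) / (2 * 2 powr (k - a)))"
  have "1 < 2 powr (real k - a)" using ak by simp
  then have c'': "0 < c''" using c'(1) by (simp add: c''_def)
  define F where "F = (\<lambda>i. {V \<in> grassmannian k. ennreal (c'' * 2 powr ((k - a) * i)) \<le> shell_mass i \<Phi> V})"
  have "\<exists>C\<ge>0. \<forall>i\<ge>2. \<forall>P. finite P \<longrightarrow> P \<subseteq> F i \<longrightarrow>
    (\<forall>V\<in>P. \<forall>W\<in>P. V \<noteq> W \<longrightarrow> (1/2) ^ i \<le> gr_dist V W) \<longrightarrow> card P \<le> C * 2 powr (?b * i)"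
    unfolding F_def \<Phi>_def by (rule card_large_shell_le[OF k \<mu> \<theta> c'' energy])
  then obtain C where C: "0 \<le> C" and card: "\<forall>i\<ge>2. \<forall>P. finite P \<longrightarrow> P \<subseteq> F i \<longrightarrow>
    (\<forall>V\<in>P. \<forall>W\<in>P. V \<noteq> W \<longrightarrow> (1/2) ^ i \<le> gr_dist V W) \<longrightarrow> card P \<le> C * 2 powr (?b * i)"
    by (elim exE conjE)
  show ?thesis
  proof (rule hausdorff_measure_limsup_eq_0[where G="grassmannian k" and F=F and C=C and b="?b" and ?i1.0=2])
    show "gr_dist V W = gr_dist W V" if "V \<in> grassmannian k" "W \<in> grassmannian k" for V W :: "'a set"
      using gr_dist_commute[of V V W] that by (auto simp: grassmannian_def)
    show "gr_dist V V = 0" if "V \<in> grassmannian k" for V :: "'a set"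
      using gr_dist_eq_0_iff[of V V V] that by (auto simp: grassmannian_def)
    show "gr_dist U W \<le> gr_dist U V + gr_dist V W" if "U \<in> grassmannian k" "V \<in> grassmannian k" "W \<in> grassmannian k" for U V W :: "'a set"
      using gr_dist_triangle[of U V W] that by (auto simp: grassmannian_def)
    show "F i \<subseteq> grassmannian k" for i by (auto simp: F_def)
    show "\<exists>i\<ge>i0. V \<in> F i" if "V \<in> {V \<in> grassmannian k. hausdorff_dim dist (orth_proj V ` X) < ereal u}" for V i0
    proof -
      have V: "V \<in> grassmannian k" "subspace V" and dimV: "hausdorff_dim dist (orth_proj V ` X) < ereal u"
        using that by (auto simp: grassmannian_def)
      have "\<exists>j\<ge>J. ennreal (c' * ((1/2) ^ j) powr a) \<le> ennreal (((1/2) ^ j) ^ k) *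
        (\<integral>\<^sup>+z\<in>{z. norm z \<le> 1 / (1/2) ^ j \<and> norm (z - orth_proj V z) \<le> 1}. ennreal (\<Phi> z) \<partial>lborel)" for J
      proof -
        \<comment> \<open>Starting from level 5 ensures 2 ^ - j \<le> 1/32.\<close>
        obtain j where j: "max J 5 \<le> j" "ennreal (c * ((1/2) ^ j) powr a) \<le> emeasure (\<mu> \<Otimes>\<^sub>M \<mu>) (close_pairs (spt \<mu>) V ((1/2) ^ j))"
          using c(2)[OF V(2) dimV, of "max J 5"] by blast
        have "(1/2::real) ^ j \<le> (1/2) ^ 5" using j(1) by (intro power_decreasing) auto
        also have "\<dots> = 1/32" by (simp add: numeral_eq_Suc)
        finally have "(1/2::real) ^ j \<le> 1/32" .
        from c'(2)[OF V(1) _ this j(2)] show ?thesis using j(1) unfolding \<Phi>_def by auto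
      qed
      from large_mass_imp_large_shell[OF \<Phi>m V(2) ak c'(1) fin this, of i0]
      show ?thesis using V(1) by (auto simp: F_def c''_def)
    qed
    show "card P \<le> C * 2 powr (?b * i)" if "2 \<le> i" "finite P" "P \<subseteq> F i"
      "\<forall>V\<in>P. \<forall>W\<in>P. V \<noteq> W \<longrightarrow> (1/2) ^ i \<le> gr_dist V W" for i P
      by (rule card[rule_format, OF that(1-3)]) (use that(4) in blast)
  qed (use C \<tau>(1) b in auto)
qed

section \<open>From single measures to the Fourier spectrum, and the comparison of bounds\<close>

text \<open>The default value 0 of the empty supremum cannot exceed a nonnegative s.\<close>

lemma Sup0_eq_Sup:
  assumes "0 \<le> s" "ereal s < Sup0 S"
  shows "Sup0 S = Sup S"
  using assms by (cases "S = {}") (simp_all add: Sup0_def)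

lemma hausdorff_dim_leI:
  assumes "0 \<le> b" "\<And>\<tau>. 0 < \<tau> \<Longrightarrow> b < \<tau> \<Longrightarrow> hausdorff_measure \<rho> \<tau> A = 0"
  shows "hausdorff_dim \<rho> A \<le> ereal b"
proof (rule ereal_le_epsilon2)
  fix e :: real assume "0 < e"
  then have "b + e \<in> {s. 0 < s \<and> hausdorff_measure \<rho> s A = 0}" using assms by auto
  then show "hausdorff_dim \<rho> A \<le> ereal b + ereal e"
    unfolding hausdorff_dim_def by (metis Inf_lower imageI plus_ereal.simps(1))
qed

lemma fourier_spectrum_ge:
  fixes X :: "'a::euclidean_space set"
  assumes "\<nu> \<in> measures_on X" "fourier_energy s \<theta> \<nu> < \<infinity>" "s \<le> DIM('a)"
  shows "ereal s \<le> fourier_spectrum \<theta> X"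
proof -
  have "ereal s \<le> fourier_spectrum_measure \<theta> \<nu>"
    unfolding fourier_spectrum_measure_def Sup0_def using assms(2) by (auto intro!: Sup_upper)
  then have "ereal s \<le> min (fourier_spectrum_measure \<theta> \<nu>) (ereal (real DIM('a)))" using assms(3) by simp
  also have "\<dots> \<le> fourier_spectrum \<theta> X"
    unfolding fourier_spectrum_def Sup0_def using assms(1) by (auto intro: Sup_upper)
  finally show ?thesis .
qed

lemma fourier_spectrum_gtE:
  assumes "0 \<le> s" "ereal s < fourier_spectrum \<theta> X"
  obtains \<nu> s' where "\<nu> \<in> measures_on X" "s < s'" "fourier_energy s' \<theta> \<nu> < \<infinity>"
proof -
  have "measures_on X \<noteq> {}" using assms by (auto simp: fourier_spectrum_def Sup0_def)
  then obtain \<nu> where \<nu>: "\<nu> \<in> measures_on X" "ereal s < fourier_spectrum_measure \<theta> \<nu>"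
    using assms(2) by (auto simp: fourier_spectrum_def Sup0_def less_Sup_iff)
  have "fourier_spectrum_measure \<theta> \<nu> = Sup (ereal ` {s. fourier_energy s \<theta> \<nu> < \<infinity>})"
    using \<nu>(2) unfolding fourier_spectrum_measure_def by (rule Sup0_eq_Sup[OF assms(1)])
  with \<nu>(2) obtain s' where "s < s'" "fourier_energy s' \<theta> \<nu> < \<infinity>" by (auto simp: less_Sup_iff)
  then show ?thesis using that \<nu>(1) by blast
qed

lemma fourier_spectrum_le: "fourier_spectrum \<theta> (X :: 'a::euclidean_space set) \<le> ereal (real DIM('a))"
  unfolding fourier_spectrum_def Sup0_def by (auto intro: Sup_least)

text \<open>For \<tau> above the bound, D may be lowered to a nonnegative s, and some measure has
  finite energy at an exponent s' > s, which still keeps the critical exponent below \<tau>.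
  Positivity of D leaves room for s \<ge> 0, where the default values in the spectrum cannot
  interfere.\<close>

lemma hausdorff_dim_exceptional_set_le:
  fixes X :: "'a::euclidean_space set"
  assumes k: "1 \<le> k" "k < DIM('a)" and X: "compact X" and \<theta>: "0 < \<theta>" "\<theta> \<le> 1"
    and D: "0 < D" "ereal D \<le> fourier_spectrum \<theta> X" and u: "0 < u" "u < 1"
  shows "hausdorff_dim gr_dist {V \<in> grassmannian k. hausdorff_dim dist (orth_proj V ` X) < ereal u}
    \<le> ereal (max 0 (k * (DIM('a) - real k) + (u - D) / \<theta>))" (is "?h \<le> ereal (max 0 ?b)")
proof (rule hausdorff_dim_leI)
  fix \<tau> :: real assume \<tau>: "0 < \<tau>" "max 0 ?b < \<tau>"
  define s where "s = max 0 (D - \<theta> * (\<tau> - ?b))"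
  have "0 < \<theta> * (\<tau> - ?b)" using \<tau> \<theta> by simp
  then have s: "0 \<le> s" "s < D" "D - \<theta> * (\<tau> - ?b) \<le> s" using D(1) by (auto simp: s_def)
  then have "ereal s < fourier_spectrum \<theta> X" using D(2) by (meson ereal_less_eq(3) less_ereal.simps(1) less_le_trans)
  from fourier_spectrum_gtE[OF s(1) this]
  obtain \<nu> s' where \<nu>: "\<nu> \<in> measures_on X" "s < s'" "fourier_energy s' \<theta> \<nu> < \<infinity>" .
  have "(u - s') / \<theta> < (u - D) / \<theta> + t" if "D - \<theta> * t < s'" for t
  proof -
    have "u - s' < u - D + \<theta> * t" using that by simp
    then have "(u - s') / \<theta> < (u - D + \<theta> * t) / \<theta>" using \<theta>(1) by (rule divide_strict_right_mono)
    then show ?thesis using \<theta>(1) by (simp add: add_divide_distrib)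
  qed
  from this[of "\<tau> - ?b"] have "k * (DIM('a) - real k) + (u - s') / \<theta> < \<tau>" using s(3) \<nu>(2) by linarith
  then show "hausdorff_measure gr_dist \<tau> {V \<in> grassmannian k. hausdorff_dim dist (orth_proj V ` X) < ereal u} = 0"
    using exceptional_set_null[OF k \<nu>(1) X \<theta> \<nu>(3) u \<tau>(1)] by blast
qed simp

text \<open>The flat measure fixes \<open>\<theta>\<^sub>1\<close> before u. At this value the
  quotient is at most u / \<open>\<theta>\<^sub>1\<close> - (d - \<epsilon>), which for small u is
  below both - h and - k. The dimension estimate, in contrast, has to hold at every \<theta>,
  because the bound is an infimum that need not be attained.\<close>

theorem corollary6p6:
  fixes X :: "'a::euclidean_space set" and k :: nat
  assumes "DIM('a) \<ge> 3"
    and "1 \<le> k" and "k < DIM('a)"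
    and "compact X"
    and "0 < hausdorff_dim dist X" and "hausdorff_dim dist X < ereal (real DIM('a))"
    and "\<exists>C \<alpha>. 1 \<le> C \<and> 0 < \<alpha> \<and>
           (\<exists>\<mu>\<in>measures_on X. uniformly_affinely_nonconcentrated C \<alpha> \<mu>)"
  shows "\<exists>u\<^sub>0>0. \<forall>u::real. 0 < u \<and> u < u\<^sub>0 \<longrightarrow>
           hausdorff_dim gr_dist
               {V \<in> grassmannian k. hausdorff_dim dist (orth_proj V ` X) < ereal u}
             \<le> max 0 (exceptional_bound k X u)
         \<and> exceptional_bound k X u
             < ereal (real k * (real DIM('a) - real k)) + ereal u - hausdorff_dim dist X
         \<and> exceptional_bound k X u
             < ereal (real k * (real DIM('a) - real k - 1) + u)"
proof -
  let ?d = "real DIM('a)" and ?c = "real k * (real DIM('a) - real k)"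
  note k = assms(2,3)
  obtain h where h: "hausdorff_dim dist X = ereal h" "0 < h" "h < ?d"
    using assms(5,6) by (cases "hausdorff_dim dist X") auto
  obtain C \<alpha> \<mu> where \<mu>: "1 \<le> C" "0 < \<alpha>" "\<mu> \<in> measures_on X" "uniformly_affinely_nonconcentrated C \<alpha> \<mu>"
    using assms(7) by blast
  \<comment> \<open>The second entry leaves room above h for the Peres-Schlag comparison; the first,
    with m \<le> 1/2 below, gives m + \<epsilon> \<le> 1 \<le> d - k for the Mattila
    comparison.\<close>
  define \<epsilon> where "\<epsilon> = min (1/2) ((?d - h) / 2)"
  have \<epsilon>: "0 < \<epsilon>" "\<epsilon> < 1" "\<epsilon> < ?d - h" "\<epsilon> \<le> 1/2"
    using h by (auto simp: \<epsilon>_def min_def field_simps)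
  from flat_fourier_spectrum[OF assms(4) \<mu> \<epsilon>(1,2)]
  obtain \<theta>\<^sub>1 \<nu> where \<theta>\<^sub>1: "0 < \<theta>\<^sub>1" "\<theta>\<^sub>1 \<le> 1" and \<nu>: "\<nu> \<in> measures_on X" "fourier_energy ((?d - \<epsilon>) * \<theta>\<^sub>1) \<theta>\<^sub>1 \<nu> < \<infinity>"
    by auto
  have D0: "0 < (?d - \<epsilon>) * \<theta>\<^sub>1" using \<epsilon>(3) h \<theta>\<^sub>1 by simp
  have "(?d - \<epsilon>) * \<theta>\<^sub>1 \<le> ?d * 1" using \<epsilon>(1) h \<theta>\<^sub>1 by (intro mult_mono) auto
  then have D: "ereal ((?d - \<epsilon>) * \<theta>\<^sub>1) \<le> fourier_spectrum \<theta>\<^sub>1 X" using \<nu> by (intro fourier_spectrum_ge) auto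
  have kd: "real k + 1 \<le> ?d" using k(2) by linarith
  define m where "m = min (1/2) (?d - \<epsilon> - h)"
  have m: "0 < m" "m \<le> 1/2" "m \<le> ?d - \<epsilon> - h" using \<epsilon> by (auto simp: m_def min_def)
  \<comment> \<open>The entry 1 serves the exceptional set estimate, the other one says u /
    \<open>\<theta>\<^sub>1\<close> < m.\<close>
  define u\<^sub>0 where "u\<^sub>0 = min 1 (\<theta>\<^sub>1 * m)"
  have u\<^sub>0: "0 < u\<^sub>0" using \<theta>\<^sub>1 m by (simp add: u\<^sub>0_def)
  show ?thesis
  proof (intro exI[of _ "u\<^sub>0"] conjI allI impI u\<^sub>0)
    fix u :: real assume "0 < u \<and> u < u\<^sub>0"
    then have "0 < u" "u < 1" "u < \<theta>\<^sub>1 * m" by (auto simp: u\<^sub>0_def)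
    then have u: "0 < u" "u < 1" "u / \<theta>\<^sub>1 < m" using \<theta>\<^sub>1(1) by (auto simp: pos_divide_less_eq mult.commute)
    let ?h = "hausdorff_dim gr_dist {V \<in> grassmannian k. hausdorff_dim dist (orth_proj V ` X) < ereal u}"
    have b1: "?c + (u - (?d - \<epsilon>) * \<theta>\<^sub>1) / \<theta>\<^sub>1 < ?c + m - (?d - \<epsilon>)"
      using u(3) \<theta>\<^sub>1 by (simp add: diff_divide_distrib)
    have "(INF \<theta>\<in>{0<..1}. (ereal u - fourier_spectrum \<theta> X) / ereal \<theta>) \<le> (ereal u - fourier_spectrum \<theta>\<^sub>1 X) / ereal \<theta>\<^sub>1"
      using \<theta>\<^sub>1 by (intro INF_lower) auto
    also have "\<dots> \<le> (ereal u - ereal ((?d - \<epsilon>) * \<theta>\<^sub>1)) / ereal \<theta>\<^sub>1"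
      using \<theta>\<^sub>1 D by (intro ereal_divide_right_mono ereal_minus_mono) auto
    also have "\<dots> = ereal ((u - (?d - \<epsilon>) * \<theta>\<^sub>1) / \<theta>\<^sub>1)" using \<theta>\<^sub>1 by simp
    finally have "exceptional_bound k X u \<le> ereal ?c + ereal ((u - (?d - \<epsilon>) * \<theta>\<^sub>1) / \<theta>\<^sub>1)"
      unfolding exceptional_bound_def by (rule add_left_mono)
    also have "\<dots> < ereal (?c + m - (?d - \<epsilon>))" using b1 by simp
    finally have B: "exceptional_bound k X u < ereal (?c + m - (?d - \<epsilon>))" .
    also have "\<dots> \<le> ereal (?c + u - h)" using m(3) u(1) by simp
    finally show "exceptional_bound k X u < ereal ?c + ereal u - hausdorff_dim dist X" using h(1) by simp
    have "?c + m - (?d - \<epsilon>) \<le> real k * (?d - real k - 1) + u"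
      using m(2) \<epsilon>(4) kd u(1) by (simp add: algebra_simps)
    with B show "exceptional_bound k X u < ereal (real k * (?d - real k - 1) + u)"
      by (meson ereal_less_eq(3) less_le_trans)
    \<comment> \<open>The estimate at \<open>\<theta>\<^sub>1\<close> already implies the bound k (d
      - k). It settles the values of \<theta> at which the spectrum is not positive, where (u - D) /
      \<theta> > 0.\<close>
    have "?h \<le> ereal ?c"
    proof -
      have "?c + (u - (?d - \<epsilon>) * \<theta>\<^sub>1) / \<theta>\<^sub>1 \<le> ?c" using b1 m(2) \<epsilon>(4) kd k(1) by linarith
      moreover have "0 \<le> ?c" using kd by simp
      ultimately have "ereal (max 0 (?c + (u - (?d - \<epsilon>) * \<theta>\<^sub>1) / \<theta>\<^sub>1)) \<le> ereal ?c"
        unfolding ereal_less_eq(3) by (rule max.boundedI[rotated])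
      with hausdorff_dim_exceptional_set_le[OF k assms(4) \<theta>\<^sub>1 D0 D u(1,2)] show ?thesis by (rule order_trans)
    qed
    note hc = this
    have each: "?h \<le> ereal ?c + (ereal u - fourier_spectrum \<theta> X) / ereal \<theta>"
      if \<theta>: "0 < \<theta>" "\<theta> \<le> 1" and pos: "0 < ?h" for \<theta>
    proof -
      consider "fourier_spectrum \<theta> X = -\<infinity>" | D where "fourier_spectrum \<theta> X = ereal D"
        using fourier_spectrum_le[of \<theta> X] by (cases "fourier_spectrum \<theta> X") auto
      then show ?thesis
      proof cases
        case 1
        then show ?thesis using \<theta> by simp
      next
        case 2
        show ?thesis
        proof (cases "0 < D")
          case True
          then have "?h \<le> ereal (max 0 (?c + (u - D) / \<theta>))"
            using hausdorff_dim_exceptional_set_le[OF k assms(4) \<theta> True _ u(1,2)] 2 by simp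
          moreover from pos this have "0 < ereal (max 0 (?c + (u - D) / \<theta>))" by (rule less_le_trans)
          then have "max 0 (?c + (u - D) / \<theta>) = ?c + (u - D) / \<theta>" by (simp add: max_def split: if_splits)
          ultimately show ?thesis using \<theta> 2 by simp
        next
          case False
          then have "?c \<le> ?c + (u - D) / \<theta>" using u(1) \<theta> by simp
          with hc have "?h \<le> ereal (?c + (u - D) / \<theta>)" by (meson ereal_less_eq(3) order_trans)
          then show ?thesis using \<theta> 2 by simp
        qed
      qed
    qed
    show "?h \<le> max 0 (exceptional_bound k X u)"
    \<comment> \<open>If the dimension is positive, the maximum with 0 drops out of the estimate at
      each single \<theta>, and the infimum can then be taken.\<close>
    proof (cases "0 < ?h")
      case True
      have "?h - ereal ?c \<le> (INF \<theta>\<in>{0<..1}. (ereal u - fourier_spectrum \<theta> X) / ereal \<theta>)"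
        using each[OF _ _ True] by (intro INF_greatest) (simp add: ereal_minus_le_iff add.commute)
      then have "?h \<le> exceptional_bound k X u"
        unfolding exceptional_bound_def by (simp add: ereal_minus_le_iff add.commute)
      then show ?thesis by (simp add: le_max_iff_disj)
    qed (simp add: not_less le_max_iff_disj)
  qed
qed

end
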